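(* Let $G$ be a countable ICC group and let $\pi:G\to\mathcal U(\mathcal H)$ be a unitary representation of $G$ on a nonzero Hilbert space $\mathcal H$. Assume that there exists a Parseval frame vector $\xi_1$ for $\mathcal H$. For $\xi\in\mathcal H$, let $p_\xi$ be the projection onto the subspace $\overline{\pi(G)'\xi}$. (i) If $\eta$ is a Parseval frame vector for a subspace of $\mathcal H$, then $\mathrm{tr}_{\pi(G)''}(p_\eta)=\|\eta\|^2$. (ii) If $\eta$ is a Parseval frame vector for $\mathcal H$ and $u$ is a unitary operator in $\pi(G)''$, then the Parseval frame vector $u\eta$ is strongly disjoint from $\eta$ if and only if $u\eta$ is orthogonal to the range of $p_\eta$, and in this case $p_\eta\perp p_{u\eta}$. (iii) Let $N\ge 1$, $N\in\mathbb Z$, and suppose $\xi_1,\dots,\xi_{N+1}$ is a strongly disjoint $(N+1)$-tuple of Parseval frame vectors for some subspaces of $\mathcal H$, with $\sum_{i=1}^{N+1}\|\xi_i\|^2=1$. Then the projections $p_{\xi_i}$, $i=1,\dots,N$, are mutually orthogonal, and $p_{\xi_1}+\dots+p_{\xi_{N+1}}=1$.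
   Context: A group $G$ is ICC if for every $g\ne e$ in $G$ the conjugacy class of $g$ is infinite. A family $\{e_i\,|\,i\in I\}$ in a Hilbert space $\mathcal K$ is a Parseval frame for $\mathcal K$ if $\|f\|^2=\sum_{i\in I}|\langle f,e_i\rangle|^2$ for all $f\in\mathcal K$. A vector $\xi\in\mathcal H$ is a Parseval frame vector for $\mathcal H$ if $\{\pi(g)\xi\,|\,g\in G\}$ (indexed by $G$) is a Parseval frame for $\mathcal H$; it is a Parseval frame vector for a (closed) subspace $\mathcal K\subseteq\mathcal H$ if this family is contained in $\mathcal K$ and is a Parseval frame for $\mathcal K$ (so $\mathcal K$ is its closed linear span). Parseval frames $\{e_i^1\},\dots,\{e_i^n\}$ ($i\in I$) for Hilbert spaces $\mathcal H_1,\dots,\mathcal H_n$ form a strongly disjoint $n$-tuple if $\{e_i^1\oplus\dots\oplus e_i^n\,|\,i\in I\}$ is a Parseval frame for $\mathcal H_1\oplus\dots\oplus\mathcal H_n$ (strongly disjoint when $n=2$); Parseval frame vectors are strongly disjoint, or form a strongly disjoint $n$-tuple, if the frames indexed by $G$ which they generate do. $\pi(G)'$ is the commutant of $\pi(G)$, and $\pi(G)''$ is the commutant of $\pi(G)'$, i.e. the von Neumann algebra generated by $\pi(G)$. Under the hypotheses $\pi$ is equivalent to a subrepresentation of the left regular representation and $\pi(G)''$ is a finite factor; $\mathrm{tr}_{\pi(G)''}$ is its unique normalized trace ($\mathrm{tr}(1)=1$). One has $p_\xi\in\pi(G)''$. "Projection" means orthogonal projection. *)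

theory Defs
  imports "HOL-Analysis.Analysis" "HOL-Algebra.Group"
begin

section \<open>Complex Hilbert spaces\<close>

text \<open>
  A complex inner product space is a real one together with a complex scalar multiplication
  extending \<open>(*\<^sub>R)\<close> and a sesquilinear form with real part \<open>(\<bullet>)\<close>; norm and topology are
  those of \<^class>\<open>real_inner\<close>. The form is linear in its \<^emph>\<open>first\<close> argument.
\<close>

class complex_inner = real_inner +
  fixes scaleC :: "complex \<Rightarrow> 'a \<Rightarrow> 'a"  (infixr \<open>*\<^sub>C\<close> 75)
    and cinner :: "'a \<Rightarrow> 'a \<Rightarrow> complex"
  assumes scaleC_add_right: "c *\<^sub>C (x + y) = c *\<^sub>C x + c *\<^sub>C y"
    and scaleC_add_left: "(c + d) *\<^sub>C x = c *\<^sub>C x + d *\<^sub>C x"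
    and scaleC_scaleC: "c *\<^sub>C (d *\<^sub>C x) = (c * d) *\<^sub>C x"
    and scaleC_of_real: "complex_of_real r *\<^sub>C x = r *\<^sub>R x"
    and cinner_add_left: "cinner (x + y) z = cinner x z + cinner y z"
    and cinner_scaleC_left: "cinner (c *\<^sub>C x) y = c * cinner x y"
    and cinner_commute: "cinner x y = cnj (cinner y x)"
    and Re_cinner: "Re (cinner x y) = x \<bullet> y"

class complex_hilbert = complex_inner + complete_space

lemma cinner_self: "cinner x x = complex_of_real ((norm x)\<^sup>2)"
proof -
  have "Im (cinner x x) = 0"
    using cinner_commute[of x x] by (metis complex_cnj cnj.simps(2) equal_neg_zero)
  then show ?thesis
    by (simp add: complex_eq_iff Re_cinner power2_norm_eq_inner)
qed

instantiation complex :: complex_hilbert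
begin

definition scaleC_complex :: "complex \<Rightarrow> complex \<Rightarrow> complex" where
  "scaleC_complex c z = c * z"

definition cinner_complex :: "complex \<Rightarrow> complex \<Rightarrow> complex" where
  "cinner_complex x y = x * cnj y"

instance
  by standard
    (auto simp: scaleC_complex_def cinner_complex_def inner_complex_def algebra_simps
      scaleR_conv_of_real)

end

definition csubspace :: "'h::complex_inner set \<Rightarrow> bool" where
  "csubspace K \<longleftrightarrow> 0 \<in> K \<and> (\<forall>x\<in>K. \<forall>y\<in>K. x + y \<in> K) \<and> (\<forall>c. \<forall>x\<in>K. c *\<^sub>C x \<in> K)"

definition closed_csubspace :: "'h::complex_inner set \<Rightarrow> bool" where
  "closed_csubspace K \<longleftrightarrow> csubspace K \<and> closed K"

definition cproj :: "'h::complex_inner set \<Rightarrow> 'h \<Rightarrow> 'h" where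
  "cproj K x = (THE y. y \<in> K \<and> (\<forall>z\<in>K. cinner (x - y) z = 0))"

definition bounded_clinear :: "('h::complex_inner \<Rightarrow> 'h) \<Rightarrow> bool" where
  "bounded_clinear T \<longleftrightarrow> bounded_linear T \<and> (\<forall>c x. T (c *\<^sub>C x) = c *\<^sub>C T x)"

definition unitary_op :: "('h::complex_inner \<Rightarrow> 'h) \<Rightarrow> bool" where
  "unitary_op U \<longleftrightarrow> bounded_clinear U \<and> surj U \<and> (\<forall>x y. cinner (U x) (U y) = cinner x y)"

definition positive_op :: "('h::complex_inner \<Rightarrow> 'h) \<Rightarrow> bool" where
  "positive_op T \<longleftrightarrow> (\<forall>x. cinner (T x) x \<in> \<real>\<^sub>\<ge>\<^sub>0)"

text \<open>Orthogonality of two projections means that their product vanishes.\<close>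

definition orthogonal_projs :: "('h::complex_inner \<Rightarrow> 'h) \<Rightarrow> ('h \<Rightarrow> 'h) \<Rightarrow> bool" where
  "orthogonal_projs p q \<longleftrightarrow> p \<circ> q = (\<lambda>_. 0)"


section \<open>Groups and unitary representations\<close>

definition icc_group :: "('g, 'm) monoid_scheme \<Rightarrow> bool" where
  "icc_group G \<longleftrightarrow> group G \<and>
     (\<forall>g\<in>carrier G. g \<noteq> \<one>\<^bsub>G\<^esub> \<longrightarrow>
        infinite {h \<otimes>\<^bsub>G\<^esub> g \<otimes>\<^bsub>G\<^esub> inv\<^bsub>G\<^esub> h | h. h \<in> carrier G})"

definition unitary_rep ::
  "('g, 'm) monoid_scheme \<Rightarrow> ('g \<Rightarrow> 'h::complex_inner \<Rightarrow> 'h) \<Rightarrow> bool" where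
  "unitary_rep G \<pi> \<longleftrightarrow>
     (\<forall>g\<in>carrier G. unitary_op (\<pi> g)) \<and>
     (\<forall>g\<in>carrier G. \<forall>h\<in>carrier G. \<pi> (g \<otimes>\<^bsub>G\<^esub> h) = \<pi> g \<circ> \<pi> h)"


section \<open>Commutants and the trace\<close>

definition commutant :: "('h::complex_inner \<Rightarrow> 'h) set \<Rightarrow> ('h \<Rightarrow> 'h) set" where
  "commutant S = {T. bounded_clinear T \<and> (\<forall>A\<in>S. T \<circ> A = A \<circ> T)}"

text \<open>
  The ultraweak topology is the initial topology for the functionals
  \<open>T \<mapsto> \<Sum>n. \<langle>T a\<^sub>n, b\<^sub>n\<rangle>\<close> with square-summable sequences \<open>a\<close>, \<open>b\<close>. It is only used
  through its restrictions to sets of bounded operators, where these series converge.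
\<close>

definition ultraweak_topology :: "('h::complex_inner \<Rightarrow> 'h) topology" where
  "ultraweak_topology = topology_generated_by
     {{T. (\<Sum>n. cinner (T (a n)) (b n)) \<in> U} | (a :: nat \<Rightarrow> 'h) (b :: nat \<Rightarrow> 'h) U.
        summable (\<lambda>n. (norm (a n))\<^sup>2) \<and> summable (\<lambda>n. (norm (b n))\<^sup>2) \<and> open U}"

text \<open>
  As usual for von Neumann algebras, traces are positive and ultraweakly continuous (normal).
  Functionals on \<open>M\<close> are extended by \<^const>\<open>undefined\<close> so that uniqueness
  makes sense in HOL.
\<close>

definition normalized_trace ::
  "('h::complex_inner \<Rightarrow> 'h) set \<Rightarrow> (('h \<Rightarrow> 'h) \<Rightarrow> complex) \<Rightarrow> bool" where
  "normalized_trace M \<tau> \<longleftrightarrow>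
     \<tau> \<in> extensional M \<and>
     (\<forall>S\<in>M. \<forall>T\<in>M. \<tau> (\<lambda>x. S x + T x) = \<tau> S + \<tau> T) \<and>
     (\<forall>c. \<forall>T\<in>M. \<tau> (\<lambda>x. c *\<^sub>C T x) = c * \<tau> T) \<and>
     (\<forall>T\<in>M. positive_op T \<longrightarrow> \<tau> T \<in> \<real>\<^sub>\<ge>\<^sub>0) \<and>
     (\<forall>S\<in>M. \<forall>T\<in>M. \<tau> (S \<circ> T) = \<tau> (T \<circ> S)) \<and>
     continuous_map (subtopology ultraweak_topology M) euclidean \<tau> \<and>
     \<tau> id = 1"

definition tr :: "('h::complex_inner \<Rightarrow> 'h) set \<Rightarrow> ('h \<Rightarrow> 'h) \<Rightarrow> complex" where
  "tr M = (THE \<tau>. normalized_trace M \<tau>)"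


section \<open>Parseval frames\<close>

text \<open>
  Parseval frames for a Hilbert space given by a carrier \<open>K\<close> and an inner product \<open>ip\<close>, so that
  the same notion applies to closed subspaces of a type (with \<^const>\<open>cinner\<close>) and to their
  finite direct sums. The squared norm of \<open>f\<close> is \<open>Re (ip f f)\<close>.
\<close>

definition parseval_frame ::
  "('v \<Rightarrow> 'v \<Rightarrow> complex) \<Rightarrow> 'v set \<Rightarrow> 'i set \<Rightarrow> ('i \<Rightarrow> 'v) \<Rightarrow> bool" where
  "parseval_frame ip K I e \<longleftrightarrow>
     (\<forall>i\<in>I. e i \<in> K) \<and>
     (\<forall>f\<in>K. ((\<lambda>i. (cmod (ip f (e i)))\<^sup>2) has_sum Re (ip f f)) I)"

text \<open>
  The direct sum of the closed subspaces \<open>K j\<close>, \<open>j \<in> J\<close> (\<open>J\<close> finite), has the carrier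
  \<open>Pi\<^sub>E J K\<close> and the inner product below.
\<close>

definition dsum_cinner ::
  "'j set \<Rightarrow> ('j \<Rightarrow> 'h::complex_inner) \<Rightarrow> ('j \<Rightarrow> 'h) \<Rightarrow> complex" where
  "dsum_cinner J f f' = (\<Sum>j\<in>J. cinner (f j) (f' j))"

definition strongly_disjoint_tuple ::
  "nat \<Rightarrow> 'i set \<Rightarrow> (nat \<Rightarrow> 'h::complex_inner set) \<Rightarrow> (nat \<Rightarrow> 'i \<Rightarrow> 'h) \<Rightarrow> bool" where
  "strongly_disjoint_tuple n I K e \<longleftrightarrow>
     (\<forall>j\<in>{1..n}. parseval_frame cinner (K j) I (e j)) \<and>
     parseval_frame (dsum_cinner {1..n}) (Pi\<^sub>E {1..n} K) I (\<lambda>i. \<lambda>j\<in>{1..n}. e j i)"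

definition parseval_frame_vector ::
  "('g, 'm) monoid_scheme \<Rightarrow> ('g \<Rightarrow> 'h::complex_inner \<Rightarrow> 'h) \<Rightarrow> 'h set \<Rightarrow> 'h \<Rightarrow> bool" where
  "parseval_frame_vector G \<pi> K \<xi> \<longleftrightarrow>
     closed_csubspace K \<and> parseval_frame cinner K (carrier G) (\<lambda>g. \<pi> g \<xi>)"

definition strongly_disjoint_vectors ::
  "('g, 'm) monoid_scheme \<Rightarrow> ('g \<Rightarrow> 'h::complex_inner \<Rightarrow> 'h) \<Rightarrow>
     nat \<Rightarrow> (nat \<Rightarrow> 'h set) \<Rightarrow> (nat \<Rightarrow> 'h) \<Rightarrow> bool" where
  "strongly_disjoint_vectors G \<pi> n K \<xi> \<longleftrightarrow>
     (\<forall>j\<in>{1..n}. parseval_frame_vector G \<pi> (K j) (\<xi> j)) \<and>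
     strongly_disjoint_tuple n (carrier G) K (\<lambda>j g. \<pi> g (\<xi> j))"

definition strongly_disjoint_pair ::
  "('g, 'm) monoid_scheme \<Rightarrow> ('g \<Rightarrow> 'h::complex_inner \<Rightarrow> 'h) \<Rightarrow>
     'h set \<Rightarrow> 'h \<Rightarrow> 'h set \<Rightarrow> 'h \<Rightarrow> bool" where
  "strongly_disjoint_pair G \<pi> K \<xi> L \<eta> \<longleftrightarrow>
     strongly_disjoint_vectors G \<pi> 2 (\<lambda>j. if j = 1 then K else L) (\<lambda>j. if j = 1 then \<xi> else \<eta>)"

definition vproj ::
  "('g, 'm) monoid_scheme \<Rightarrow> ('g \<Rightarrow> 'h::complex_inner \<Rightarrow> 'h) \<Rightarrow> 'h \<Rightarrow> 'h \<Rightarrow> 'h" where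
  "vproj G \<pi> \<xi> = cproj (closure ((\<lambda>T. T \<xi>) ` commutant (\<pi> ` carrier G)))"

end

theory Submission
  imports Defs
begin

text \<open>
  The analysis operator \<open>v\<^sub>\<eta> : f \<mapsto> (\<langle>f, \<pi>(g)\<eta>\<rangle>)\<^sub>g\<close> of a Parseval frame vector \<open>\<eta>\<close> for a subspace is a
  partial isometry into \<open>\<ell>\<^sup>2(G)\<close> that intertwines \<open>\<pi>\<close> with the left regular representation, and
  \<open>\<eta> = v\<^sub>\<eta>\<^sup>*\<delta>\<^sub>1\<close>. The proof replaces vectors by such intertwiners: for intertwiners \<open>v\<close>, \<open>w\<close> the
  operator \<open>v\<^sup>*w\<close> lies in \<open>\<pi>(G)'\<close>, and \<open>vw\<^sup>*\<close> commutes with the left translations of \<open>\<ell>\<^sup>2(G)\<close>.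

  To compute the trace of \<open>\<pi>(G)''\<close> one needs to reach \<open>\<delta>\<^sub>1\<close> from \<open>\<H>\<close>. As \<open>G\<close> is ICC, the right
  translates of a single isometric intertwiner separate \<open>\<ell>\<^sup>2(G)\<close> (\<open>translates_separate\<close>), and a greedy
  construction turns them into intertwiners \<open>v\<^sub>k\<close> for which \<open>\<Sum>\<^sub>k v\<^sub>kv\<^sub>k\<^sup>*\<close> is the identity
  (\<open>parseval_pieces\<close>). Hence every \<open>T \<in> \<pi>(G)''\<close> has a lift \<open>T'\<close> to \<open>\<ell>\<^sup>2(G)\<close>, which commutes with the
  right translations and satisfies \<open>w\<^sup>*T' = Tw\<^sup>*\<close> for all intertwiners \<open>w\<close>. The functional
  \<open>\<tau>(T) = \<langle>T'\<delta>\<^sub>1, \<delta>\<^sub>1\<rangle> = \<Sum>\<^sub>k \<langle>Tv\<^sub>k\<^sup>*\<delta>\<^sub>1, v\<^sub>k\<^sup>*\<delta>\<^sub>1\<rangle>\<close> is tracial by its first form and normal by the second. It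
  is the only normalized trace (\<open>trace_unique\<close>): averaging \<open>T\<close> over conjugations by \<open>G\<close> moves
  \<open>T'\<delta>\<^sub>1\<close> towards \<open>\<tau>(T)\<delta>\<^sub>1\<close>, so that the scalar \<open>\<tau>(T)\<close> is a limit of operators on which any trace
  takes the same value as on \<open>T\<close>.

  For (i), the lift of \<open>p\<^sub>\<eta>\<close> sends \<open>\<delta>\<^sub>1\<close> to \<open>v\<^sub>\<eta>\<eta>\<close> (\<open>lift_vproj\<close>), whence \<open>\<tau>(p\<^sub>\<eta>) = \<parallel>\<eta>\<parallel>\<^sup>2\<close>.
  For (ii) and (iii), strong disjointness of \<open>\<xi>\<close> and \<open>\<eta>\<close> amounts to \<open>v\<^sub>\<xi>\<^sup>*v\<^sub>\<eta> = 0\<close>. Since \<open>\<delta>\<^sub>1\<close> also gives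
  a trace on the operators commuting with left translations, this implies \<open>\<pi>(G)'\<xi> \<bottom> \<pi>(G)'\<eta>\<close>
  (\<open>cyc_orthogonal\<close>); conversely \<open>v\<^sub>\<xi>\<^sup>*v\<^sub>\<eta> = 0\<close> if \<open>\<xi>\<close> and \<open>\<eta>\<close> are frame vectors for \<open>\<H>\<close> with
  \<open>\<xi> \<bottom> \<pi>(G)'\<eta>\<close> (\<open>disjoint_if_orthogonal\<close>). That \<open>u\<eta>\<close> is again a frame
  vector is seen by moving the lift of \<open>u\<close> to the other side with the modular conjugation. Finally, orthogonal projections of total trace one
  add up to the identity because \<open>\<tau>\<close> is faithful.
\<close>

section \<open>Complex inner product spaces\<close>

lemma cinner_add_right: "cinner x (y + z) = cinner x y + cinner x (z::'a::complex_inner)"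
  by (metis cinner_add_left cinner_commute complex_cnj_add)

lemma cinner_scaleC_right: "cinner x (c *\<^sub>C y) = cnj c * cinner x (y::'a::complex_inner)"
  by (metis cinner_commute cinner_scaleC_left complex_cnj_mult)

lemma scaleC_minus_one: "(-1) *\<^sub>C x = - (x::'a::complex_inner)"
  using scaleC_of_real[of "-1" x] by simp

lemma scaleC_one [simp]: "1 *\<^sub>C x = (x::'a::complex_inner)"
  using scaleC_of_real[of "1" x] by simp

lemma scaleC_zero_left [simp]: "0 *\<^sub>C x = (0::'a::complex_inner)"
  using scaleC_of_real[of "0" x] by simp

lemma scaleC_zero_right [simp]: "c *\<^sub>C 0 = (0::'a::complex_inner)"
  using scaleC_add_right[of c 0 0] by simp

lemma cinner_minus_left [simp]: "cinner (- x) y = - cinner x (y::'a::complex_inner)"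
  by (metis cinner_scaleC_left mult_minus1 scaleC_minus_one)

lemma cinner_minus_right [simp]: "cinner x (- y) = - cinner x (y::'a::complex_inner)"
  by (metis cinner_commute cinner_minus_left complex_cnj_minus)

lemma cinner_diff_left: "cinner (x - y) z = cinner x z - cinner y (z::'a::complex_inner)"
  using cinner_add_left[of x "-y" z] by simp

lemma cinner_diff_right: "cinner z (x - y) = cinner z x - cinner z (y::'a::complex_inner)"
  using cinner_add_right[of z x "-y"] by simp

lemma cinner_zero_left [simp]: "cinner 0 (y::'a::complex_inner) = 0"
  using cinner_diff_left[of 0 0 y] by simp

lemma cinner_zero_right [simp]: "cinner y (0::'a::complex_inner) = 0"
  using cinner_diff_right[of y 0 0] by simp

lemma cinner_scaleR_left: "cinner (r *\<^sub>R x) y = of_real r * cinner x (y::'a::complex_inner)"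
  by (metis cinner_scaleC_left scaleC_of_real)

lemma cinner_scaleR_right: "cinner x (r *\<^sub>R y) = of_real r * cinner x (y::'a::complex_inner)"
  by (metis cinner_scaleC_right complex_cnj_complex_of_real scaleC_of_real)

lemma cinner_sum_left: "cinner (\<Sum>i\<in>I. f i) (y::'a::complex_inner) = (\<Sum>i\<in>I. cinner (f i) y)"
  by (induction I rule: infinite_finite_induct) (auto simp: cinner_add_left)

lemma cinner_sum_right: "cinner (y::'a::complex_inner) (\<Sum>i\<in>I. f i) = (\<Sum>i\<in>I. cinner y (f i))"
  by (induction I rule: infinite_finite_induct) (auto simp: cinner_add_right)

lemma norm_scaleC [simp]: "norm (c *\<^sub>C x) = cmod c * norm (x::'a::complex_inner)"
proof -
  have "complex_of_real ((norm (c *\<^sub>C x))\<^sup>2) = (c * cnj c) * complex_of_real ((norm x)\<^sup>2)"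
    unfolding cinner_self[symmetric] cinner_scaleC_left cinner_scaleC_right by simp
  also have "\<dots> = complex_of_real ((cmod c * norm x)\<^sup>2)"
    unfolding complex_norm_square[symmetric] by (simp add: power_mult_distrib)
  finally show ?thesis
    by (metis of_real_eq_iff norm_ge_zero power2_eq_imp_eq zero_le_mult_iff)
qed

lemma cmod_cinner_le: "cmod (cinner x y) \<le> norm x * norm (y::'a::complex_inner)"
proof (cases "cinner x y = 0")
  case False
  \<comment> \<open>Rotate \<open>x\<close> so that the complex inner product becomes real, then use the real inequality.\<close>
  define c where "c = cnj (cinner x y) / of_real (cmod (cinner x y))"
  have c: "cmod c = 1"
    using False by (simp add: c_def norm_divide)
  have "cinner (c *\<^sub>C x) y = (cinner x y * cnj (cinner x y)) / of_real (cmod (cinner x y))"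
    by (simp add: cinner_scaleC_left c_def)
  also have "\<dots> = of_real (cmod (cinner x y))"
    unfolding complex_norm_square[symmetric] using False by (simp add: power2_eq_square)
  finally have "cinner (c *\<^sub>C x) y = of_real (cmod (cinner x y))" .
  then have "cmod (cinner x y) = (c *\<^sub>C x) \<bullet> y"
    by (metis Re_cinner Re_complex_of_real)
  also have "\<dots> \<le> norm (c *\<^sub>C x) * norm y"
    by (rule norm_cauchy_schwarz)
  finally show ?thesis using c by simp
qed auto

lemma cinner_eq_zeroD: "(\<And>y. cinner x y = 0) \<Longrightarrow> x = (0::'a::complex_inner)"
  by (metis Re_cinner inner_eq_zero_iff zero_complex.simps(1))

lemma cinner_eqI: "(\<And>z. cinner z x = cinner z y) \<Longrightarrow> x = (y::'a::complex_inner)"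
proof -
  assume "\<And>z. cinner z x = cinner z y"
  then have "cinner (x - y) (x - y) = 0"
    by (simp add: cinner_diff_right)
  then show ?thesis by (simp add: cinner_self)
qed

lemma bounded_bilinear_cinner: "bounded_bilinear (cinner :: 'a::complex_inner \<Rightarrow> 'a \<Rightarrow> complex)"
proof
  show "\<exists>K. \<forall>a b. norm (cinner a b) \<le> norm a * norm (b::'a) * K"
    by (rule exI[of _ 1]) (simp add: cmod_cinner_le)
  show "cinner (r *\<^sub>R a) b = r *\<^sub>R cinner a (b::'a)" for r a b
    by (simp add: cinner_scaleR_left scaleR_conv_of_real)
  show "cinner a (r *\<^sub>R b) = r *\<^sub>R cinner a (b::'a)" for r a b
    by (simp add: cinner_scaleR_right scaleR_conv_of_real)
qed (fact cinner_add_left cinner_add_right)+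

lemmas tendsto_cinner [tendsto_intros] = bounded_bilinear.tendsto[OF bounded_bilinear_cinner]

lemma continuous_on_cinner [continuous_intros]:
  "continuous_on S f \<Longrightarrow> continuous_on S g \<Longrightarrow> continuous_on S (\<lambda>x. cinner (f x) (g x))"
  by (rule bounded_bilinear.continuous_on[OF bounded_bilinear_cinner])

lemma continuous_on_scaleC [continuous_intros]:
  "continuous_on S f \<Longrightarrow> continuous_on S (\<lambda>x. c *\<^sub>C (f x :: 'a::complex_inner))"
proof -
  assume f: "continuous_on S f"
  have "bounded_linear (\<lambda>x::'a. c *\<^sub>C x)"
  proof (rule bounded_linear_intro[where K = "cmod c"])
    show "c *\<^sub>C (r *\<^sub>R x) = r *\<^sub>R (c *\<^sub>C x)" for r and x :: 'a
      by (metis mult.commute scaleC_of_real scaleC_scaleC)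
  qed (simp_all add: scaleC_add_right mult.commute)
  from bounded_linear.continuous_on[OF this f] show ?thesis .
qed

section \<open>Projections onto closed subspaces\<close>

text \<open>By the parallelogram law, a minimising sequence for the norm is Cauchy.\<close>

lemma exists_min_norm:
  fixes C :: "'a::{real_inner, complete_space} set"
  assumes "closed C" "convex C" "C \<noteq> {}"
  shows "\<exists>m\<in>C. \<forall>x\<in>C. norm m \<le> norm x"
proof -
  define d where "d = Inf (norm ` C)"
  have bdd: "bdd_below (norm ` C)" by (auto intro!: bdd_belowI[of _ 0])
  have d_le: "d \<le> norm x" if "x \<in> C" for x
    unfolding d_def using that bdd by (auto intro: cInf_lower)
  have d0: "0 \<le> d"
    unfolding d_def using assms(3) by (auto intro!: cInf_greatest)
  have "\<exists>x\<in>C. norm x < d + inverse (real (Suc n))" for n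
  proof -
    have "Inf (norm ` C) < d + inverse (real (Suc n))" by (simp add: d_def)
    then show ?thesis
      using assms(3) cInf_lessD[of "norm ` C"] by auto
  qed
  then obtain X where X: "\<And>n. X n \<in> C" "\<And>n. norm (X n) < d + inverse (real (Suc n))"
    by metis
  have lim: "(\<lambda>n. norm (X n)) \<longlonglongrightarrow> d"
  proof (rule tendsto_sandwich[of "\<lambda>_. d" _ _ "\<lambda>n. d + inverse (real (Suc n))"])
    show "(\<lambda>n. d + inverse (real (Suc n))) \<longlonglongrightarrow> d"
      using tendsto_add[OF tendsto_const[of d] LIMSEQ_inverse_real_of_nat] by simp
  qed (use X d_le in \<open>auto intro!: always_eventually less_imp_le\<close>)
  have par: "(norm (x - y))\<^sup>2 \<le> 2 * (norm x)\<^sup>2 + 2 * (norm y)\<^sup>2 - 4 * d\<^sup>2" if "x \<in> C" "y \<in> C" for x y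
  proof -
    have "(1/2) *\<^sub>R x + (1/2) *\<^sub>R y \<in> C"
      using assms(2) that by (intro convexD) auto
    then have "d \<le> norm ((1/2) *\<^sub>R (x + y))"
      using d_le by (simp add: scaleR_add_right)
    then have "2 * d \<le> norm (x + y)" by simp
    then have "(2 * d)\<^sup>2 \<le> (norm (x + y))\<^sup>2"
      using d0 by (intro power_mono) auto
    moreover have "(norm (x + y))\<^sup>2 + (norm (x - y))\<^sup>2 = 2 * (norm x)\<^sup>2 + 2 * (norm y)\<^sup>2"
      by (simp add: power2_norm_eq_inner algebra_simps inner_commute)
    ultimately show ?thesis by (simp add: power_mult_distrib)
  qed
  have "Cauchy X"
  proof (rule metric_CauchyI)
    fix e :: real assume e: "0 < e"
    have "(\<lambda>n. (norm (X n))\<^sup>2) \<longlonglongrightarrow> d\<^sup>2" by (intro tendsto_intros lim)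
    then have "\<forall>\<^sub>F n in sequentially. (norm (X n))\<^sup>2 < d\<^sup>2 + e\<^sup>2 / 4"
      by (rule order_tendstoD) (use e in auto)
    then obtain N where N: "\<And>n. n \<ge> N \<Longrightarrow> (norm (X n))\<^sup>2 < d\<^sup>2 + e\<^sup>2 / 4"
      by (auto simp: eventually_sequentially)
    have "dist (X m) (X n) < e" if "m \<ge> N" "n \<ge> N" for m n
    proof -
      have "(norm (X m - X n))\<^sup>2 < e\<^sup>2"
        using par[OF X(1) X(1), of m n] N[OF that(1)] N[OF that(2)] by linarith
      then show ?thesis
        using e by (simp add: dist_norm power2_less_imp_less)
    qed
    then show "\<exists>M. \<forall>m\<ge>M. \<forall>n\<ge>M. dist (X m) (X n) < e" by blast
  qed
  then obtain m where m: "X \<longlonglongrightarrow> m"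
    using Cauchy_convergent convergent_def by blast
  have "m \<in> C" using assms(1) m X(1) closed_sequentially by blast
  moreover have "norm m = d" using LIMSEQ_unique[OF tendsto_norm[OF m] lim] .
  ultimately show ?thesis using d_le by auto
qed

lemma min_norm_unique:
  fixes C :: "'a::real_inner set"
  assumes "convex C" "m \<in> C" "\<And>x. x \<in> C \<Longrightarrow> norm m \<le> norm x" "m' \<in> C" "norm m' = norm m"
  shows "m' = m"
proof -
  have "(1/2) *\<^sub>R m + (1/2) *\<^sub>R m' \<in> C"
    using assms by (intro convexD) auto
  then have "norm m \<le> norm ((1/2) *\<^sub>R (m + m'))"
    using assms(3) by (simp add: scaleR_add_right)
  then have "2 * norm m \<le> norm (m + m')" by simp
  then have "(2 * norm m)\<^sup>2 \<le> (norm (m + m'))\<^sup>2"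
    by (intro power_mono) auto
  moreover have "(norm (m + m'))\<^sup>2 + (norm (m - m'))\<^sup>2 = 2 * (norm m)\<^sup>2 + 2 * (norm m')\<^sup>2"
    by (simp add: power2_norm_eq_inner algebra_simps inner_commute)
  ultimately have "(norm (m - m'))\<^sup>2 \<le> 0"
    unfolding assms(5) power_mult_distrib by (simp add: power2_eq_square)
  then show ?thesis by simp
qed

lemma csubspace_minus: "csubspace K \<Longrightarrow> x \<in> K \<Longrightarrow> - x \<in> (K::'a::complex_inner set)"
  by (metis csubspace_def scaleC_minus_one)

lemma csubspace_diff: "csubspace K \<Longrightarrow> x \<in> K \<Longrightarrow> y \<in> K \<Longrightarrow> x - y \<in> (K::'a::complex_inner set)"
  by (metis csubspace_def csubspace_minus diff_conv_add_uminus)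

lemma csubspace_UNIV: "csubspace UNIV" by (simp add: csubspace_def)

lemma csubspace_convex: "csubspace K \<Longrightarrow> convex (K::'a::complex_inner set)"
  unfolding convex_def csubspace_def by (metis scaleC_of_real)

lemma csubspace_closure:
  assumes K: "csubspace (K::'a::complex_inner set)"
  shows "csubspace (closure K)"
  unfolding csubspace_def
proof (intro conjI ballI allI)
  show "0 \<in> closure K" using K closure_subset unfolding csubspace_def by blast
next
  fix x y assume "x \<in> closure K" "y \<in> closure K"
  then obtain X Y where XY: "\<And>n. X n \<in> K" "X \<longlonglongrightarrow> x" "\<And>n. Y n \<in> K" "Y \<longlonglongrightarrow> y"
    by (auto simp: closure_sequential)
  have "(\<lambda>n. X n + Y n) \<longlonglongrightarrow> x + y" by (intro tendsto_intros XY)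
  moreover have "\<And>n. X n + Y n \<in> K" using K XY unfolding csubspace_def by blast
  ultimately show "x + y \<in> closure K" unfolding closure_sequential by (intro exI conjI allI)
next
  fix c and x assume "x \<in> closure K"
  then obtain X where X: "\<And>n. X n \<in> K" "X \<longlonglongrightarrow> x"
    by (auto simp: closure_sequential)
  have "continuous_on UNIV (\<lambda>x::'a. c *\<^sub>C x)" by (intro continuous_intros)
  then have "(\<lambda>n. c *\<^sub>C X n) \<longlonglongrightarrow> c *\<^sub>C x"
    using X(2) continuous_on_tendsto_compose[of UNIV "(*\<^sub>C) c" X x] by simp
  moreover have "\<And>n. c *\<^sub>C X n \<in> K" using K X unfolding csubspace_def by blast
  ultimately show "c *\<^sub>C x \<in> closure K" unfolding closure_sequential by (intro exI conjI allI)
qed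

text \<open>
  The point \<open>m\<close> of smallest norm in \<open>x + K\<close> is orthogonal to \<open>K\<close>: otherwise subtracting
  its component along some \<open>z \<in> K\<close> would shorten it.
\<close>

lemma exists_projection:
  fixes K :: "'a::complex_hilbert set"
  assumes K: "closed_csubspace K"
  shows "\<exists>y\<in>K. \<forall>z\<in>K. cinner (x - y) z = 0"
proof -
  have cs: "csubspace K" and cl: "closed K" using K by (auto simp: closed_csubspace_def)
  define C where "C = (+) x ` K"
  have "closed C" unfolding C_def using cl by (simp add: closed_translation)
  moreover have "convex C" unfolding C_def using csubspace_convex[OF cs] by (simp add: convex_translation)
  moreover have "C \<noteq> {}" unfolding C_def using cs by (auto simp: csubspace_def)
  ultimately obtain m where m: "m \<in> C" "\<And>z. z \<in> C \<Longrightarrow> norm m \<le> norm z"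
    using exists_min_norm[of C] by metis
  then obtain k where k: "k \<in> K" "m = x + k" by (auto simp: C_def)
  have orth: "cinner m z = 0" if z: "z \<in> K" for z
  proof (cases "z = 0")
    case False
    \<comment> \<open>This \<open>c\<close> minimises \<open>\<parallel>m + c z\<parallel>\<close>.\<close>
    define c where "c = - cinner m z / of_real ((norm z)\<^sup>2)"
    have "k + c *\<^sub>C z \<in> K" using cs k z unfolding csubspace_def by blast
    then have "m + c *\<^sub>C z \<in> C" unfolding C_def k by (auto simp: add.assoc)
    then have "norm m \<le> norm (m + c *\<^sub>C z)" by (rule m(2))
    then have "(norm m)\<^sup>2 \<le> (norm (m + c *\<^sub>C z))\<^sup>2" by (intro power_mono) auto
    also have "complex_of_real ((norm (m + c *\<^sub>C z))\<^sup>2)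
        = complex_of_real ((norm m)\<^sup>2) - of_real ((cmod (cinner m z))\<^sup>2 / (norm z)\<^sup>2)"
    proof -
      have "complex_of_real ((norm (m + c *\<^sub>C z))\<^sup>2) = cinner m m + c * cnj (cinner m z)
          + cnj c * cinner m z + c * cnj c * cinner z z"
        unfolding cinner_self[symmetric] cinner_add_left cinner_add_right cinner_scaleC_left
          cinner_scaleC_right
        by (simp add: cinner_commute[of z m] algebra_simps)
      also have "\<dots> = complex_of_real ((norm m)\<^sup>2)
          - cinner m z * cnj (cinner m z) / of_real ((norm z)\<^sup>2)"
        using False by (simp add: cinner_self c_def field_simps power2_eq_square)
      finally show ?thesis by (simp add: complex_norm_square[symmetric])
    qed
    then have "(norm (m + c *\<^sub>C z))\<^sup>2 = (norm m)\<^sup>2 - (cmod (cinner m z))\<^sup>2 / (norm z)\<^sup>2"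
      unfolding of_real_diff[symmetric] of_real_eq_iff .
    finally have "(cmod (cinner m z))\<^sup>2 / (norm z)\<^sup>2 \<le> 0" by simp
    then show ?thesis using False by (simp add: divide_le_0_iff)
  qed auto
  have "- k \<in> K" using csubspace_minus[OF cs k(1)] .
  moreover have "x - (-k) = m" using k by simp
  ultimately show ?thesis using orth by metis
qed

lemma projection_unique:
  assumes "csubspace K" "y \<in> K" "\<forall>z\<in>K. cinner (x - y) z = 0" "y' \<in> K" "\<forall>z\<in>K. cinner (x - y') z = 0"
  shows "y' = (y::'a::complex_inner)"
proof -
  have d: "y' - y \<in> K" using assms csubspace_diff by blast
  then have "cinner (y' - y) (y' - y) = cinner (x - y) (y' - y) - cinner (x - y') (y' - y)"
    by (simp add: cinner_diff_left)
  also have "\<dots> = 0" using d assms by simp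
  finally show ?thesis by (simp add: cinner_self)
qed

lemma cproj_eqI:
  assumes "csubspace (K::'a::complex_inner set)" "y \<in> K" "\<And>z. z \<in> K \<Longrightarrow> cinner (x - y) z = 0"
  shows "cproj K x = y"
  unfolding cproj_def
proof (rule the_equality)
  show "y \<in> K \<and> (\<forall>z\<in>K. cinner (x - y) z = 0)" using assms by blast
  show "y' = y" if "y' \<in> K \<and> (\<forall>z\<in>K. cinner (x - y') z = 0)" for y'
    using projection_unique[OF assms(1), of y x y'] assms that by blast
qed

lemma
  assumes "closed_csubspace (K::'a::complex_hilbert set)"
  shows cproj_in: "cproj K x \<in> K"
    and cproj_orth: "z \<in> K \<Longrightarrow> cinner (x - cproj K x) z = 0"
proof -
  obtain y where y: "y \<in> K" "\<forall>z\<in>K. cinner (x - y) z = 0"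
    using exists_projection[OF assms] by blast
  have "cproj K x = y"
    by (rule cproj_eqI) (use assms y in \<open>auto simp: closed_csubspace_def\<close>)
  then show "cproj K x \<in> K" "z \<in> K \<Longrightarrow> cinner (x - cproj K x) z = 0" using y by auto
qed

lemma cproj_self: "csubspace K \<Longrightarrow> x \<in> K \<Longrightarrow> cproj K x = (x::'a::complex_inner)"
  by (rule cproj_eqI) auto

lemma orth_closure:
  assumes "\<And>z. z \<in> S \<Longrightarrow> cinner x z = 0" "z \<in> closure S"
  shows "cinner x (z::'a::complex_inner) = 0"
proof -
  have "closure S \<subseteq> {z. cinner x z = 0}"
    by (rule closure_minimal) (auto intro!: closed_Collect_eq continuous_intros simp: assms(1))
  then show ?thesis using assms(2) by auto
qed

section \<open>Bounded complex linear maps and adjoints\<close>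

definition bclinear :: "('a::complex_inner \<Rightarrow> 'b::complex_inner) \<Rightarrow> bool" where
  "bclinear T \<longleftrightarrow> bounded_linear T \<and> (\<forall>c x. T (c *\<^sub>C x) = c *\<^sub>C T x)"

lemma bounded_clinear_iff: "bounded_clinear T \<longleftrightarrow> bclinear T"
  by (simp add: bounded_clinear_def bclinear_def)

lemma bclinearI:
  assumes "\<And>x y. T (x + y) = T x + T y" "\<And>c x. T (c *\<^sub>C x) = c *\<^sub>C T x"
    "\<And>x. norm (T x) \<le> B * norm x"
  shows "bclinear T"
  unfolding bclinear_def
proof
  show "bounded_linear T"
  proof (rule bounded_linear_intro[where K = B])
    show "T (r *\<^sub>R x) = r *\<^sub>R T x" for r x
      unfolding scaleC_of_real[symmetric] by (rule assms(2))
    show "norm (T x) \<le> norm x * B" for x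
      using assms(3)[of x] by (simp add: mult.commute)
  qed (rule assms(1))
qed (use assms(2) in blast)

lemma bclinear_linear: "bclinear T \<Longrightarrow> linear T"
  by (simp add: bclinear_def bounded_linear.linear)

lemma bclinear_scaleC: "bclinear T \<Longrightarrow> T (c *\<^sub>C x) = c *\<^sub>C T x"
  by (simp add: bclinear_def)

lemmas bclinear_add = linear_add[OF bclinear_linear]
  and bclinear_diff = linear_diff[OF bclinear_linear]
  and bclinear_minus = linear_neg[OF bclinear_linear]
  and bclinear_zero = linear_0[OF bclinear_linear]
  and bclinear_sum = linear_sum[OF bclinear_linear]

lemma bclinear_bound:
  assumes "bclinear T" obtains B where "B > 0" "\<And>x. norm (T x) \<le> B * norm x"
proof -
  have "bounded_linear T" using assms by (simp add: bclinear_def)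
  from bounded_linear.pos_bounded[OF this] that show ?thesis by (auto simp: mult.commute)
qed

lemma bclinear_bounded_linear: "bclinear T \<Longrightarrow> bounded_linear T"
  by (simp add: bclinear_def)

lemmas bclinear_tendsto = bounded_linear.tendsto[OF bclinear_bounded_linear]
  and bclinear_continuous = linear_continuous_on[OF bclinear_bounded_linear]

lemma bclinear_compose:
  assumes "bclinear S" "bclinear T" shows "bclinear (\<lambda>x. S (T x))"
  unfolding bclinear_def
  by (simp add: bounded_linear_compose[OF assms[THEN bclinear_bounded_linear]]
      bclinear_scaleC[OF assms(1)] bclinear_scaleC[OF assms(2)])

lemma bclinear_ident: "bclinear (\<lambda>x. x)"
  by (simp add: bclinear_def bounded_linear_ident)

lemma bclinear_zero_map: "bclinear (\<lambda>x. 0)"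
  by (simp add: bclinear_def bounded_linear_zero)

lemma bclinear_plus:
  assumes "bclinear S" "bclinear T" shows "bclinear (\<lambda>x. S x + T x)"
  unfolding bclinear_def
  by (simp add: bounded_linear_add[OF assms[THEN bclinear_bounded_linear]]
      bclinear_scaleC[OF assms(1)] bclinear_scaleC[OF assms(2)] scaleC_add_right)

lemma bclinear_sum_map: "(\<And>i. i \<in> I \<Longrightarrow> bclinear (T i)) \<Longrightarrow> bclinear (\<lambda>x. \<Sum>i\<in>I. T i x)"
  by (induction I rule: infinite_finite_induct) (simp_all add: bclinear_zero_map bclinear_plus)

lemma bclinear_scale:
  assumes T: "bclinear T" shows "bclinear (\<lambda>x. c *\<^sub>C T x)"
proof -
  obtain B where B: "B > 0" "\<And>x. norm (T x) \<le> B * norm x" by (rule bclinear_bound[OF T]) blast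
  show ?thesis
  proof (rule bclinearI[where B = "cmod c * B"])
    show "norm (c *\<^sub>C T x) \<le> cmod c * B * norm x" for x
      using mult_left_mono[OF B(2)[of x], of "cmod c"] by (simp add: mult.assoc)
  qed (simp_all add: bclinear_add[OF T] bclinear_scaleC[OF T] scaleC_add_right scaleC_scaleC
      mult.commute)
qed

lemma bclinear_minus_map: "bclinear S \<Longrightarrow> bclinear T \<Longrightarrow> bclinear (\<lambda>x. S x - T x)"
  using bclinear_plus[OF _ bclinear_scale[of T "-1"], of S] by (simp add: scaleC_minus_one)

text \<open>
  The orthogonal complement of the kernel is spanned by one vector \<open>m\<close>, and \<open>\<phi>\<close> is determined by its
  value at \<open>m\<close>.
\<close>

lemma riesz_representation:
  fixes \<phi> :: "'a::complex_hilbert \<Rightarrow> complex"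
  assumes \<phi>: "bclinear \<phi>"
  shows "\<exists>y. \<forall>x. \<phi> x = cinner x y"
proof (cases "\<forall>x. \<phi> x = 0")
  case True then show ?thesis by (intro exI[of _ 0]) auto
next
  case False
  then obtain x0 where x0: "\<phi> x0 \<noteq> 0" by auto
  define N where "N = {x. \<phi> x = 0}"
  have "closed N"
    unfolding N_def by (intro closed_Collect_eq bclinear_continuous[OF \<phi>] continuous_intros)
  moreover have "csubspace N"
    unfolding csubspace_def N_def using \<phi> by (auto simp: bclinear_add bclinear_scaleC bclinear_zero)
  ultimately have N: "closed_csubspace N" by (simp add: closed_csubspace_def)
  define m where "m = x0 - cproj N x0"
  have orth: "cinner m z = 0" if "z \<in> N" for z
    unfolding m_def by (rule cproj_orth[OF N that])
  have \<phi>m: "\<phi> m = \<phi> x0"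
    using cproj_in[OF N, of x0] by (simp add: m_def bclinear_diff[OF \<phi>] N_def)
  then have m0: "m \<noteq> 0" using x0 bclinear_zero[OF \<phi>] by auto
  have "\<phi> x = cinner x ((cnj (\<phi> m) / of_real ((norm m)\<^sup>2)) *\<^sub>C m)" for x
  proof -
    have "\<phi> ((\<phi> m) *\<^sub>C x - (\<phi> x) *\<^sub>C m) = 0"
      by (simp add: bclinear_diff[OF \<phi>] bclinear_scaleC[OF \<phi>] scaleC_complex_def)
    then have "cinner m ((\<phi> m) *\<^sub>C x - (\<phi> x) *\<^sub>C m) = 0"
      by (intro orth) (simp add: N_def)
    then have "cinner ((\<phi> m) *\<^sub>C x - (\<phi> x) *\<^sub>C m) m = 0"
      by (metis cinner_commute complex_cnj_zero)
    then have "\<phi> m * cinner x m = \<phi> x * of_real ((norm m)\<^sup>2)"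
      by (simp add: cinner_diff_left cinner_scaleC_left cinner_self)
    then show ?thesis using m0 by (simp add: cinner_scaleC_right field_simps)
  qed
  then show ?thesis by blast
qed

text \<open>Riesz representation in the second argument, for each value of the first.\<close>

lemma sesquilinear_representation:
  fixes \<beta> :: "'a::complex_inner \<Rightarrow> 'b::complex_hilbert \<Rightarrow> complex"
  assumes add1: "\<And>x x' y. \<beta> (x + x') y = \<beta> x y + \<beta> x' y"
    and scale1: "\<And>c x y. \<beta> (c *\<^sub>C x) y = c * \<beta> x y"
    and add2: "\<And>x y y'. \<beta> x (y + y') = \<beta> x y + \<beta> x y'"
    and scale2: "\<And>c x y. \<beta> x (c *\<^sub>C y) = cnj c * \<beta> x y"
    and bound: "\<And>x y. cmod (\<beta> x y) \<le> B * norm x * norm y" and B: "0 \<le> B"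
  shows "\<exists>S. bclinear S \<and> (\<forall>x y. cinner (S x) y = \<beta> x y) \<and> (\<forall>x. norm (S x) \<le> B * norm x)"
proof -
  have "\<exists>s. \<forall>y. cnj (\<beta> x y) = cinner y s" for x
  proof (rule riesz_representation)
    show "bclinear (\<lambda>y. cnj (\<beta> x y))"
      by (rule bclinearI[where B = "B * norm x"])
        (use bound in \<open>auto simp: add2 scale2 scaleC_complex_def\<close>)
  qed
  then obtain S where "\<And>x y. cnj (\<beta> x y) = cinner y (S x)" by metis
  then have S: "cinner (S x) y = \<beta> x y" for x y
    by (metis cinner_commute complex_cnj_cnj)
  have b: "norm (S x) \<le> B * norm x" for x
  proof (cases "S x = 0")
    case True then show ?thesis using B by simp
  next
    case False
    have "(norm (S x))\<^sup>2 = cmod (\<beta> x (S x))"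
      unfolding S[symmetric] by (simp add: cinner_self norm_power)
    also have "\<dots> \<le> B * norm x * norm (S x)" by (rule bound)
    finally show ?thesis using False by (simp add: power2_eq_square)
  qed
  have "bclinear S"
  proof (rule bclinearI[where B = B])
    show "S (x + y) = S x + S y" for x y
      by (rule cinner_eqI) (metis S add1 cinner_add_left cinner_commute)
    show "S (c *\<^sub>C x) = c *\<^sub>C S x" for c x
      by (rule cinner_eqI) (metis S scale1 cinner_scaleC_left cinner_commute)
  qed (rule b)
  then show ?thesis using S b by blast
qed

definition adj :: "('a::complex_hilbert \<Rightarrow> 'b::complex_inner) \<Rightarrow> 'b \<Rightarrow> 'a" where
  "adj T = (SOME S. bclinear S \<and> (\<forall>x y. cinner (S y) x = cinner y (T x)))"

lemma
  fixes T :: "'a::complex_hilbert \<Rightarrow> 'b::complex_inner"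
  assumes T: "bclinear T"
  shows bclinear_adj: "bclinear (adj T)"
    and cinner_adj_left: "cinner (adj T y) x = cinner y (T x)"
    and cinner_adj_right: "cinner x (adj T y) = cinner (T x) y"
proof -
  obtain B where B: "B > 0" "\<And>x. norm (T x) \<le> B * norm x"
    by (rule bclinear_bound[OF T]) blast
  have "\<exists>S. bclinear S \<and> (\<forall>y x. cinner (S y) x = cinner y (T x)) \<and> (\<forall>x. norm (S x) \<le> B * norm x)"
  proof (rule sesquilinear_representation)
    fix x :: 'b and y :: 'a
    have "cmod (cinner x (T y)) \<le> norm x * norm (T y)" by (rule cmod_cinner_le)
    also have "\<dots> \<le> norm x * (B * norm y)" using B by (intro mult_left_mono) auto
    finally show "cmod (cinner x (T y)) \<le> B * norm x * norm y" by (simp add: mult_ac)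
  qed (use B in \<open>simp_all add: cinner_add_left cinner_add_right cinner_scaleC_left
      cinner_scaleC_right bclinear_add[OF T] bclinear_scaleC[OF T]\<close>)
  then have "\<exists>S. bclinear S \<and> (\<forall>x y. cinner (S y) x = cinner y (T x))" by blast
  from someI_ex[OF this] have *: "bclinear (adj T)" "\<And>x y. cinner (adj T y) x = cinner y (T x)"
    unfolding adj_def[symmetric] by auto
  then show "bclinear (adj T)" "cinner (adj T y) x = cinner y (T x)" by auto
  show "cinner x (adj T y) = cinner (T x) y" by (metis * cinner_commute)
qed

lemma adj_eqI:
  fixes T :: "'a::complex_hilbert \<Rightarrow> 'b::complex_inner"
  assumes "bclinear T" "\<And>x y. cinner (T x) y = cinner x (S y)"
  shows "adj T = S"
proof
  show "adj T y = S y" for y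
    by (rule cinner_eqI) (simp add: cinner_adj_right[OF assms(1)] assms(2))
qed

lemma adj_adj:
  fixes T :: "'a::complex_hilbert \<Rightarrow> 'b::complex_hilbert"
  assumes "bclinear T" shows "adj (adj T) = T"
  by (rule adj_eqI) (simp_all add: bclinear_adj assms cinner_adj_left)

lemma adj_compose:
  fixes T :: "'a::complex_hilbert \<Rightarrow> 'b::complex_hilbert" and S :: "'b \<Rightarrow> 'c::complex_inner"
  assumes "bclinear S" "bclinear T"
  shows "adj (\<lambda>x. S (T x)) = (\<lambda>x. adj T (adj S x))"
  by (rule adj_eqI) (simp_all add: bclinear_compose assms cinner_adj_right)

lemma norm_adj_le:
  fixes T :: "'a::complex_hilbert \<Rightarrow> 'b::complex_inner"
  assumes T: "bclinear T" and B: "\<And>x. norm (T x) \<le> B * norm x" "0 \<le> B"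
  shows "norm (adj T y) \<le> B * norm y"
proof (cases "adj T y = 0")
  case True then show ?thesis using B(2) by simp
next
  case False
  have "(norm (adj T y))\<^sup>2 = cmod (cinner (T (adj T y)) y)"
    unfolding cinner_adj_right[OF T, symmetric] by (simp add: cinner_self norm_power)
  also have "\<dots> \<le> norm (T (adj T y)) * norm y" by (rule cmod_cinner_le)
  also have "\<dots> \<le> (B * norm (adj T y)) * norm y" by (intro mult_right_mono B) auto
  finally show ?thesis using False by (simp add: power2_eq_square mult_ac)
qed

text \<open>The imaginary part of \<open>\<phi> x\<close> is minus the real part of \<open>\<phi> (\<i> x)\<close>.\<close>

lemma zero_if_Re_zero:
  assumes "\<And>x. x \<in> K \<Longrightarrow> Re (\<phi> x) = 0" "\<And>x. x \<in> K \<Longrightarrow> \<i> *\<^sub>C x \<in> K"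
    "\<And>x. x \<in> K \<Longrightarrow> \<phi> (\<i> *\<^sub>C x) = \<i> * \<phi> x" "x \<in> K"
  shows "\<phi> x = (0::complex)"
proof -
  have "Re (\<phi> x) = 0" "Re (\<i> * \<phi> x) = 0" using assms by metis+
  then show ?thesis by (simp add: complex_eq_iff)
qed

section \<open>The Hilbert space of square-summable families\<close>

text \<open>
  The index set is a whole type. For the carrier of a group, \<open>\<ell>\<^sup>2\<close> will be the subspace of the
  families that vanish outside the carrier.
\<close>

typedef 'i ell2 = "{f :: 'i \<Rightarrow> complex. (\<lambda>i. (cmod (f i))\<^sup>2) summable_on UNIV}"
  morphisms coord Ell2
  by (rule exI[of _ "\<lambda>_. 0"]) simp

lemma coord_summable: "(\<lambda>i. (cmod (coord f i))\<^sup>2) summable_on A"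
  using coord[of f] summable_on_subset_banach[of _ UNIV A] by auto

lemma coord_Ell2: "(\<lambda>i. (cmod (f i))\<^sup>2) summable_on UNIV \<Longrightarrow> coord (Ell2 f) = f"
  by (simp add: Ell2_inverse)

lemma ell2_eqI: "(\<And>i. coord f i = coord g i) \<Longrightarrow> f = g"
  by (metis coord_inject ext)

lemma square_summable_add:
  assumes "(\<lambda>i. (cmod (f i))\<^sup>2) summable_on A" "(\<lambda>i. (cmod (g i))\<^sup>2) summable_on A"
  shows "(\<lambda>i. (cmod (f i + g i))\<^sup>2) summable_on A"
proof (rule summable_on_comparison_test)
  show "(\<lambda>i. 2 * (cmod (f i))\<^sup>2 + 2 * (cmod (g i))\<^sup>2) summable_on A"
    by (intro summable_on_add summable_on_cmult_right assms)
  show "(cmod (f i + g i))\<^sup>2 \<le> 2 * (cmod (f i))\<^sup>2 + 2 * (cmod (g i))\<^sup>2" for i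
  proof -
    have "(cmod (f i + g i))\<^sup>2 \<le> (cmod (f i) + cmod (g i))\<^sup>2"
      by (intro power_mono norm_triangle_ineq) auto
    also have "\<dots> \<le> 2 * (cmod (f i))\<^sup>2 + 2 * (cmod (g i))\<^sup>2"
      using sum_squares_bound[of "cmod (f i)" "cmod (g i)"] by (simp add: power2_sum)
    finally show ?thesis .
  qed
qed auto

lemma square_summable_scale:
  "(\<lambda>i. (cmod (f i))\<^sup>2) summable_on A \<Longrightarrow> (\<lambda>i. (cmod (c * f i))\<^sup>2) summable_on A"
  by (simp add: norm_mult power_mult_distrib summable_on_cmult_right)

lemma square_summable_product:
  assumes "(\<lambda>i. (cmod (f i))\<^sup>2) summable_on A" "(\<lambda>i. (cmod (g i))\<^sup>2) summable_on A"
  shows "(\<lambda>i. f i * cnj (g i)) summable_on A"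
proof (rule abs_summable_summable, rule summable_on_comparison_test)
  show "(\<lambda>i. (cmod (f i))\<^sup>2 + (cmod (g i))\<^sup>2) summable_on A"
    by (intro summable_on_add assms)
  show "cmod (f i * cnj (g i)) \<le> (cmod (f i))\<^sup>2 + (cmod (g i))\<^sup>2" for i
  proof -
    have "2 * (cmod (f i) * cmod (g i)) \<le> (cmod (f i))\<^sup>2 + (cmod (g i))\<^sup>2"
      using sum_squares_bound[of "cmod (f i)" "cmod (g i)"] by simp
    moreover have "0 \<le> cmod (f i) * cmod (g i)" by simp
    ultimately show ?thesis unfolding norm_mult complex_mod_cnj by linarith
  qed
qed auto

lemma coord_product_summable: "(\<lambda>i. coord f i * cnj (coord g i)) summable_on A"
  by (intro square_summable_product coord_summable)

instantiation ell2 :: (type) complex_inner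
begin

definition "0 = Ell2 (\<lambda>_. 0)"
definition "f + g = Ell2 (\<lambda>i. coord f i + coord g i)"
definition "- f = Ell2 (\<lambda>i. - coord f i)"
definition "f - g = Ell2 (\<lambda>i. coord f i - coord g i)"
definition scaleR_ell2 :: "real \<Rightarrow> 'a ell2 \<Rightarrow> 'a ell2" where
  "scaleR_ell2 r f = Ell2 (\<lambda>i. of_real r * coord f i)"
definition scaleC_ell2 :: "complex \<Rightarrow> 'a ell2 \<Rightarrow> 'a ell2" where
  "scaleC_ell2 c f = Ell2 (\<lambda>i. c * coord f i)"
definition cinner_ell2 :: "'a ell2 \<Rightarrow> 'a ell2 \<Rightarrow> complex" where
  "cinner_ell2 f g = (\<Sum>\<^sub>\<infinity>i. coord f i * cnj (coord g i))"
definition inner_ell2 :: "'a ell2 \<Rightarrow> 'a ell2 \<Rightarrow> real" where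
  "inner_ell2 f g = Re (cinner f g)"
definition norm_ell2 :: "'a ell2 \<Rightarrow> real" where
  "norm_ell2 f = sqrt (f \<bullet> f)"
definition dist_ell2 :: "'a ell2 \<Rightarrow> 'a ell2 \<Rightarrow> real" where
  "dist_ell2 f g = norm (f - g)"
definition sgn_ell2 :: "'a ell2 \<Rightarrow> 'a ell2" where
  "sgn_ell2 f = inverse (norm f) *\<^sub>R f"
definition uniformity_ell2 :: "('a ell2 \<times> 'a ell2) filter" where
  "uniformity_ell2 = (INF e\<in>{0 <..}. principal {(f, g). dist f g < e})"
definition open_ell2 :: "'a ell2 set \<Rightarrow> bool" where
  "open_ell2 U = (\<forall>x\<in>U. eventually (\<lambda>(x', y). x' = x \<longrightarrow> y \<in> U) uniformity)"

lemma coord_zero_raw: "coord 0 = (\<lambda>_. 0)"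
  by (simp add: zero_ell2_def coord_Ell2)

lemma coord_add_raw: "coord (f + g) = (\<lambda>i. coord f i + coord g i)"
  by (simp add: plus_ell2_def coord_Ell2 square_summable_add coord_summable)

lemma coord_scaleC_raw: "coord (c *\<^sub>C f) = (\<lambda>i. c * coord f i)"
  by (simp add: scaleC_ell2_def coord_Ell2 square_summable_scale coord_summable)

lemma coord_scaleR_raw: "coord (r *\<^sub>R f) = (\<lambda>i. of_real r * coord f i)"
  by (simp add: scaleR_ell2_def coord_Ell2 square_summable_scale coord_summable)

lemma coord_uminus_raw: "coord (- f) = (\<lambda>i. - coord f i)"
  by (simp add: uminus_ell2_def coord_Ell2 coord_summable)

lemma coord_minus_raw: "coord (f - g) = (\<lambda>i. coord f i - coord g i)"
  using square_summable_add[of "coord f" UNIV "\<lambda>i. - coord g i"]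
  by (simp add: minus_ell2_def coord_Ell2 coord_summable)

lemmas coord_simps [simp] = coord_zero_raw coord_add_raw coord_scaleC_raw coord_scaleR_raw
  coord_uminus_raw coord_minus_raw

instance
proof
  fix f g h :: "'a ell2" and r s :: real and c d :: complex
  show "f + g + h = f + (g + h)" "f + g = g + f" "0 + f = f" "- f + f = 0" "f - g = f + - g"
    "r *\<^sub>R (f + g) = r *\<^sub>R f + r *\<^sub>R g" "(r + s) *\<^sub>R f = r *\<^sub>R f + s *\<^sub>R f"
    "r *\<^sub>R s *\<^sub>R f = (r * s) *\<^sub>R f" "1 *\<^sub>R f = f"
    "c *\<^sub>C (f + g) = c *\<^sub>C f + c *\<^sub>C g" "(c + d) *\<^sub>C f = c *\<^sub>C f + d *\<^sub>C f"
    "c *\<^sub>C d *\<^sub>C f = (c * d) *\<^sub>C f" "complex_of_real r *\<^sub>C f = r *\<^sub>R f"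
    by (auto intro!: ell2_eqI simp: algebra_simps)
  show "dist f g = norm (f - g)" by (rule dist_ell2_def)
  show "sgn f = inverse (norm f) *\<^sub>R f" by (rule sgn_ell2_def)
  show "uniformity = (INF e\<in>{0 <..}. principal {(f :: 'a ell2, g). dist f g < e})"
    by (rule uniformity_ell2_def)
  show "open U = (\<forall>x\<in>U. \<forall>\<^sub>F (x', y) in uniformity. x' = x \<longrightarrow> y \<in> U)" for U :: "'a ell2 set"
    by (rule open_ell2_def)
  show add: "cinner (f + g) h = cinner f h + cinner g h" for f g h :: "'a ell2"
    unfolding cinner_ell2_def
    by (simp add: ring_distribs infsum_add coord_product_summable)
  show scale: "cinner (c *\<^sub>C f) g = c * cinner f g" for c and f g :: "'a ell2"
    unfolding cinner_ell2_def by (simp add: mult.assoc infsum_cmult_right')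
  show comm: "cinner f g = cnj (cinner g f)" for f g :: "'a ell2"
    unfolding cinner_ell2_def by (simp add: mult.commute flip: infsum_cnj)
  show "Re (cinner f g) = f \<bullet> g" by (simp add: inner_ell2_def)
  show "f \<bullet> g = g \<bullet> f" by (metis inner_ell2_def comm cnj.simps(1))
  show "(f + g) \<bullet> h = f \<bullet> h + g \<bullet> h" by (simp add: inner_ell2_def add)
  have "r *\<^sub>R f = of_real r *\<^sub>C f" by (rule ell2_eqI) simp
  then show "(r *\<^sub>R f) \<bullet> g = r * (f \<bullet> g)" by (simp add: inner_ell2_def scale)
  have "f \<bullet> f = (\<Sum>\<^sub>\<infinity>i. Re (coord f i * cnj (coord f i)))"
    unfolding inner_ell2_def cinner_ell2_def
    by (rule infsum_Re[symmetric]) (rule coord_product_summable)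
  also have "\<dots> = (\<Sum>\<^sub>\<infinity>i. (cmod (coord f i))\<^sup>2)"
    by (simp add: cmod_power2 flip: power2_eq_square)
  finally have ff: "f \<bullet> f = (\<Sum>\<^sub>\<infinity>i. (cmod (coord f i))\<^sup>2)" .
  then show "0 \<le> f \<bullet> f" by (simp add: infsum_nonneg)
  have "f = 0" if "f \<bullet> f = 0"
  proof (rule ell2_eqI)
    show "coord f i = coord 0 i" for i
      using nonneg_infsum_le_0D[of "\<lambda>i. (cmod (coord f i))\<^sup>2" UNIV i] that
      by (simp add: ff coord_summable)
  qed
  then show "(f \<bullet> f = 0) = (f = 0)" by (auto simp: ff)
  show "norm f = sqrt (f \<bullet> f)" by (rule norm_ell2_def)
qed

end

lemma cinner_ell2_has_sum: "((\<lambda>i. coord f i * cnj (coord g i)) has_sum cinner f g) UNIV"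
  unfolding cinner_ell2_def by (intro has_sum_infsum coord_product_summable)

lemma norm_ell2_has_sum: "((\<lambda>i. (cmod (coord f i))\<^sup>2) has_sum (norm f)\<^sup>2) UNIV"
proof -
  have "((\<lambda>i. Re (coord f i * cnj (coord f i))) has_sum Re (cinner f f)) UNIV"
    by (intro has_sum_Re cinner_ell2_has_sum)
  then show ?thesis
    by (simp add: cinner_self cmod_power2 flip: power2_eq_square)
qed

lemma sum_coord_le: "finite F \<Longrightarrow> (\<Sum>i\<in>F. (cmod (coord f i))\<^sup>2) \<le> (norm f)\<^sup>2"
  using finite_sum_le_has_sum[OF norm_ell2_has_sum, of F f] by auto

lemma coord_le_norm: "cmod (coord f i) \<le> norm f"
  by (rule power2_le_imp_le) (use sum_coord_le[of "{i}" f] in simp_all)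

text \<open>The coordinates of a Cauchy sequence converge, and the bound on finite partial sums of
  \<open>\<parallel>X m - X n\<parallel>\<^sup>2\<close> passes to the limit.\<close>

instance ell2 :: (type) complex_hilbert
proof
  fix X :: "nat \<Rightarrow> 'a ell2"
  assume X: "Cauchy X"
  have "Cauchy (\<lambda>n. coord (X n) i)" for i
  proof (rule metric_CauchyI)
    fix e :: real assume "0 < e"
    then obtain M where M: "\<And>m n. m \<ge> M \<Longrightarrow> n \<ge> M \<Longrightarrow> dist (X m) (X n) < e"
      using metric_CauchyD[OF X] by blast
    have "dist (coord (X m) i) (coord (X n) i) < e" if "m \<ge> M" "n \<ge> M" for m n
      using M[OF that] coord_le_norm[of "X m - X n" i] by (simp add: dist_norm)
    then show "\<exists>M. \<forall>m\<ge>M. \<forall>n\<ge>M. dist (coord (X m) i) (coord (X n) i) < e" by blast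
  qed
  then have "\<forall>i. \<exists>x. (\<lambda>n. coord (X n) i) \<longlonglongrightarrow> x"
    using Cauchy_convergent convergent_def by blast
  then obtain x where x: "\<And>i. (\<lambda>n. coord (X n) i) \<longlonglongrightarrow> x i" by metis
  have tail: "\<exists>M. \<forall>m\<ge>M. \<forall>F. finite F \<longrightarrow> (\<Sum>i\<in>F. (cmod (coord (X m) i - x i))\<^sup>2) \<le> e\<^sup>2"
    if e: "0 < e" for e :: real
  proof -
    obtain M where M: "\<And>m n. m \<ge> M \<Longrightarrow> n \<ge> M \<Longrightarrow> dist (X m) (X n) < e"
      using metric_CauchyD[OF X e] by blast
    have "(\<Sum>i\<in>F. (cmod (coord (X m) i - x i))\<^sup>2) \<le> e\<^sup>2" if m: "m \<ge> M" and F: "finite F" for m F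
    proof (rule tendsto_upperbound)
      show "(\<lambda>n. \<Sum>i\<in>F. (cmod (coord (X m) i - coord (X n) i))\<^sup>2)
          \<longlonglongrightarrow> (\<Sum>i\<in>F. (cmod (coord (X m) i - x i))\<^sup>2)"
        by (intro tendsto_intros x)
      have "(\<Sum>i\<in>F. (cmod (coord (X m) i - coord (X n) i))\<^sup>2) \<le> e\<^sup>2" if "n \<ge> M" for n
      proof -
        have "(\<Sum>i\<in>F. (cmod (coord (X m - X n) i))\<^sup>2) \<le> (norm (X m - X n))\<^sup>2"
          by (rule sum_coord_le[OF F])
        also have "\<dots> \<le> e\<^sup>2"
          using M[OF m that] by (intro power_mono) (auto simp: dist_norm)
        finally show ?thesis by simp
      qed
      then show "\<forall>\<^sub>F n in sequentially. (\<Sum>i\<in>F. (cmod (coord (X m) i - coord (X n) i))\<^sup>2) \<le> e\<^sup>2"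
        by (auto simp: eventually_sequentially)
    qed simp
    then show ?thesis by blast
  qed
  obtain M where M: "\<And>F. finite F \<Longrightarrow> (\<Sum>i\<in>F. (cmod (coord (X M) i - x i))\<^sup>2) \<le> 1"
    using tail[of 1] by auto
  have "(\<lambda>i. (cmod (coord (X M) i - x i))\<^sup>2) summable_on UNIV"
    by (rule nonneg_bdd_above_summable_on) (use M in \<open>auto intro!: bdd_aboveI[of _ 1]\<close>)
  then have "(\<lambda>i. (cmod (- 1 * (coord (X M) i - x i)))\<^sup>2) summable_on UNIV"
    by (rule square_summable_scale)
  from square_summable_add[OF coord_summable[of "X M"] this]
  have "(\<lambda>i. (cmod (x i))\<^sup>2) summable_on UNIV" by simp
  then have cx: "coord (Ell2 x) = x" by (rule coord_Ell2)
  have "X \<longlonglongrightarrow> Ell2 x"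
  proof (rule metric_LIMSEQ_I)
    fix r :: real assume r: "0 < r"
    then obtain M where M: "\<And>m F. m \<ge> M \<Longrightarrow> finite F
        \<Longrightarrow> (\<Sum>i\<in>F. (cmod (coord (X m) i - x i))\<^sup>2) \<le> (r / 2)\<^sup>2"
      using tail[of "r / 2"] by auto
    have "dist (X m) (Ell2 x) < r" if m: "m \<ge> M" for m
    proof -
      have "(norm (X m - Ell2 x))\<^sup>2 \<le> (r / 2)\<^sup>2"
        by (rule has_sum_le_finite_sums[OF norm_ell2_has_sum]) (use M[OF m] cx in auto)
      then have "norm (X m - Ell2 x) \<le> r / 2"
        by (rule power2_le_imp_le) (use r in simp)
      then show ?thesis using r by (simp add: dist_norm)
    qed
    then show "\<exists>M. \<forall>m\<ge>M. dist (X m) (Ell2 x) < r" by blast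
  qed
  then show "convergent X" by (auto simp: convergent_def)
qed

text \<open>The point masses \<open>\<delta>\<^sub>g\<close>.\<close>

definition basis :: "'i \<Rightarrow> 'i ell2" where
  "basis g = Ell2 (\<lambda>i. if i = g then 1 else 0)"

lemma coord_basis: "coord (basis g) i = (if i = g then 1 else 0)"
proof -
  have "(\<lambda>i. (cmod (if i = g then 1 else 0))\<^sup>2) summable_on UNIV"
    by (rule finite_nonzero_values_imp_summable_on) (auto intro: finite_subset[of _ "{g}"])
  then show ?thesis unfolding basis_def by (simp add: coord_Ell2)
qed

lemma cinner_basis_right: "cinner f (basis g) = coord f g"
proof -
  have "((\<lambda>i. coord f i * cnj (coord (basis g) i)) has_sum coord f g) UNIV"
    by (rule has_sum_finite_neutralI[of "{g}"]) (auto simp: coord_basis)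
  then show ?thesis using cinner_ell2_has_sum[of f "basis g"] has_sum_unique by blast
qed

lemma cinner_basis_left: "cinner (basis g) f = cnj (coord f g)"
  by (metis cinner_basis_right cinner_commute)

section \<open>Commutants\<close>

lemma commutantI:
  "bclinear T \<Longrightarrow> (\<And>A x. A \<in> S \<Longrightarrow> T (A x) = A (T x)) \<Longrightarrow> T \<in> commutant S"
  by (auto simp: commutant_def bounded_clinear_iff o_def)

lemma commutant_bclinear: "T \<in> commutant S \<Longrightarrow> bclinear T"
  by (simp add: commutant_def bounded_clinear_iff)

lemma commutant_commute: "T \<in> commutant S \<Longrightarrow> A \<in> S \<Longrightarrow> T (A x) = A (T x)"
  unfolding commutant_def o_def by (metis (mono_tags, lifting) mem_Collect_eq)

lemma commutant_image: "T \<in> commutant (U ` I) \<Longrightarrow> i \<in> I \<Longrightarrow> T (U i x) = U i (T x)"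
  by (rule commutant_commute) auto

lemma commutant_ident: "(\<lambda>x. x) \<in> commutant S"
  by (rule commutantI) (simp_all add: bclinear_ident)

lemma commutant_compose: "A \<in> commutant S \<Longrightarrow> B \<in> commutant S \<Longrightarrow> (\<lambda>x. A (B x)) \<in> commutant S"
  by (rule commutantI) (simp_all add: bclinear_compose commutant_bclinear commutant_commute)

lemma commutant_plus:
  assumes "\<And>A. A \<in> S \<Longrightarrow> bclinear A" "T \<in> commutant S" "U \<in> commutant S"
  shows "(\<lambda>x. T x + U x) \<in> commutant S"
  using assms
  by (intro commutantI) (simp_all add: bclinear_plus commutant_bclinear commutant_commute bclinear_add)

lemma commutant_scale:
  assumes "\<And>A. A \<in> S \<Longrightarrow> bclinear A" "T \<in> commutant S"
  shows "(\<lambda>x. c *\<^sub>C T x) \<in> commutant S"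
  using assms
  by (intro commutantI) (simp_all add: bclinear_scale commutant_bclinear commutant_commute bclinear_scaleC)

lemma commutant_minus:
  assumes "\<And>A. A \<in> S \<Longrightarrow> bclinear A" "T \<in> commutant S" "U \<in> commutant S"
  shows "(\<lambda>x. T x - U x) \<in> commutant S"
  using assms
  by (intro commutantI) (simp_all add: bclinear_minus_map commutant_bclinear commutant_commute bclinear_diff)

lemma commutant_adj:
  fixes S :: "('h::complex_hilbert \<Rightarrow> 'h) set"
  assumes S: "\<And>A. A \<in> S \<Longrightarrow> bclinear A \<and> adj A \<in> S" and T: "T \<in> commutant S"
  shows "adj T \<in> commutant S"
proof (rule commutantI)
  show "bclinear (adj T)" using T by (simp add: bclinear_adj commutant_bclinear)
  fix A x assume A: "A \<in> S"
  have T': "bclinear T" by (rule commutant_bclinear[OF T])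
  show "adj T (A x) = A (adj T x)"
  proof (rule cinner_eqI)
    fix z
    have "cinner z (adj T (A x)) = cinner (adj A (T z)) x"
      using A S by (simp add: cinner_adj_right T' cinner_adj_left)
    also have "\<dots> = cinner (T (adj A z)) x"
      using A S T commutant_commute by metis
    also have "\<dots> = cinner z (A (adj T x))"
      using A S by (simp add: cinner_adj_right[OF T', symmetric] cinner_adj_left)
    finally show "cinner z (adj T (A x)) = cinner z (A (adj T x))" .
  qed
qed

section \<open>The regular representations\<close>

text \<open>
  Operators on \<open>\<ell>\<^sup>2\<close> given by composing with a map \<open>\<sigma>\<close> of the index set \<open>A\<close>; coordinates outside
  \<open>A\<close> are set to zero, so that \<open>\<ell>\<^sup>2(A)\<close> is treated as a subspace.
\<close>

definition pull :: "'i set \<Rightarrow> ('i \<Rightarrow> 'i) \<Rightarrow> 'i ell2 \<Rightarrow> 'i ell2" where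
  "pull A \<sigma> f = Ell2 (\<lambda>k. if k \<in> A then coord f (\<sigma> k) else 0)"

context
  fixes A :: "'i set" and \<sigma> :: "'i \<Rightarrow> 'i"
  assumes \<sigma>: "inj_on \<sigma> A"
begin

lemma pull_has_sum:
  "((\<lambda>k. (cmod (if k \<in> A then coord f (\<sigma> k) else 0))\<^sup>2) has_sum (\<Sum>\<^sub>\<infinity>k\<in>\<sigma> ` A. (cmod (coord f k))\<^sup>2)) UNIV"
proof -
  have "((\<lambda>k. (cmod (coord f k))\<^sup>2) has_sum (\<Sum>\<^sub>\<infinity>k\<in>\<sigma> ` A. (cmod (coord f k))\<^sup>2)) (\<sigma> ` A)"
    by (intro has_sum_infsum coord_summable)
  then have "((\<lambda>k. (cmod (coord f (\<sigma> k)))\<^sup>2) has_sum (\<Sum>\<^sub>\<infinity>k\<in>\<sigma> ` A. (cmod (coord f k))\<^sup>2)) A"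
    by (simp add: has_sum_reindex[OF \<sigma>] o_def)
  then show ?thesis
    by (rule has_sum_cong_neutral[THEN iffD1, rotated -1]) auto
qed

lemma coord_pull: "coord (pull A \<sigma> f) k = (if k \<in> A then coord f (\<sigma> k) else 0)"
  unfolding pull_def by (subst coord_Ell2) (use pull_has_sum[of f] has_sum_imp_summable in auto)

lemma norm_pull_le: "norm (pull A \<sigma> f) \<le> norm f"
proof (rule power2_le_imp_le)
  have "(norm (pull A \<sigma> f))\<^sup>2 = (\<Sum>\<^sub>\<infinity>k\<in>\<sigma> ` A. (cmod (coord f k))\<^sup>2)"
    using has_sum_unique[OF norm_ell2_has_sum[of "pull A \<sigma> f", unfolded coord_pull] pull_has_sum] .
  also have "\<dots> \<le> (norm f)\<^sup>2"
    by (rule has_sum_mono_neutral[OF has_sum_infsum[OF coord_summable] norm_ell2_has_sum]) auto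
  finally show "(norm (pull A \<sigma> f))\<^sup>2 \<le> (norm f)\<^sup>2" .
qed auto

lemma bclinear_pull: "bclinear (pull A \<sigma>)"
  by (rule bclinearI[where B = 1])
    (auto intro!: ell2_eqI simp: coord_pull norm_pull_le)

end

lemma cinner_pull:
  assumes \<sigma>: "\<And>k. k \<in> A \<Longrightarrow> \<sigma> k \<in> A" "\<And>k. k \<in> A \<Longrightarrow> \<tau> (\<sigma> k) = k"
    and \<tau>: "\<And>k. k \<in> A \<Longrightarrow> \<tau> k \<in> A" "\<And>k. k \<in> A \<Longrightarrow> \<sigma> (\<tau> k) = k"
  shows "cinner (pull A \<sigma> f) h = cinner f (pull A \<tau> h)"
proof -
  have inj: "inj_on \<sigma> A" "inj_on \<tau> A" using \<sigma>(2) \<tau>(2) by (auto intro: inj_on_inverseI)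
  have "((\<lambda>k. coord (pull A \<sigma> f) k * cnj (coord h k)) has_sum cinner (pull A \<sigma> f) h) UNIV"
    by (rule cinner_ell2_has_sum)
  then have "((\<lambda>k. coord f (\<sigma> k) * cnj (coord h k)) has_sum cinner (pull A \<sigma> f) h) A"
    by (rule has_sum_cong_neutral[THEN iffD1, rotated -1]) (auto simp: coord_pull inj)
  then have "((\<lambda>k. coord f k * cnj (coord h (\<tau> k))) has_sum cinner (pull A \<sigma> f) h) A"
    by (rule has_sum_reindex_bij_witness[THEN iffD1, of A \<tau> \<sigma> A, rotated -1])
      (use \<sigma> \<tau> in auto)
  then have "((\<lambda>k. coord f k * cnj (coord (pull A \<tau> h) k)) has_sum cinner (pull A \<sigma> f) h) UNIV"
    by (rule has_sum_cong_neutral[THEN iffD1, rotated -1]) (auto simp: coord_pull inj)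
  then show ?thesis using cinner_ell2_has_sum has_sum_unique by blast
qed

context group
begin

definition lam :: "'a \<Rightarrow> 'a ell2 \<Rightarrow> 'a ell2" where
  "lam g = pull (carrier G) (\<lambda>k. inv g \<otimes> k)"

definition rho :: "'a \<Rightarrow> 'a ell2 \<Rightarrow> 'a ell2" where
  "rho g = pull (carrier G) (\<lambda>k. k \<otimes> g)"

lemma coord_lam: "g \<in> carrier G \<Longrightarrow>
    coord (lam g f) k = (if k \<in> carrier G then coord f (inv g \<otimes> k) else 0)"
  unfolding lam_def by (rule coord_pull) (auto intro!: inj_onI)

lemma coord_rho: "g \<in> carrier G \<Longrightarrow>
    coord (rho g f) k = (if k \<in> carrier G then coord f (k \<otimes> g) else 0)"
  unfolding rho_def by (rule coord_pull) (auto intro!: inj_onI)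

lemma bclinear_lam: "g \<in> carrier G \<Longrightarrow> bclinear (lam g)"
  unfolding lam_def by (rule bclinear_pull) (auto intro!: inj_onI)

lemma bclinear_rho: "g \<in> carrier G \<Longrightarrow> bclinear (rho g)"
  unfolding rho_def by (rule bclinear_pull) (auto intro!: inj_onI)

lemma norm_lam_le: "g \<in> carrier G \<Longrightarrow> norm (lam g f) \<le> norm f"
  unfolding lam_def by (rule norm_pull_le) (auto intro!: inj_onI)

lemma norm_rho_le: "g \<in> carrier G \<Longrightarrow> norm (rho g f) \<le> norm f"
  unfolding rho_def by (rule norm_pull_le) (auto intro!: inj_onI)

lemma adj_lam: "g \<in> carrier G \<Longrightarrow> adj (lam g) = lam (inv g)"
  by (rule adj_eqI[OF bclinear_lam], assumption, unfold lam_def, rule cinner_pull)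
    (auto simp flip: m_assoc)

lemma adj_rho: "g \<in> carrier G \<Longrightarrow> adj (rho g) = rho (inv g)"
  by (rule adj_eqI[OF bclinear_rho], assumption, unfold rho_def, rule cinner_pull)
    (auto simp: m_assoc)

lemma lam_mult: "g \<in> carrier G \<Longrightarrow> h \<in> carrier G \<Longrightarrow> lam g (lam h f) = lam (g \<otimes> h) f"
  by (rule ell2_eqI) (auto simp: coord_lam inv_mult_group m_assoc)

lemma rho_mult: "g \<in> carrier G \<Longrightarrow> h \<in> carrier G \<Longrightarrow> rho g (rho h f) = rho (g \<otimes> h) f"
  by (rule ell2_eqI) (auto simp: coord_rho m_assoc)

lemma lam_rho: "g \<in> carrier G \<Longrightarrow> h \<in> carrier G \<Longrightarrow> lam g (rho h f) = rho h (lam g f)"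
  by (rule ell2_eqI) (auto simp: coord_rho coord_lam m_assoc)

lemma rho_one: "rho \<one> = lam \<one>"
  by (rule ext, rule ell2_eqI) (auto simp: coord_rho coord_lam)

lemma lam_one_eqI: "(\<And>k. k \<notin> carrier G \<Longrightarrow> coord f k = 0) \<Longrightarrow> lam \<one> f = f"
  by (rule ell2_eqI) (auto simp: coord_lam)

lemma lam_one_lam [simp]: "g \<in> carrier G \<Longrightarrow> lam \<one> (lam g f) = lam g f"
  by (simp add: lam_mult)

lemma lam_one_rho [simp]: "g \<in> carrier G \<Longrightarrow> lam \<one> (rho g f) = rho g f"
  by (simp add: rho_mult flip: rho_one)

lemma lam_basis: "g \<in> carrier G \<Longrightarrow> h \<in> carrier G \<Longrightarrow> lam g (basis h) = basis (g \<otimes> h)"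
  by (rule ell2_eqI) (auto simp: coord_lam coord_basis inv_solve_left' m_assoc[symmetric])

lemma rho_basis: "g \<in> carrier G \<Longrightarrow> h \<in> carrier G \<Longrightarrow> rho g (basis h) = basis (h \<otimes> inv g)"
  by (rule ell2_eqI) (auto simp: coord_rho coord_basis m_assoc)

lemma lam_basis_one [simp]: "g \<in> carrier G \<Longrightarrow> lam g (basis \<one>) = basis g"
  by (simp add: lam_basis)

lemma rho_basis_one [simp]: "g \<in> carrier G \<Longrightarrow> rho (inv g) (basis \<one>) = basis g"
  by (simp add: rho_basis)

text \<open>The adjoint of such a \<open>T\<close> takes values that vanish on \<open>G\<close>, whereas \<open>f\<close> vanishes outside.\<close>

lemma ell2_op_eq_zero:
  assumes T: "bclinear T" and b: "\<And>g. g \<in> carrier G \<Longrightarrow> T (basis g) = 0" and f: "lam \<one> f = f"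
  shows "T f = (0::'h::complex_inner)"
proof (rule cinner_eq_zeroD)
  fix z
  have "coord (adj T z) g = 0" if "g \<in> carrier G" for g
    by (simp add: cinner_adj_left[OF T] b[OF that] flip: cinner_basis_right)
  moreover have "coord f g = 0" if "g \<notin> carrier G" for g
    using arg_cong[OF f, of "\<lambda>f. coord f g"] that by (simp add: coord_lam)
  ultimately have "(\<lambda>g. coord f g * cnj (coord (adj T z) g)) = (\<lambda>_. 0)"
    by (metis complex_cnj_zero mult_zero_left mult_zero_right)
  then have "cinner f (adj T z) = 0"
    using cinner_ell2_has_sum[of f "adj T z"] has_sum_unique has_sum_0_simp by metis
  then show "cinner (T f) z = 0" by (simp add: cinner_adj_right[OF T])
qed

text \<open>
  The left-hand side is \<open>\<langle>AB\<delta>\<^sub>1, \<delta>\<^sub>1\<rangle> = \<Sum>\<^sub>g (B\<delta>\<^sub>1)(g) (A\<delta>\<^sub>1)(g\<^sup>-\<^sup>1)\<close>, and the substitution \<open>g \<mapsto> g\<^sup>-\<^sup>1\<close>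
  exchanges \<open>A\<close> and \<open>B\<close>. The hypotheses on \<open>U\<close> hold for the left and for the right translations.
\<close>

lemma trace_commute_aux:
  assumes A: "bclinear A" "\<And>g f. g \<in> carrier G \<Longrightarrow> A (U g f) = U g (A f)"
    and B: "bclinear B" "\<And>g f. g \<in> carrier G \<Longrightarrow> B (U g f) = U g (B f)"
    and U: "\<And>g. g \<in> carrier G \<Longrightarrow> U g (basis \<one>) = basis g"
      "\<And>g f. g \<in> carrier G \<Longrightarrow> coord (U g f) \<one> = coord f (inv g)"
      "\<And>f k. k \<notin> carrier G \<Longrightarrow> coord (U \<one> f) k = 0"
  shows "coord (A (B (basis \<one>))) \<one> = coord (B (A (basis \<one>))) \<one>"
proof -
  have hs: "((\<lambda>g. coord (B (basis \<one>)) g * coord (A (basis \<one>)) (inv g))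
      has_sum coord (A (B (basis \<one>))) \<one>) (carrier G)"
    if A: "bclinear A" "\<And>g f. g \<in> carrier G \<Longrightarrow> A (U g f) = U g (A f)"
    and B: "\<And>g f. g \<in> carrier G \<Longrightarrow> B (U g f) = U g (B f)" for A B
  proof -
    have c: "cnj (coord (adj A (basis \<one>)) g) = coord (A (basis \<one>)) (inv g)" if g: "g \<in> carrier G" for g
    proof -
      have "cnj (coord (adj A (basis \<one>)) g) = cinner (A (basis g)) (basis \<one>)"
        by (simp add: cinner_adj_right A flip: cinner_basis_left)
      also have "\<dots> = coord (A (U g (basis \<one>))) \<one>" using g by (simp add: U cinner_basis_right)
      also have "\<dots> = coord (A (basis \<one>)) (inv g)" using g by (simp only: A(2) U(2))
      finally show ?thesis .
    qed
    have "coord (A (B (basis \<one>))) \<one> = cinner (B (basis \<one>)) (adj A (basis \<one>))"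
      by (simp add: cinner_adj_right A cinner_basis_right)
    then have "((\<lambda>g. coord (B (basis \<one>)) g * cnj (coord (adj A (basis \<one>)) g))
      has_sum coord (A (B (basis \<one>))) \<one>) UNIV"
      using cinner_ell2_has_sum by metis
    moreover have "coord (B (basis \<one>)) g = 0" if "g \<notin> carrier G" for g
      using U(3)[OF that, of "B (basis \<one>)"] by (simp add: U(1) flip: B)
    ultimately have "((\<lambda>g. coord (B (basis \<one>)) g * cnj (coord (adj A (basis \<one>)) g))
      has_sum coord (A (B (basis \<one>))) \<one>) (carrier G)"
      by (rule_tac has_sum_cong_neutral[THEN iffD1, rotated -1]) auto
    then show ?thesis by (simp add: c cong: has_sum_cong)
  qed
  have "((\<lambda>g. coord (A (basis \<one>)) g * coord (B (basis \<one>)) (inv g))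
      has_sum coord (A (B (basis \<one>))) \<one>) (carrier G)"
    by (rule has_sum_reindex_bij_witness[THEN iffD1, OF _ _ _ _ _ _ hs[OF A B(2)],
        of "\<lambda>g. inv g" "\<lambda>g. inv g"]) (auto simp: mult.commute)
  then show ?thesis using has_sum_unique hs[OF B A(2)] by blast
qed

lemma trace_commute_lam:
  assumes A: "A \<in> commutant (lam ` carrier G)" and B: "B \<in> commutant (lam ` carrier G)"
  shows "coord (A (B (basis \<one>))) \<one> = coord (B (A (basis \<one>))) \<one>"
  by (rule trace_commute_aux[where U = lam])
    (use A B in \<open>auto simp: commutant_bclinear commutant_image[of _ lam] coord_lam\<close>)

lemma trace_commute_rho:
  assumes A: "A \<in> commutant (rho ` carrier G)" and B: "B \<in> commutant (rho ` carrier G)"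
  shows "coord (A (B (basis \<one>))) \<one> = coord (B (A (basis \<one>))) \<one>"
  by (rule trace_commute_aux[where U = "\<lambda>g. rho (inv g)"])
    (use A B in \<open>auto simp: commutant_bclinear commutant_image[of _ rho] coord_rho\<close>)

lemma commutant_rho_adj: "A \<in> commutant (rho ` carrier G) \<Longrightarrow> adj A \<in> commutant (rho ` carrier G)"
  by (rule commutant_adj) (auto simp: adj_rho bclinear_rho)

text \<open>
  A nonzero value at some \<open>k \<noteq> \<one>\<close> would be repeated on the infinite conjugacy class of \<open>k\<close>, against
  square-summability.
\<close>

lemma conj_invariant_vector:
  assumes icc: "icc_group G"
    and inv: "\<And>h. h \<in> carrier G \<Longrightarrow> lam h (rho h f) = f"
  shows "f = coord f \<one> *\<^sub>C basis \<one>"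
proof (rule ell2_eqI)
  fix k
  have supp: "coord f k = 0" if "k \<notin> carrier G" for k
    using arg_cong[OF inv[of \<one>], of "\<lambda>f. coord f k"] that by (simp add: coord_lam del: lam_one_rho)
  have "coord f k = 0" if k: "k \<in> carrier G" "k \<noteq> \<one>"
  proof (rule ccontr)
    assume nz: "coord f k \<noteq> 0"
    define C where "C = {h \<otimes> k \<otimes> inv h | h. h \<in> carrier G}"
    have "infinite C" using icc k by (auto simp: icc_group_def C_def)
    have "coord f c = coord f k" if c: "c \<in> C" for c
    proof -
      obtain h where h: "h \<in> carrier G" "c = h \<otimes> k \<otimes> inv h" using c by (auto simp: C_def)
      have "coord f c = coord (lam h (rho h f)) c" using inv[OF h(1)] by simp
      also have "\<dots> = coord f (inv h \<otimes> (h \<otimes> k \<otimes> inv h) \<otimes> h)"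
        using h k by (simp add: coord_lam coord_rho)
      also have "inv h \<otimes> (h \<otimes> k \<otimes> inv h) \<otimes> h = inv h \<otimes> (h \<otimes> k)"
        using h(1) k(1) by (simp add: m_assoc)
      also have "\<dots> = k"
        using h(1) k(1) by (simp flip: m_assoc)
      finally show ?thesis .
    qed
    then have "(\<lambda>c. (cmod (coord f k))\<^sup>2) summable_on C"
      using coord_summable[of f C] by (simp cong: summable_on_cong)
    then show False
      using infsum_diverge_constant[OF \<open>infinite C\<close>, of "(cmod (coord f k))\<^sup>2"] nz by simp
  qed
  then show "coord f k = coord (coord f \<one> *\<^sub>C basis \<one>) k"
    using supp by (cases "k \<in> carrier G") (auto simp: coord_basis)
qed

end

section \<open>Intertwiners into the left regular representation\<close>

text \<open>
  Both summands of \<open>A - A\<^sup>2 = A (1 - A) A + (1 - A) A (1 - A)\<close> are positive.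
\<close>

lemma positive_contraction_square:
  fixes A :: "'a::complex_inner \<Rightarrow> 'a"
  assumes A: "bclinear A" and sa: "\<And>x y. cinner (A x) y = cinner x (A y)"
    and pos: "\<And>x. 0 \<le> Re (cinner (A x) x)" and le: "\<And>x. Re (cinner (A x) x) \<le> (norm x)\<^sup>2"
  shows "(norm (A x))\<^sup>2 \<le> Re (cinner (A x) x)"
proof -
  have "0 \<le> Re (cinner (A (x - A x)) (x - A x))" by (rule pos)
  moreover have "Re (cinner (A (A x)) (A x)) \<le> (norm (A x))\<^sup>2" by (rule le)
  moreover have "cinner (A (x - A x)) (x - A x)
      = cinner (A x) x - 2 * cinner (A x) (A x) + cinner (A (A x)) (A x)"
    by (simp add: bclinear_diff[OF A] cinner_diff_left cinner_diff_right sa algebra_simps)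
  ultimately show ?thesis by (simp add: cinner_self)
qed

text \<open>
  Polarisation: the diagonal gives \<open>\<phi> x y + \<phi> y x = 0\<close>, and \<open>\<i> x\<close> in place of \<open>x\<close> changes the relative
  sign.
\<close>

lemma sesquilinear_zero:
  fixes \<phi> :: "'a::complex_inner \<Rightarrow> 'a \<Rightarrow> complex"
  assumes add1: "\<And>x x' y. \<phi> (x + x') y = \<phi> x y + \<phi> x' y"
    and scale1: "\<And>c x y. \<phi> (c *\<^sub>C x) y = c * \<phi> x y"
    and add2: "\<And>x y y'. \<phi> x (y + y') = \<phi> x y + \<phi> x y'"
    and scale2: "\<And>c x y. \<phi> x (c *\<^sub>C y) = cnj c * \<phi> x y"
    and diag: "\<And>x. \<phi> x x = 0"
  shows "\<phi> x y = 0"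
proof -
  have sum0: "\<phi> x y + \<phi> y x = 0" for x y
  proof -
    have "\<phi> (x + y) (x + y) = \<phi> x y + \<phi> y x"
      unfolding add1 add2 by (simp add: diag)
    then show ?thesis by (metis diag)
  qed
  have "\<i> * \<phi> x y - \<i> * \<phi> y x = 0"
    using sum0[of "\<i> *\<^sub>C x" y] by (simp add: scale1 scale2)
  then have "\<phi> x y = \<phi> y x" by simp
  then show ?thesis using sum0[of x y] by simp
qed

locale group_rep = group G for G (structure) +
  fixes \<pi> :: "'a \<Rightarrow> 'h::complex_hilbert \<Rightarrow> 'h"
  assumes rep: "unitary_rep G \<pi>"
begin

lemma
  assumes g: "g \<in> carrier G"
  shows bclinear_rep: "bclinear (\<pi> g)" and surj_rep: "surj (\<pi> g)"
    and cinner_rep: "cinner (\<pi> g x) (\<pi> g y) = cinner x y"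
  using rep g by (auto simp: unitary_rep_def unitary_op_def bounded_clinear_iff)

lemma rep_mult: "g \<in> carrier G \<Longrightarrow> h \<in> carrier G \<Longrightarrow> \<pi> (g \<otimes> h) x = \<pi> g (\<pi> h x)"
  using rep by (auto simp: unitary_rep_def)

lemma norm_rep [simp]: "g \<in> carrier G \<Longrightarrow> norm (\<pi> g x) = norm x"
  using cinner_rep[of g x x] unfolding cinner_self of_real_eq_iff
  by (simp add: power2_eq_iff_nonneg)

lemma rep_one [simp]: "\<pi> \<one> x = x"
proof -
  obtain y where "x = \<pi> \<one> y" using surj_rep[of \<one>] by (metis one_closed surjD)
  then show ?thesis using rep_mult[of \<one> \<one> y] by simp
qed

lemma rep_inv [simp]:
  "g \<in> carrier G \<Longrightarrow> \<pi> (inv g) (\<pi> g x) = x" "g \<in> carrier G \<Longrightarrow> \<pi> g (\<pi> (inv g) x) = x"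
  by (simp_all flip: rep_mult)

lemma cinner_rep_inv: "g \<in> carrier G \<Longrightarrow> cinner (\<pi> g x) y = cinner x (\<pi> (inv g) y)"
  using cinner_rep[of g x "\<pi> (inv g) y"] by simp

lemma adj_rep: "g \<in> carrier G \<Longrightarrow> adj (\<pi> g) = \<pi> (inv g)"
  by (rule adj_eqI) (simp_all add: bclinear_rep cinner_rep_inv)

abbreviation rep_commutant where "rep_commutant \<equiv> commutant (\<pi> ` carrier G)"
abbreviation rep_vN where "rep_vN \<equiv> commutant rep_commutant"
abbreviation lam_commutant where "lam_commutant \<equiv> commutant (lam ` carrier G)"
abbreviation rho_commutant where "rho_commutant \<equiv> commutant (rho ` carrier G)"

lemma rep_commutant_adj: "S \<in> rep_commutant \<Longrightarrow> adj S \<in> rep_commutant"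
  by (rule commutant_adj) (auto simp: adj_rep bclinear_rep)

lemma rep_vN_adj: "T \<in> rep_vN \<Longrightarrow> adj T \<in> rep_vN"
  by (rule commutant_adj) (auto simp: rep_commutant_adj commutant_bclinear)

lemma rep_in_vN: "g \<in> carrier G \<Longrightarrow> \<pi> g \<in> rep_vN"
  by (rule commutantI) (simp_all add: bclinear_rep commutant_image[of _ \<pi>])

definition intertwiner :: "('h \<Rightarrow> 'a ell2) \<Rightarrow> bool" where
  "intertwiner v \<longleftrightarrow> bclinear v \<and> (\<forall>g\<in>carrier G. \<forall>f. v (\<pi> g f) = lam g (v f))"

lemma intertwiner_bclinear: "intertwiner v \<Longrightarrow> bclinear v"
  by (simp add: intertwiner_def)

lemma intertwiner_rep: "intertwiner v \<Longrightarrow> g \<in> carrier G \<Longrightarrow> v (\<pi> g f) = lam g (v f)"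
  by (simp add: intertwiner_def)

lemma intertwiner_lam_one [simp]: "intertwiner v \<Longrightarrow> lam \<one> (v f) = v f"
  using intertwiner_rep[of v \<one> f] by simp

lemma adj_intertwiner:
  assumes v: "intertwiner v" and g: "g \<in> carrier G"
  shows "adj v (lam g y) = \<pi> g (adj v y)"
proof (rule cinner_eqI)
  fix z
  note bv = intertwiner_bclinear[OF v]
  have "cinner z (adj v (lam g y)) = cinner (lam (inv g) (v z)) y"
    using g cinner_adj_left[OF bclinear_lam, of g "v z" y]
    by (simp add: cinner_adj_right[OF bv] adj_lam)
  also have "\<dots> = cinner (\<pi> (inv g) z) (adj v y)"
    using g v by (simp add: cinner_adj_right[OF bv] intertwiner_rep)
  also have "\<dots> = cinner z (\<pi> g (adj v y))"
    using g by (simp add: cinner_rep_inv)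
  finally show "cinner z (adj v (lam g y)) = cinner z (\<pi> g (adj v y))" .
qed

lemma adj_intertwiner_lam_one: "intertwiner v \<Longrightarrow> adj v (lam \<one> y) = adj v y"
  by (simp add: adj_intertwiner)

lemma adj_intertwiner_basis:
  "intertwiner v \<Longrightarrow> g \<in> carrier G \<Longrightarrow> adj v (basis g) = \<pi> g (adj v (basis \<one>))"
  by (simp flip: adj_intertwiner)

lemma intertwiner_compose_left:
  "A \<in> lam_commutant \<Longrightarrow> intertwiner v \<Longrightarrow> intertwiner (\<lambda>f. A (v f))"
  unfolding intertwiner_def by (auto simp: bclinear_compose commutant_bclinear commutant_image[of _ lam])

lemma adj_compose_intertwiner:
  "intertwiner v \<Longrightarrow> intertwiner w \<Longrightarrow> (\<lambda>f. adj v (w f)) \<in> rep_commutant"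
  by (rule commutantI)
    (auto simp: bclinear_compose bclinear_adj intertwiner_bclinear intertwiner_rep adj_intertwiner)

lemma intertwiner_compose_adj:
  "intertwiner v \<Longrightarrow> intertwiner w \<Longrightarrow> (\<lambda>f. v (adj w f)) \<in> lam_commutant"
  by (rule commutantI)
    (auto simp: bclinear_compose bclinear_adj intertwiner_bclinear intertwiner_rep adj_intertwiner)

lemma intertwiner_compose_right:
  "intertwiner v \<Longrightarrow> S \<in> rep_commutant \<Longrightarrow> intertwiner (\<lambda>f. v (S f))"
  unfolding intertwiner_def by (auto simp: bclinear_compose commutant_bclinear commutant_image[of _ \<pi>])

lemma rho_in_lam_commutant: "g \<in> carrier G \<Longrightarrow> rho g \<in> lam_commutant"
  by (rule commutantI) (auto simp: bclinear_rho lam_rho)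

lemma adj_rho_compose:
  assumes "intertwiner v" "g \<in> carrier G"
  shows "adj (\<lambda>f. rho (inv g) (v f)) = (\<lambda>y. adj v (rho g y))"
  using assms by (simp add: adj_compose bclinear_rho intertwiner_bclinear adj_rho)

end

text \<open>
  In the application \<open>\<theta>\<close> is the analysis operator of the Parseval frame vector for the whole space.
\<close>

locale icc_rep = group_rep G \<pi> for G (structure) and \<pi> :: "'a \<Rightarrow> 'h::complex_hilbert \<Rightarrow> 'h" +
  fixes \<theta> :: "'h \<Rightarrow> 'a ell2"
  assumes icc: "icc_group G" and countable: "countable (carrier G)"
    and nonzero: "\<exists>x::'h. x \<noteq> 0"
    and \<theta>: "intertwiner \<theta>" "\<And>f. norm (\<theta> f) = norm f"
begin

text \<open>
  The vectors killed by all translates of \<open>\<theta>\<^sup>*\<close> form a subspace invariant under left and right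
  translations, so the projection of \<open>\<delta>\<^sub>1\<close> to it is invariant under conjugations. By the ICC
  property it is then a multiple of \<open>\<delta>\<^sub>1\<close>, which leaves only the zero subspace and the whole of
  \<open>\<ell>\<^sup>2(G)\<close>. This expresses that the regular representation of \<open>G\<close> generates a
  factor.
\<close>

lemma translates_separate:
  assumes z: "lam \<one> z = z" and 0: "\<And>h. h \<in> carrier G \<Longrightarrow> adj \<theta> (rho h z) = 0"
  shows "z = 0"
proof -
  define N where "N = {z. lam \<one> z = z \<and> (\<forall>h\<in>carrier G. adj \<theta> (rho h z) = 0)}"
  have b: "bclinear (adj \<theta>)" by (intro bclinear_adj intertwiner_bclinear \<theta>)
  have b': "bclinear (\<lambda>z. adj \<theta> (rho h z))" if "h \<in> carrier G" for h
    using bclinear_compose[OF b bclinear_rho[OF that]] .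
  have bl: "bclinear (lam \<one>)" by (rule bclinear_lam) simp
  have "N = {z. lam \<one> z = z} \<inter> (\<Inter>h\<in>carrier G. {z. adj \<theta> (rho h z) = 0})"
    by (auto simp: N_def)
  also have "closed \<dots>"
    by (intro closed_Int closed_INT ballI closed_Collect_eq continuous_intros
        bclinear_continuous b' bl)
  finally have "closed N" .
  moreover have "csubspace N"
    unfolding csubspace_def N_def
    by (auto simp: bclinear_add[OF bl] bclinear_scaleC[OF bl] bclinear_zero[OF bl]
        bclinear_add[OF b'] bclinear_scaleC[OF b'] bclinear_zero[OF b'])
  ultimately have N: "closed_csubspace N" by (simp add: closed_csubspace_def)
  have lamN: "lam g z \<in> N" if "z \<in> N" "g \<in> carrier G" for g z
    using that \<theta>(1) by (auto simp: N_def adj_intertwiner bclinear_zero[OF bclinear_rep] simp flip: lam_rho)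
  have rhoN: "rho g z \<in> N" if "z \<in> N" "g \<in> carrier G" for g z
    using that by (auto simp: N_def rho_mult)
  define n where "n = cproj N (basis \<one>)"
  have "n = coord n \<one> *\<^sub>C basis \<one>"
  proof (rule conj_invariant_vector[OF icc])
    fix h assume h: "h \<in> carrier G"
    have "cproj N (basis \<one>) = lam h (rho h n)"
    proof (rule cproj_eqI)
      show "csubspace N" using N by (simp add: closed_csubspace_def)
      show "lam h (rho h n) \<in> N" unfolding n_def by (intro lamN rhoN cproj_in N h)
      fix z assume z: "z \<in> N"
      have "basis \<one> - lam h (rho h n) = lam h (rho h (basis \<one> - n))"
        using h by (simp add: bclinear_diff[OF bclinear_rho] bclinear_diff[OF bclinear_lam]
            rho_basis lam_basis)
      also have "cinner \<dots> z = cinner (basis \<one> - n) (rho (inv h) (lam (inv h) z))"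
        using h by (simp add: cinner_adj_right[OF bclinear_rho, symmetric]
            cinner_adj_right[OF bclinear_lam, symmetric] flip: adj_rho adj_lam)
      also have "\<dots> = 0"
        unfolding n_def using h z by (intro cproj_orth N rhoN lamN) auto
      finally show "cinner (basis \<one> - lam h (rho h n)) z = 0" .
    qed
    then show "lam h (rho h n) = n" by (simp add: n_def)
  qed
  then obtain c where c: "n = c *\<^sub>C basis \<one>" by blast
  have "c = 0"
  proof (rule ccontr)
    assume "c \<noteq> 0"
    then have "basis \<one> = inverse c *\<^sub>C n" by (simp add: c scaleC_scaleC)
    moreover have "n \<in> N" unfolding n_def by (rule cproj_in[OF N])
    ultimately have "basis \<one> \<in> N" using N by (auto simp: closed_csubspace_def csubspace_def)
    then have "basis g \<in> N" if "g \<in> carrier G" for g using lamN[OF _ that] that by fastforce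
    then have "adj \<theta> (rho \<one> (basis g)) = 0" if "g \<in> carrier G" for g
      using that one_closed unfolding N_def by blast
    then have ker: "adj \<theta> (basis g) = 0" if "g \<in> carrier G" for g
      using that by (simp add: rho_one lam_basis)
    have "adj \<theta> (\<theta> x) = 0" for x
      by (rule ell2_op_eq_zero[OF b ker intertwiner_lam_one[OF \<theta>(1)]])
    then have "cinner (\<theta> x) (\<theta> x) = 0" for x
      by (simp flip: cinner_adj_right[OF intertwiner_bclinear[OF \<theta>(1)]])
    then have "norm x = 0" for x :: 'h
      unfolding cinner_self \<theta>(2) by simp
    then show False using nonzero by simp
  qed
  have zN: "z \<in> N" using z 0 by (simp add: N_def)
  have "coord z g = 0" for g
  proof (cases "g \<in> carrier G")
    case True
    have "cinner (basis \<one> - n) (lam (inv g) z) = 0"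
      unfolding n_def using zN True by (intro cproj_orth N lamN) auto
    then have "cinner (lam g (basis \<one>)) z = 0"
      using True cinner_adj_right[OF bclinear_lam, of g "basis \<one>" z] by (simp add: c \<open>c = 0\<close> adj_lam)
    then show ?thesis using True by (simp add: cinner_basis_left)
  next
    case False
    then show ?thesis using arg_cong[OF z, of "\<lambda>f. coord f g"] by (simp add: coord_lam)
  qed
  then show "z = 0" by (intro ell2_eqI) simp
qed

lemma intertwiners_separate:
  assumes "lam \<one> z = z" "\<And>w. intertwiner w \<Longrightarrow> adj w z = 0"
  shows "z = 0"
proof (rule translates_separate[OF assms(1)])
  fix h assume h: "h \<in> carrier G"
  have "adj (\<lambda>f. rho (inv h) (\<theta> f)) z = 0"
    using h by (intro assms(2) intertwiner_compose_left[of "rho (inv h)", OF rho_in_lam_commutant \<theta>(1)]) simp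
  then show "adj \<theta> (rho h z) = 0" using h \<theta> by (simp add: adj_rho_compose)
qed

end

section \<open>A resolution of the identity by intertwiners\<close>

context icc_rep
begin

text \<open>Each group element recurs infinitely often in this enumeration.\<close>

definition recurrent :: "nat \<Rightarrow> 'a" where
  "recurrent k = from_nat_into (carrier G) (fst (prod_decode k))"

lemma recurrent_closed: "recurrent k \<in> carrier G"
  unfolding recurrent_def by (rule from_nat_into) auto

lemma recurrent_infinitely_often: "g \<in> carrier G \<Longrightarrow> \<exists>\<^sub>F k in sequentially. recurrent k = g"
proof -
  assume "g \<in> carrier G"
  then obtain i where i: "from_nat_into (carrier G) i = g"
    using from_nat_into_surj[OF countable] by blast
  have "recurrent (prod_encode (i, j)) = g" for j by (simp add: recurrent_def i)
  moreover have "j \<le> prod_encode (i, j)" for j by (rule le_prod_encode_2)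
  ultimately show ?thesis unfolding frequently_sequentially by blast
qed

text \<open>
  With \<open>w\<^sub>k = \<rho>(g\<^sub>k)\<^sup>*\<theta>\<close>, put \<open>R\<^sub>0 = 1\<close> and \<open>R\<^sub>k\<^sub>+\<^sub>1 = R\<^sub>k - v\<^sub>kv\<^sub>k\<^sup>*\<close> with \<open>v\<^sub>k = R\<^sub>kw\<^sub>k\<close>. Then
  \<open>R\<^sub>k\<^sub>+\<^sub>1 \<ge> R\<^sub>k - R\<^sub>k\<^sup>2 \<ge> 0\<close>, so the partial sums of \<open>v\<^sub>kv\<^sub>k\<^sup>*\<close> are bounded by the identity. Here
  \<open>R\<^sub>k\<close> is \<open>remainder k\<close>, and \<open>v\<^sub>k\<close> will be \<open>piece k\<close>. The identity of
  \<open>\<ell>\<^sup>2(G)\<close> is \<open>lam \<one>\<close>, which restricts families to the carrier.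
\<close>

fun remainder :: "nat \<Rightarrow> 'a ell2 \<Rightarrow> 'a ell2" where
  "remainder 0 y = lam \<one> y"
| "remainder (Suc k) y = remainder k y -
     remainder k (rho (inv (recurrent k)) (\<theta> (adj \<theta> (rho (recurrent k) (remainder k y)))))"

declare remainder.simps(2) [simp del]

definition piece :: "nat \<Rightarrow> 'h \<Rightarrow> 'a ell2" where
  "piece k f = remainder k (rho (inv (recurrent k)) (\<theta> f))"

lemma norm_adj_\<theta>: "norm (adj \<theta> y) \<le> norm y"
  using norm_adj_le[OF intertwiner_bclinear[OF \<theta>(1)], of 1 y] \<theta>(2) by simp

lemma remainder_properties:
  "remainder k \<in> lam_commutant \<and> (\<forall>x y. cinner (remainder k x) y = cinner x (remainder k y)) \<and>
   (\<forall>x. 0 \<le> Re (cinner (remainder k x) x)) \<and> (\<forall>x. Re (cinner (remainder k x) x) \<le> (norm x)\<^sup>2)"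
proof (induction k)
  case 0
  have sa: "cinner (lam \<one> x) y = cinner x (lam \<one> y)" for x y
    using cinner_adj_right[OF bclinear_lam, of \<one> x y] by (simp add: adj_lam)
  have "Re (cinner (lam \<one> x) x) = (norm (lam \<one> x))\<^sup>2" for x
    using sa[of "lam \<one> x" x] by (simp add: sa[symmetric] cinner_self)
  moreover have "(norm (lam \<one> x))\<^sup>2 \<le> (norm x)\<^sup>2" for x
    by (intro power_mono norm_lam_le) auto
  moreover have "remainder 0 = lam \<one>" by auto
  moreover have "lam \<one> \<in> lam_commutant"
    by (rule commutantI) (auto simp: bclinear_lam lam_mult)
  ultimately show ?case using sa by simp
next
  case (Suc k)
  let ?R = "remainder k" and ?w = "\<lambda>f. rho (inv (recurrent k)) (\<theta> f)"
  have R: "?R \<in> lam_commutant" and sa: "\<And>x y. cinner (?R x) y = cinner x (?R y)"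
    and pos: "\<And>x. 0 \<le> Re (cinner (?R x) x)" and le: "\<And>x. Re (cinner (?R x) x) \<le> (norm x)\<^sup>2"
    using Suc by auto
  have bR: "bclinear ?R" by (rule commutant_bclinear[OF R])
  have w: "intertwiner ?w"
    by (rule intertwiner_compose_left[of "rho (inv (recurrent k))", OF rho_in_lam_commutant \<theta>(1)])
      (simp add: recurrent_closed)
  have aw: "adj ?w = (\<lambda>y. adj \<theta> (rho (recurrent k) y))"
    by (rule adj_rho_compose[OF \<theta>(1) recurrent_closed])
  have step: "remainder (Suc k) = (\<lambda>y. ?R y - ?R (?w (adj ?w (?R y))))"
    unfolding aw by (rule ext) (rule remainder.simps(2))
  have "(\<lambda>y. ?R (?w (adj ?w (?R y)))) \<in> lam_commutant"
    by (rule commutant_compose[OF R, OF commutant_compose[OF intertwiner_compose_adj[OF w w] R]])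
  then have 1: "remainder (Suc k) \<in> lam_commutant"
    unfolding step by (intro commutant_minus R) (auto simp: bclinear_lam)
  note bw = intertwiner_bclinear[OF w]
  have 2: "cinner (remainder (Suc k) x) y = cinner x (remainder (Suc k) y)" for x y
  proof -
    have "cinner (?R (?w (adj ?w (?R x)))) y = cinner (adj ?w (?R x)) (adj ?w (?R y))"
      by (simp add: sa cinner_adj_right[OF bw])
    also have "\<dots> = cinner x (?R (?w (adj ?w (?R y))))"
      by (simp add: sa[symmetric] cinner_adj_left[OF bw])
    finally show ?thesis unfolding step by (simp add: cinner_diff_left cinner_diff_right sa)
  qed
  have form: "Re (cinner (remainder (Suc k) x) x) = Re (cinner (?R x) x) - (norm (adj ?w (?R x)))\<^sup>2" for x
  proof -
    have "cinner (?R (?w (adj ?w (?R x)))) x = cinner (adj ?w (?R x)) (adj ?w (?R x))"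
      by (simp add: sa cinner_adj_right[OF bw])
    then show ?thesis unfolding step by (simp add: cinner_diff_left cinner_self)
  qed
  have "(norm (adj ?w (?R x)))\<^sup>2 \<le> Re (cinner (?R x) x)" for x
  proof -
    have "norm (adj ?w (?R x)) \<le> norm (?R x)"
      unfolding aw using norm_adj_\<theta> norm_rho_le[OF recurrent_closed] order_trans by blast
    then have "(norm (adj ?w (?R x)))\<^sup>2 \<le> (norm (?R x))\<^sup>2" by (intro power_mono) auto
    also have "\<dots> \<le> Re (cinner (?R x) x)" by (rule positive_contraction_square[OF bR sa pos le])
    finally show ?thesis .
  qed
  then have 3: "0 \<le> Re (cinner (remainder (Suc k) x) x)" for x by (simp add: form)
  have 4: "Re (cinner (remainder (Suc k) x) x) \<le> (norm x)\<^sup>2" for x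
    using le[of x] zero_le_power2[of "norm (adj ?w (?R x))"] unfolding form by linarith
  show ?case using 1 2 3 4 by blast
qed

lemma
  shows remainder_lam_commutant: "remainder k \<in> lam_commutant"
    and remainder_selfadjoint: "cinner (remainder k x) y = cinner x (remainder k y)"
    and remainder_pos: "0 \<le> Re (cinner (remainder k x) x)"
    and remainder_le: "Re (cinner (remainder k x) x) \<le> (norm x)\<^sup>2"
  using remainder_properties[of k] by blast+

lemmas bclinear_remainder = commutant_bclinear[OF remainder_lam_commutant]

lemma piece_intertwiner: "intertwiner (piece k)"
  unfolding piece_def
  by (rule intertwiner_compose_left[OF remainder_lam_commutant],
      rule intertwiner_compose_left[of "rho (inv (recurrent k))", OF rho_in_lam_commutant \<theta>(1)])
    (simp add: recurrent_closed)

lemma adj_piece: "adj (piece k) y = adj \<theta> (rho (recurrent k) (remainder k y))"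
proof -
  have 1: "bclinear (\<lambda>f. rho (inv (recurrent k)) (\<theta> f))"
    by (rule bclinear_compose[OF bclinear_rho intertwiner_bclinear[OF \<theta>(1)]]) (simp add: recurrent_closed)
  have "adj (remainder k) = remainder k"
    by (rule adj_eqI[OF bclinear_remainder]) (rule remainder_selfadjoint)
  then show ?thesis
    unfolding piece_def adj_compose[OF bclinear_remainder 1]
    by (simp add: adj_rho_compose[OF \<theta>(1) recurrent_closed])
qed

lemma remainder_Suc: "remainder (Suc k) y = remainder k y - piece k (adj (piece k) y)"
  unfolding remainder.simps(2) adj_piece piece_def ..

lemma remainder_form_Suc:
  "Re (cinner (remainder (Suc k) y) y) = Re (cinner (remainder k y) y) - (norm (adj (piece k) y))\<^sup>2"
  by (simp add: remainder_Suc cinner_diff_left cinner_self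
      flip: cinner_adj_right[OF intertwiner_bclinear[OF piece_intertwiner]])

lemma sum_norm_adj_piece:
  "(\<Sum>k<n. (norm (adj (piece k) y))\<^sup>2) = Re (cinner (lam \<one> y) y) - Re (cinner (remainder n y) y)"
  by (induction n) (simp_all add: remainder_form_Suc)

lemma remainder_difference:
  assumes "m \<le> n"
  shows "(norm (remainder m y - remainder n y))\<^sup>2 \<le> Re (cinner (remainder m y) y) - Re (cinner (remainder n y) y)"
proof -
  have mono: "Re (cinner (remainder n x) x) \<le> Re (cinner (remainder m x) x)" for x
    using assms by (rule lift_Suc_antimono_le[of "\<lambda>k. Re (cinner (remainder k x) x)", rotated])
      (simp add: remainder_form_Suc)
  have "(norm (remainder m y - remainder n y))\<^sup>2 \<le> Re (cinner (remainder m y - remainder n y) y)"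
  proof (rule positive_contraction_square)
    show "bclinear (\<lambda>y. remainder m y - remainder n y)"
      by (intro bclinear_minus_map bclinear_remainder)
    show "Re (cinner (remainder m x - remainder n x) x) \<le> (norm x)\<^sup>2" for x
      using remainder_pos[of n x] remainder_le[of m x] by (simp add: cinner_diff_left)
  qed (use mono in \<open>simp_all add: cinner_diff_left cinner_diff_right remainder_selfadjoint\<close>)
  then show ?thesis by (simp add: cinner_diff_left)
qed

text \<open>
  The decreasing sequence \<open>R\<^sub>n\<close> converges strongly. Its limit \<open>r\<close> on \<open>y\<close> satisfies \<open>\<theta>\<^sup>*\<rho>(g)r = 0\<close> for
  every \<open>g\<close>: along the infinitely many \<open>k\<close> with \<open>g\<^sub>k = g\<close>, the vectors \<open>\<theta>\<^sup>*\<rho>(g)R\<^sub>ky = v\<^sub>k\<^sup>*y\<close> tend to zero.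
\<close>

lemma remainder_tendsto_zero:
  assumes y: "lam \<one> y = y"
  shows "(\<lambda>n. remainder n y) \<longlonglongrightarrow> 0"
proof -
  let ?q = "\<lambda>n. Re (cinner (remainder n y) y)"
  have dec: "decseq ?q"
    by (rule decseq_SucI) (simp add: remainder_form_Suc)
  have "convergent ?q"
    by (rule decseq_convergent[OF dec, of 0]) (auto simp: remainder_pos convergent_def)
  then have "Cauchy ?q" by (rule convergent_Cauchy)
  have "Cauchy (\<lambda>n. remainder n y)"
  proof (rule metric_CauchyI)
    fix e :: real assume e: "0 < e"
    then obtain M where M: "\<And>m n. m \<ge> M \<Longrightarrow> n \<ge> M \<Longrightarrow> dist (?q m) (?q n) < e\<^sup>2"
      using metric_CauchyD[OF \<open>Cauchy ?q\<close>, of "e\<^sup>2"] by auto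
    have "dist (remainder m y) (remainder n y) < e" if "M \<le> m" "m \<le> n" for m n
    proof -
      have "(norm (remainder m y - remainder n y))\<^sup>2 \<le> ?q m - ?q n"
        by (rule remainder_difference[OF that(2)])
      also have "\<dots> < e\<^sup>2" using M[of m n] that by (auto simp: dist_real_def)
      finally show ?thesis using e by (auto simp: dist_norm intro: power2_less_imp_less)
    qed
    then show "\<exists>M. \<forall>m\<ge>M. \<forall>n\<ge>M. dist (remainder m y) (remainder n y) < e"
      by (metis dist_commute nle_le)
  qed
  then obtain r where r: "(\<lambda>n. remainder n y) \<longlonglongrightarrow> r"
    using Cauchy_convergent convergent_def by blast
  have "r = 0"
  proof (rule translates_separate)
    have "(\<lambda>n. lam \<one> (remainder n y)) \<longlonglongrightarrow> lam \<one> r"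
      by (rule bclinear_tendsto[OF bclinear_lam r]) simp
    moreover have "lam \<one> (remainder n y) = remainder n y" for n
      using commutant_image[OF remainder_lam_commutant, of \<one> n y] y by simp
    ultimately show "lam \<one> r = r" using r LIMSEQ_unique by fastforce
  next
    fix g assume g: "g \<in> carrier G"
    have "summable (\<lambda>k. (norm (adj (piece k) y))\<^sup>2)"
    proof (rule summableI_nonneg_bounded)
      show "(\<Sum>k<n. (norm (adj (piece k) y))\<^sup>2) \<le> Re (cinner (lam \<one> y) y)" for n
        by (simp add: sum_norm_adj_piece remainder_pos)
    qed auto
    then have a: "(\<lambda>k. (norm (adj (piece k) y))\<^sup>2) \<longlonglongrightarrow> 0" by (rule summable_LIMSEQ_zero)
    have b: "(\<lambda>k. (norm (adj \<theta> (rho g (remainder k y))))\<^sup>2) \<longlonglongrightarrow> (norm (adj \<theta> (rho g r)))\<^sup>2"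
      by (intro tendsto_intros bclinear_tendsto[OF bclinear_adj[OF intertwiner_bclinear[OF \<theta>(1)]]]
          bclinear_tendsto[OF bclinear_rho[OF g]] r)
    have "(norm (adj \<theta> (rho g r)))\<^sup>2 = 0"
    proof (rule ccontr)
      assume "(norm (adj \<theta> (rho g r)))\<^sup>2 \<noteq> 0"
      then obtain d where d: "0 < d" "d < (norm (adj \<theta> (rho g r)))\<^sup>2"
        using dense[of 0 "(norm (adj \<theta> (rho g r)))\<^sup>2"] by auto
      have "\<forall>\<^sub>F k in sequentially. (norm (adj (piece k) y))\<^sup>2 < d"
        by (rule order_tendstoD(2)[OF a d(1)])
      moreover have "\<forall>\<^sub>F k in sequentially. d < (norm (adj \<theta> (rho g (remainder k y))))\<^sup>2"
        by (rule order_tendstoD(1)[OF b d(2)])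
      ultimately have "\<forall>\<^sub>F k in sequentially. recurrent k \<noteq> g"
        by eventually_elim (auto simp: adj_piece)
      then show False using recurrent_infinitely_often[OF g] by (simp add: frequently_def)
    qed
    then show "adj \<theta> (rho g r) = 0" by simp
  qed
  then show ?thesis using r by simp
qed

lemma parseval_pieces: "(\<lambda>k. (norm (adj (piece k) y))\<^sup>2) sums (norm (lam \<one> y))\<^sup>2"
proof -
  let ?y = "lam \<one> y"
  have "(\<lambda>n. Re (cinner (lam \<one> ?y) ?y) - Re (cinner (remainder n ?y) ?y))
      \<longlonglongrightarrow> Re (cinner (lam \<one> ?y) ?y) - Re (cinner 0 ?y)"
    by (intro tendsto_intros remainder_tendsto_zero) simp
  then have "(\<lambda>k. (norm (adj (piece k) ?y))\<^sup>2) sums (norm ?y)\<^sup>2"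
    unfolding sums_def sum_norm_adj_piece by (simp add: cinner_self)
  then show ?thesis by (simp add: adj_intertwiner_lam_one[OF piece_intertwiner])
qed

text \<open>Cauchy-Schwarz for the square-summable sequences \<open>v\<^sub>k\<^sup>*y\<close> and \<open>v\<^sub>k\<^sup>*z\<close>.\<close>

lemma form_bound:
  assumes "\<And>x. norm (T x) \<le> B * norm x" "0 \<le> B"
  shows form_summable: "summable (\<lambda>k. norm (cinner (T (adj (piece k) y)) (adj (piece k) z)))"
    and form_le: "cmod (\<Sum>k. cinner (T (adj (piece k) y)) (adj (piece k) z)) \<le> B * norm y * norm z"
proof -
  let ?a = "\<lambda>k. norm (adj (piece k) y)" and ?b = "\<lambda>k. norm (adj (piece k) z)"
  have part: "(\<Sum>k<n. norm (cinner (T (adj (piece k) y)) (adj (piece k) z))) \<le> B * norm y * norm z" for n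
  proof -
    have l2: "L2_set (\<lambda>k. norm (adj (piece k) y)) {..<n} \<le> norm y" for y
    proof -
      have "(\<Sum>k<n. (norm (adj (piece k) y))\<^sup>2) \<le> (norm (lam \<one> y))\<^sup>2"
        using sum_le_suminf[OF sums_summable[OF parseval_pieces[of y]], of "{..<n}"]
          sums_unique[OF parseval_pieces[of y]] by simp
      also have "\<dots> \<le> (norm y)\<^sup>2" by (intro power_mono norm_lam_le) auto
      finally show ?thesis unfolding L2_set_def by (simp add: real_le_lsqrt)
    qed
    have "(\<Sum>k<n. norm (cinner (T (adj (piece k) y)) (adj (piece k) z))) \<le> (\<Sum>k<n. B * (?a k * ?b k))"
    proof (rule sum_mono)
      fix k
      have "cmod (cinner (T (adj (piece k) y)) (adj (piece k) z)) \<le> norm (T (adj (piece k) y)) * ?b k"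
        by (rule cmod_cinner_le)
      also have "\<dots> \<le> (B * ?a k) * ?b k" by (intro mult_right_mono assms) auto
      finally show "cmod (cinner (T (adj (piece k) y)) (adj (piece k) z)) \<le> B * (?a k * ?b k)"
        by (simp add: mult.assoc)
    qed
    also have "\<dots> = B * (\<Sum>k<n. ?a k * ?b k)" by (simp add: sum_distrib_left)
    also have "(\<Sum>k<n. ?a k * ?b k) \<le> L2_set ?a {..<n} * L2_set ?b {..<n}"
      using L2_set_mult_ineq[of ?a ?b "{..<n}"] by simp
    also have "\<dots> \<le> norm y * norm z" by (intro mult_mono l2) auto
    finally show ?thesis using assms(2) by (simp add: mult_left_mono mult.assoc)
  qed
  show s: "summable (\<lambda>k. norm (cinner (T (adj (piece k) y)) (adj (piece k) z)))"
    by (rule summableI_nonneg_bounded[OF _ part]) simp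
  have "cmod (\<Sum>k. cinner (T (adj (piece k) y)) (adj (piece k) z))
      \<le> (\<Sum>k. norm (cinner (T (adj (piece k) y)) (adj (piece k) z)))"
    by (rule summable_norm[OF s])
  also have "\<dots> \<le> B * norm y * norm z"
    by (rule suminf_le_const[OF s part])
  finally show "cmod (\<Sum>k. cinner (T (adj (piece k) y)) (adj (piece k) z)) \<le> B * norm y * norm z" .
qed

text \<open>The operator is \<open>\<Sum>\<^sub>k v\<^sub>kTv\<^sub>k\<^sup>*\<close>, with the sum taken weakly.\<close>

lemma form_representation:
  assumes T: "bclinear T"
  shows "\<exists>S. bclinear S \<and> (\<forall>y z. (\<lambda>k. cinner (T (adj (piece k) y)) (adj (piece k) z)) sums cinner (S y) z)"
proof -
  obtain B where B: "B > 0" "\<And>x. norm (T x) \<le> B * norm x" by (rule bclinear_bound[OF T]) blast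
  let ?t = "\<lambda>y z k. cinner (T (adj (piece k) y)) (adj (piece k) z)"
  have s: "summable (?t y z)" for y z
    by (rule summable_norm_cancel[OF form_summable]) (use B in auto)
  have bp: "bclinear (adj (piece k))" for k
    by (rule bclinear_adj[OF intertwiner_bclinear[OF piece_intertwiner]])
  have "\<exists>S. bclinear S \<and> (\<forall>x y. cinner (S x) y = (\<Sum>k. ?t x y k)) \<and> (\<forall>x. norm (S x) \<le> B * norm x)"
  proof (rule sesquilinear_representation)
    show "(\<Sum>k. ?t (x + x') y k) = (\<Sum>k. ?t x y k) + (\<Sum>k. ?t x' y k)" for x x' y
      by (simp add: suminf_add[OF s s] bclinear_add[OF bp] bclinear_add[OF T] cinner_add_left)
    show "(\<Sum>k. ?t y (x + x') k) = (\<Sum>k. ?t y x k) + (\<Sum>k. ?t y x' k)" for x x' y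
      by (simp add: suminf_add[OF s s] bclinear_add[OF bp] cinner_add_right)
    show "(\<Sum>k. ?t (c *\<^sub>C x) y k) = c * (\<Sum>k. ?t x y k)" for c x y
      by (simp add: suminf_mult[OF s] bclinear_scaleC[OF bp] bclinear_scaleC[OF T] cinner_scaleC_left)
    show "(\<Sum>k. ?t x (c *\<^sub>C y) k) = cnj c * (\<Sum>k. ?t x y k)" for c x y
      by (simp add: suminf_mult[OF s] bclinear_scaleC[OF bp] cinner_scaleC_right)
  qed (use B form_le[of T B] in auto)
  then obtain S where S: "bclinear S" "\<And>x y. cinner (S x) y = (\<Sum>k. ?t x y k)" by blast
  have "?t y z sums cinner (S y) z" for y z
    unfolding S(2) by (rule summable_sums[OF s])
  then show ?thesis using S(1) by blast
qed

lemma polarized_parseval: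
  "(\<lambda>k. cinner (adj (piece k) y) (adj (piece k) z)) sums cinner (lam \<one> y) z"
proof -
  obtain S where S: "bclinear S"
    "\<And>y z. (\<lambda>k. cinner (adj (piece k) y) (adj (piece k) z)) sums cinner (S y) z"
    using form_representation[OF bclinear_ident] by auto
  note bl = bclinear_lam[OF one_closed]
  have "cinner (S y) z - cinner (lam \<one> y) z = 0" for y z
  proof (rule sesquilinear_zero[where \<phi> = "\<lambda>y z. cinner (S y) z - cinner (lam \<one> y) z"])
    fix x
    have "(\<lambda>k. complex_of_real ((norm (adj (piece k) x))\<^sup>2)) sums of_real ((norm (lam \<one> x))\<^sup>2)"
      by (intro sums_of_real parseval_pieces)
    then have "cinner (S x) x = of_real ((norm (lam \<one> x))\<^sup>2)"
      using S(2)[of x x] sums_unique2 unfolding cinner_self by blast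
    also have "\<dots> = cinner (lam \<one> x) x"
      using cinner_adj_right[OF bl, of "lam \<one> x" x] unfolding cinner_self[symmetric]
      by (simp add: adj_lam)
    finally show "cinner (S x) x - cinner (lam \<one> x) x = 0" by simp
  qed (simp_all add: bclinear_add[OF S(1)] bclinear_add[OF bl] bclinear_scaleC[OF S(1)]
      bclinear_scaleC[OF bl] cinner_add_left cinner_add_right cinner_scaleC_left
      cinner_scaleC_right algebra_simps)
  then show ?thesis using S(2)[of y z] by simp
qed

end

section \<open>Lifting the von Neumann algebra to the regular representation\<close>

lemma sums_cnj: "f sums s \<Longrightarrow> (\<lambda>n. cnj (f n)) sums cnj s"
  by (rule bounded_linear.sums[OF bounded_linear_cnj])

context icc_rep
begin

text \<open>
  The lift of \<open>T\<close> is \<open>\<Sum>\<^sub>k v\<^sub>kTv\<^sub>k\<^sup>*\<close>. On the von Neumann algebra it is a homomorphism into the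
  commutant of the right translations.
\<close>

definition lift :: "('h \<Rightarrow> 'h) \<Rightarrow> 'a ell2 \<Rightarrow> 'a ell2" where
  "lift T = (SOME S. bclinear S \<and>
     (\<forall>y z. (\<lambda>k. cinner (T (adj (piece k) y)) (adj (piece k) z)) sums cinner (S y) z))"

lemma
  assumes T: "bclinear T"
  shows bclinear_lift: "bclinear (lift T)"
    and lift_sums: "(\<lambda>k. cinner (T (adj (piece k) y)) (adj (piece k) z)) sums cinner (lift T y) z"
  using someI_ex[OF form_representation[OF T]] unfolding lift_def[symmetric] by blast+

lemma cinner_lam_one: "cinner (lam \<one> y) z = cinner y (lam \<one> z)"
  using cinner_adj_right[OF bclinear_lam, of \<one> y z] by (simp add: adj_lam)

lemma lam_one_lift:
  assumes T: "bclinear T" shows "lam \<one> (lift T y) = lift T y"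
proof (rule cinner_eqI)
  fix z
  have "cinner (lam \<one> (lift T y)) z = cinner (lift T y) z"
    unfolding cinner_lam_one
    using lift_sums[OF T, of y "lam \<one> z"] lift_sums[OF T, of y z]
    by (simp add: adj_intertwiner_lam_one[OF piece_intertwiner] sums_iff)
  then show "cinner z (lam \<one> (lift T y)) = cinner z (lift T y)" by (metis cinner_commute)
qed

lemma adj_lift:
  assumes T: "bclinear T" shows "adj (lift T) = lift (adj T)"
proof (rule adj_eqI[OF bclinear_lift[OF T]])
  fix y z
  have "(\<lambda>k. cnj (cinner (adj T (adj (piece k) z)) (adj (piece k) y))) sums cnj (cinner (lift (adj T) z) y)"
    by (intro sums_cnj lift_sums bclinear_adj T)
  then have "(\<lambda>k. cinner (T (adj (piece k) y)) (adj (piece k) z)) sums cinner y (lift (adj T) z)"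
    by (simp add: cinner_adj_right[OF T] flip: cinner_commute)
  then show "cinner (lift T y) z = cinner y (lift (adj T) z)"
    using lift_sums[OF T] sums_unique2 by blast
qed

text \<open>
  As \<open>T\<close> commutes with \<open>w\<^sup>*v\<^sub>k \<in> \<pi>(G)'\<close>, it can be moved to the left through
  \<open>w\<^sup>*\<Sum>\<^sub>k v\<^sub>kTv\<^sub>k\<^sup>*\<close>. This property characterises the lift and shows that it does not depend on the \<open>v\<^sub>k\<close>.
\<close>

lemma adj_intertwiner_lift:
  assumes T: "T \<in> rep_vN" and w: "intertwiner w"
  shows "adj w (lift T y) = T (adj w y)"
proof (rule cinner_eqI)
  fix f
  note bT = commutant_bclinear[OF T] and bw = intertwiner_bclinear[OF w]
  have commute: "cinner (T (adj (piece k) y)) (adj (piece k) (w f))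
      = cinner (adj (piece k) y) (adj (piece k) (w (adj T f)))" for k
  proof -
    note bp = intertwiner_bclinear[OF piece_intertwiner[of k]]
    have S: "(\<lambda>f. adj w (piece k f)) \<in> rep_commutant"
      by (rule adj_compose_intertwiner[OF w piece_intertwiner])
    have "cinner (T (adj (piece k) y)) (adj (piece k) (w f))
        = cinner (adj w (piece k (T (adj (piece k) y)))) f"
      by (simp add: cinner_adj_right[OF bp] cinner_adj_left[OF bw])
    also have "adj w (piece k (T (adj (piece k) y))) = T (adj w (piece k (adj (piece k) y)))"
      using commutant_commute[OF T S] by simp
    also have "cinner \<dots> f = cinner (adj (piece k) y) (adj (piece k) (w (adj T f)))"
      by (simp add: cinner_adj_right[OF bp] cinner_adj_left[OF bw] flip: cinner_adj_right[OF bT])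
    finally show ?thesis .
  qed
  have "cinner (lift T y) (w f) = cinner (lam \<one> y) (w (adj T f))"
    using lift_sums[OF bT, of y "w f"] polarized_parseval[of y "w (adj T f)"]
    unfolding commute by (rule sums_unique2)
  also have "\<dots> = cinner (T (adj w y)) f"
    by (simp add: cinner_lam_one w cinner_adj_left[OF bw] flip: cinner_adj_right[OF bT])
  finally have "cinner (adj w (lift T y)) f = cinner (T (adj w y)) f"
    by (simp add: cinner_adj_left[OF bw])
  then show "cinner f (adj w (lift T y)) = cinner f (T (adj w y))"
    by (metis cinner_commute)
qed

lemma lift_eqI:
  assumes T: "T \<in> rep_vN" and z: "lam \<one> z = z"
    and w: "\<And>w. intertwiner w \<Longrightarrow> adj w z = T (adj w y)"
  shows "lift T y = z"
proof -
  note bT = commutant_bclinear[OF T]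
  have "lift T y - z = 0"
  proof (rule intertwiners_separate)
    show "lam \<one> (lift T y - z) = lift T y - z"
      by (simp add: bclinear_diff[OF bclinear_lam] lam_one_lift[OF bT] z)
    show "adj w (lift T y - z) = 0" if "intertwiner w" for w
      using that by (simp add: bclinear_diff[OF bclinear_adj] intertwiner_bclinear w
          adj_intertwiner_lift[OF T])
  qed
  then show ?thesis by simp
qed

lemma rep_commutant_bclinear: "A \<in> rep_commutant \<Longrightarrow> bclinear A"
  by (rule commutant_bclinear)

lemmas rep_vN_plus = commutant_plus[OF rep_commutant_bclinear]
  and rep_vN_minus = commutant_minus[OF rep_commutant_bclinear]
  and rep_vN_scale = commutant_scale[OF rep_commutant_bclinear]

lemma lift_plus:
  assumes "S \<in> rep_vN" "T \<in> rep_vN"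
  shows "lift (\<lambda>x. S x + T x) y = lift S y + lift T y"
  by (rule lift_eqI)
    (use assms in \<open>simp_all add: rep_vN_plus commutant_bclinear lam_one_lift adj_intertwiner_lift
      bclinear_add[OF bclinear_lam] bclinear_add[OF bclinear_adj] intertwiner_bclinear\<close>)

lemma lift_minus:
  assumes "S \<in> rep_vN" "T \<in> rep_vN"
  shows "lift (\<lambda>x. S x - T x) y = lift S y - lift T y"
  by (rule lift_eqI)
    (use assms in \<open>simp_all add: rep_vN_minus commutant_bclinear lam_one_lift adj_intertwiner_lift
      bclinear_diff[OF bclinear_lam] bclinear_diff[OF bclinear_adj] intertwiner_bclinear\<close>)

lemma lift_scale:
  assumes "T \<in> rep_vN"
  shows "lift (\<lambda>x. c *\<^sub>C T x) y = c *\<^sub>C lift T y"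
  by (rule lift_eqI)
    (use assms in \<open>simp_all add: rep_vN_scale commutant_bclinear lam_one_lift adj_intertwiner_lift
      bclinear_scaleC[OF bclinear_lam] bclinear_scaleC[OF bclinear_adj] intertwiner_bclinear\<close>)

lemma lift_compose:
  assumes "S \<in> rep_vN" "T \<in> rep_vN"
  shows "lift (\<lambda>x. S (T x)) y = lift S (lift T y)"
  by (rule lift_eqI)
    (use assms in \<open>simp_all add: commutant_compose commutant_bclinear lam_one_lift adj_intertwiner_lift\<close>)

lemma lift_ident: "lift (\<lambda>x. x) y = lam \<one> y"
  by (rule lift_eqI) (simp_all add: commutant_ident adj_intertwiner_lam_one)

lemma lift_rep: "g \<in> carrier G \<Longrightarrow> lift (\<pi> g) y = lam g y"
  by (rule lift_eqI) (simp_all add: rep_in_vN adj_intertwiner)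

lemma lift_rho:
  assumes T: "T \<in> rep_vN" and g: "g \<in> carrier G"
  shows "lift T (rho g y) = rho g (lift T y)"
proof (rule lift_eqI[OF T])
  show "lam \<one> (rho g (lift T y)) = rho g (lift T y)" using g by simp
  fix w assume w: "intertwiner w"
  have "intertwiner (\<lambda>f. rho (inv g) (w f))"
    by (rule intertwiner_compose_left[of "rho (inv g)", OF rho_in_lam_commutant w]) (use g in simp)
  from adj_intertwiner_lift[OF T this, of y]
  show "adj w (rho g (lift T y)) = T (adj w (rho g y))"
    unfolding adj_rho_compose[OF w g] .
qed

lemma lift_in_rho_commutant: "T \<in> rep_vN \<Longrightarrow> lift T \<in> rho_commutant"
  by (rule commutantI) (auto simp: bclinear_lift commutant_bclinear lift_rho)

lemma intertwiner_lift:
  assumes T: "T \<in> rep_vN" and w: "intertwiner w"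
  shows "w (T f) = lift T (w f)"
proof (rule cinner_eqI)
  fix z
  note bT = commutant_bclinear[OF T] and bw = intertwiner_bclinear[OF w]
  have "cinner z (lift T (w f)) = cinner (adj w (lift (adj T) z)) f"
    using cinner_adj_left[OF bclinear_lift[OF bT], of z "w f"]
    by (simp add: adj_lift[OF bT] cinner_adj_left[OF bw])
  also have "\<dots> = cinner z (w (T f))"
    by (simp add: adj_intertwiner_lift[OF rep_vN_adj[OF T] w] cinner_adj_left[OF bT] cinner_adj_left[OF bw])
  finally show "cinner z (w (T f)) = cinner z (lift T (w f))" by simp
qed

text \<open>
  \<open>\<delta>\<^sub>1\<close> is separating: an operator commuting with right translations and killing \<open>\<delta>\<^sub>1\<close> kills all \<open>\<delta>\<^sub>g\<close>.
\<close>

lemma lift_eq_zero: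
  assumes T: "T \<in> rep_vN" and 0: "lift T (basis \<one>) = 0"
  shows "T f = 0"
proof -
  note bT = commutant_bclinear[OF T]
  have ker: "lift T (basis g) = 0" if g: "g \<in> carrier G" for g
    using g lift_rho[OF T, of "inv g" "basis \<one>"] by (simp add: 0 bclinear_zero[OF bclinear_rho])
  have "lift T (\<theta> f) = 0"
    by (rule ell2_op_eq_zero[OF bclinear_lift[OF bT] ker intertwiner_lam_one[OF \<theta>(1)]])
  then have "\<theta> (T f) = 0" by (simp add: intertwiner_lift[OF T \<theta>(1)])
  then show ?thesis by (metis \<theta>(2) norm_eq_zero)
qed

section \<open>The trace\<close>

definition tau :: "('h \<Rightarrow> 'h) \<Rightarrow> complex" where
  "tau T = coord (lift T (basis \<one>)) \<one>"

text \<open>This series of vector functionals makes \<open>\<tau>\<close> ultraweakly continuous and positive.\<close>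

lemma tau_sums:
  "bclinear T \<Longrightarrow> (\<lambda>k. cinner (T (adj (piece k) (basis \<one>))) (adj (piece k) (basis \<one>))) sums tau T"
  using lift_sums[of T "basis \<one>" "basis \<one>"] by (simp add: tau_def cinner_basis_right)

lemma tau_suminf: "T \<in> rep_vN \<Longrightarrow>
    (\<Sum>k. cinner (T (adj (piece k) (basis \<one>))) (adj (piece k) (basis \<one>))) = tau T"
  using tau_sums[OF commutant_bclinear] by (simp add: sums_iff)

lemma tau_plus: "S \<in> rep_vN \<Longrightarrow> T \<in> rep_vN \<Longrightarrow> tau (\<lambda>x. S x + T x) = tau S + tau T"
  by (simp add: tau_def lift_plus)

lemma tau_scale: "T \<in> rep_vN \<Longrightarrow> tau (\<lambda>x. c *\<^sub>C T x) = c * tau T"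
  by (simp add: tau_def lift_scale)

lemma summable_pieces: "summable (\<lambda>k. (norm (adj (piece k) (basis \<one>)))\<^sup>2)"
  using parseval_pieces by (rule sums_summable)

lemma tau_commute:
  assumes "S \<in> rep_vN" "T \<in> rep_vN"
  shows "tau (\<lambda>x. S (T x)) = tau (\<lambda>x. T (S x))"
  using trace_commute_rho[of "lift S" "lift T"] assms
  by (simp add: tau_def lift_compose lift_in_rho_commutant)

lemma tau_ident: "tau (\<lambda>x. x) = 1"
  by (simp add: tau_def lift_ident coord_basis)

lemma tau_pos:
  assumes T: "bclinear T" and pos: "positive_op T"
  shows "tau T \<in> \<real>\<^sub>\<ge>\<^sub>0"
proof -
  let ?t = "\<lambda>k. cinner (T (adj (piece k) (basis \<one>))) (adj (piece k) (basis \<one>))"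
  have t: "Re (?t k) \<ge> 0" "Im (?t k) = 0" for k
    using pos unfolding positive_op_def by (auto simp: complex_nonneg_Reals_iff)
  have r: "(\<lambda>k. Re (?t k)) sums Re (tau T)" and i: "(\<lambda>k. Im (?t k)) sums Im (tau T)"
    using tau_sums[OF T] by (simp_all add: sums_complex_iff)
  have "0 \<le> Re (tau T)"
    unfolding sums_unique[OF r] by (rule suminf_nonneg[OF sums_summable[OF r] t(1)])
  moreover have "Im (tau T) = 0"
    using i unfolding t(2) by (simp add: sums_iff)
  ultimately show ?thesis by (simp add: complex_nonneg_Reals_iff)
qed

lemma ultraweak_open:
  assumes "summable (\<lambda>n. (norm (a n))\<^sup>2)" "summable (\<lambda>n. (norm (b n))\<^sup>2)" "open U"
  shows "openin ultraweak_topology {T. (\<Sum>n. cinner (T (a n)) (b n)) \<in> U}"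
  unfolding ultraweak_topology_def by (rule topology_generated_by_Basis) (use assms in blast)

lemma topspace_ultraweak: "topspace (ultraweak_topology :: ('h \<Rightarrow> 'h) topology) = UNIV"
proof -
  have "openin ultraweak_topology {T. (\<Sum>n. cinner (T (0::'h)) 0) \<in> UNIV}"
    by (rule ultraweak_open[of "\<lambda>_. 0" "\<lambda>_. 0"]) auto
  from openin_subset[OF this] show ?thesis by auto
qed

lemma normalized_trace_tau: "normalized_trace rep_vN (restrict tau rep_vN)"
  unfolding normalized_trace_def
proof (intro conjI ballI allI impI)
  show "continuous_map (subtopology ultraweak_topology rep_vN) euclidean (restrict tau rep_vN)"
    unfolding continuous_map
  proof (intro conjI allI impI)
    fix U :: "complex set" assume "openin euclidean U"
    then have "openin ultraweak_topology
        {T. (\<Sum>n. cinner (T (adj (piece n) (basis \<one>))) (adj (piece n) (basis \<one>))) \<in> U}"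
      by (intro ultraweak_open summable_pieces) auto
    then have "openin (subtopology ultraweak_topology rep_vN)
        (rep_vN \<inter> {T. (\<Sum>n. cinner (T (adj (piece n) (basis \<one>))) (adj (piece n) (basis \<one>))) \<in> U})"
      by (rule openin_subtopology_Int2)
    moreover have "rep_vN \<inter> {T. (\<Sum>n. cinner (T (adj (piece n) (basis \<one>))) (adj (piece n) (basis \<one>))) \<in> U}
        = {T \<in> topspace (subtopology ultraweak_topology rep_vN). restrict tau rep_vN T \<in> U}"
      using tau_suminf by (auto simp: topspace_ultraweak)
    ultimately show "openin (subtopology ultraweak_topology rep_vN)
        {T \<in> topspace (subtopology ultraweak_topology rep_vN). restrict tau rep_vN T \<in> U}" by simp
  qed auto
  have "(id :: 'h \<Rightarrow> 'h) \<in> rep_vN" using commutant_ident by (simp add: id_def)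
  then show "restrict tau rep_vN id = 1" using tau_ident by (simp add: id_def)
next
  fix S T assume ST: "S \<in> rep_vN" "T \<in> rep_vN"
  then have "S \<circ> T \<in> rep_vN" "T \<circ> S \<in> rep_vN"
    unfolding o_def by (auto intro: commutant_compose)
  then show "restrict tau rep_vN (S \<circ> T) = restrict tau rep_vN (T \<circ> S)"
    using tau_commute[OF ST] by (simp add: o_def)
qed (auto simp: rep_vN_plus rep_vN_scale tau_plus tau_scale tau_pos commutant_bclinear)

text \<open>
  On vectors \<open>w\<^sup>*\<delta>\<^sub>1\<close> with an intertwiner \<open>w\<close> one has \<open>A\<^sub>nw\<^sup>*\<delta>\<^sub>1 = w\<^sup>*A\<^sub>n'\<delta>\<^sub>1\<close> for the lift \<open>A\<^sub>n'\<close> of \<open>A\<^sub>n\<close>, which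
  converges. These vectors are total, and the sequence is bounded.
\<close>

lemma strong_convergence:
  assumes A: "\<And>n. A n \<in> rep_vN" and B: "\<And>n x. norm (A n x) \<le> B * norm x"
    and lim: "(\<lambda>n. lift (A n) (basis \<one>)) \<longlonglongrightarrow> c *\<^sub>C basis \<one>"
  shows "(\<lambda>n. A n x) \<longlonglongrightarrow> c *\<^sub>C x"
proof -
  define D where "D = {x. (\<lambda>n. A n x) \<longlonglongrightarrow> c *\<^sub>C x}"
  have bA: "bclinear (A n)" for n by (rule commutant_bclinear[OF A])
  have cs: "csubspace D"
    unfolding csubspace_def
  proof (intro conjI ballI allI)
    show "0 \<in> D" by (simp add: D_def bclinear_zero[OF bA])
    show "x + y \<in> D" if "x \<in> D" "y \<in> D" for x y
      using that tendsto_add unfolding D_def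
      by (fastforce simp: bclinear_add[OF bA] scaleC_add_right)
    show "d *\<^sub>C x \<in> D" if "x \<in> D" for d x
    proof -
      have "bclinear (\<lambda>x::'h. d *\<^sub>C x)" by (rule bclinear_scale[OF bclinear_ident])
      from bclinear_tendsto[OF this] that have "(\<lambda>n. d *\<^sub>C A n x) \<longlonglongrightarrow> d *\<^sub>C c *\<^sub>C x"
        by (simp add: D_def)
      then show ?thesis by (simp add: D_def bclinear_scaleC[OF bA] scaleC_scaleC mult.commute)
    qed
  qed
  have "closure D \<subseteq> D"
  proof
    fix x assume x: "x \<in> closure D"
    have "(\<lambda>n. A n x) \<longlonglongrightarrow> c *\<^sub>C x"
    proof (rule metric_LIMSEQ_I)
      fix e :: real assume e: "0 < e"
      \<comment> \<open>Replacing \<open>x\<close> by \<open>y\<close> changes \<open>A n x - c x\<close> by at most \<open>K\<close> times the distance; the summand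
        1 keeps \<open>K\<close> positive.\<close>
      define K where "K = \<bar>B\<bar> + cmod c + 1"
      define d where "d = e / (2 * K)"
      have pos: "0 < K" unfolding K_def using norm_ge_zero[of c] by linarith
      have d: "0 < d" using e pos by (simp add: d_def)
      obtain y where y: "y \<in> D" "dist y x < d" using x d closure_approachable by blast
      obtain M where M: "\<And>n. n \<ge> M \<Longrightarrow> dist (A n y) (c *\<^sub>C y) < e / 2"
        using metric_LIMSEQ_D[of "\<lambda>n. A n y" "c *\<^sub>C y" "e / 2"] y(1) e unfolding D_def by auto
      have "dist (A n x) (c *\<^sub>C x) < e" if n: "n \<ge> M" for n
      proof -
        have "A n x - c *\<^sub>C x = A n (x - y) + (A n y - c *\<^sub>C y) + c *\<^sub>C (y - x)"
          using bclinear_diff[OF bclinear_scale[OF bclinear_ident, of c], of y x]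
          by (simp add: bclinear_diff[OF bA])
        then have "norm (A n x - c *\<^sub>C x) \<le> norm (A n (x - y)) + norm (A n y - c *\<^sub>C y) + norm (c *\<^sub>C (y - x))"
          using norm_triangle_ineq[of "A n (x - y) + (A n y - c *\<^sub>C y)" "c *\<^sub>C (y - x)"]
            norm_triangle_ineq[of "A n (x - y)" "A n y - c *\<^sub>C y"] by simp
        also have "norm (A n (x - y)) \<le> \<bar>B\<bar> * norm (x - y)"
          using B[of n "x - y"] mult_right_mono[OF abs_ge_self[of B] norm_ge_zero[of "x - y"]] by linarith
        also have "norm (c *\<^sub>C (y - x)) = cmod c * norm (x - y)" by (simp add: norm_minus_commute)
        also have "norm (A n y - c *\<^sub>C y) < e / 2" using M[OF n] by (simp add: dist_norm)
        finally have "norm (A n x - c *\<^sub>C x) < e / 2 + (\<bar>B\<bar> + cmod c) * norm (x - y)"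
          by (simp add: algebra_simps)
        also have "(\<bar>B\<bar> + cmod c) * norm (x - y) \<le> K * d"
          using y(2) pos by (intro mult_mono) (auto simp: K_def dist_norm norm_minus_commute)
        also have "\<dots> = e / 2" using pos by (simp add: d_def)
        finally show ?thesis by (simp add: dist_norm)
      qed
      then show "\<exists>M. \<forall>n\<ge>M. dist (A n x) (c *\<^sub>C x) < e" by blast
    qed
    then show "x \<in> D" by (simp add: D_def)
  qed
  then have D: "closed_csubspace D"
    using cs closure_subset closed_closure unfolding closed_csubspace_def by (metis subset_antisym)
  have gen: "adj \<theta> (basis g) \<in> D" if g: "g \<in> carrier G" for g
  proof -
    let ?w = "\<lambda>f. rho (inv (inv g)) (\<theta> f)"
    have w: "intertwiner ?w"
      by (rule intertwiner_compose_left[of "rho (inv (inv g))", OF rho_in_lam_commutant \<theta>(1)]) (use g in simp)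
    have aw: "adj ?w = (\<lambda>y. adj \<theta> (rho (inv g) y))"
      by (rule adj_rho_compose[OF \<theta>(1)]) (use g in simp)
    have "(\<lambda>n. adj ?w (lift (A n) (basis \<one>))) \<longlonglongrightarrow> adj ?w (c *\<^sub>C basis \<one>)"
      by (rule bclinear_tendsto[OF bclinear_adj[OF intertwiner_bclinear[OF w]] lim])
    then have "(\<lambda>n. A n (adj ?w (basis \<one>))) \<longlonglongrightarrow> c *\<^sub>C adj ?w (basis \<one>)"
      by (simp add: adj_intertwiner_lift[OF A w] bclinear_scaleC[OF bclinear_adj[OF intertwiner_bclinear[OF w]]])
    then show ?thesis unfolding aw using g by (simp add: D_def)
  qed
  have "x - cproj D x = 0"
  proof -
    let ?z = "x - cproj D x"
    have "coord (\<theta> ?z) g = 0" for g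
    proof (cases "g \<in> carrier G")
      case True
      have "cinner ?z (adj \<theta> (basis g)) = 0" by (rule cproj_orth[OF D gen[OF True]])
      then show ?thesis
        by (simp add: cinner_adj_right[OF intertwiner_bclinear[OF \<theta>(1)]] cinner_basis_right)
    next
      case False
      then show ?thesis
        using arg_cong[OF intertwiner_lam_one[OF \<theta>(1)], of "\<lambda>f. coord f g" ?z] by (simp add: coord_lam)
    qed
    then have "\<theta> ?z = 0" by (intro ell2_eqI) simp
    then show ?thesis by (metis \<theta>(2) norm_eq_zero)
  qed
  then have "x \<in> D" using cproj_in[OF D, of x] by simp
  then show ?thesis by (simp add: D_def)
qed

end

context icc_rep
begin

lemma norm_product_summable:
  assumes "summable (\<lambda>n. (norm (a n))\<^sup>2)" "summable (\<lambda>n. (norm (b n))\<^sup>2)"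
  shows "summable (\<lambda>n. norm (a n) * norm (b n))"
proof (rule summable_comparison_test')
  show "summable (\<lambda>n. (norm (a n))\<^sup>2 + (norm (b n))\<^sup>2)" by (intro summable_add assms)
  show "norm (norm (a n) * norm (b n)) \<le> (norm (a n))\<^sup>2 + (norm (b n))\<^sup>2" for n
  proof -
    have "2 * (norm (a n) * norm (b n)) \<le> (norm (a n))\<^sup>2 + (norm (b n))\<^sup>2"
      using sum_squares_bound[of "norm (a n)" "norm (b n)"] by simp
    moreover have "0 \<le> norm (a n) * norm (b n)" by simp
    ultimately show ?thesis unfolding real_norm_def by linarith
  qed
qed

text \<open>For a subbasic open set this is dominated convergence in the series that defines the set.\<close>

lemma ultraweak_convergence:
  fixes A :: "nat \<Rightarrow> 'h \<Rightarrow> 'h"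
  assumes B: "\<And>n x. norm (A n x) \<le> B * norm x"
    and lim: "\<And>x. (\<lambda>n. A n x) \<longlonglongrightarrow> L x"
    and U: "openin ultraweak_topology U" "L \<in> U"
  shows "\<forall>\<^sub>F n in sequentially. A n \<in> U"
proof -
  have "generate_topology_on {{T. (\<Sum>n. cinner (T (a n)) (b n)) \<in> U} | (a :: nat \<Rightarrow> 'h) b U.
        summable (\<lambda>n. (norm (a n))\<^sup>2) \<and> summable (\<lambda>n. (norm (b n))\<^sup>2) \<and> open U} U"
    using U(1) unfolding ultraweak_topology_def openin_topology_generated_by_iff .
  then show ?thesis using U(2)
  proof (induction rule: generate_topology_on.induct)
    case Empty then show ?case by simp
  next
    case (Int U V) then show ?case by (auto intro: eventually_conj)
  next
    case (UN K)
    then obtain k where k: "k \<in> K" "L \<in> k" by blast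
    then have "\<forall>\<^sub>F n in sequentially. A n \<in> k" using UN by blast
    then show ?case by (rule eventually_mono) (use k in blast)
  next
    case (Basis s)
    then obtain a b :: "nat \<Rightarrow> 'h" and U where s: "s = {T. (\<Sum>n. cinner (T (a n)) (b n)) \<in> U}"
      and ab: "summable (\<lambda>n. (norm (a n))\<^sup>2)" "summable (\<lambda>n. (norm (b n))\<^sup>2)" and "open U"
      by blast
    have "(\<lambda>n. \<Sum>k. cinner (A n (a k)) (b k)) \<longlonglongrightarrow> (\<Sum>k. cinner (L (a k)) (b k))"
    proof (rule conjunct2[OF conjunct2[OF tannerys_theorem]])
      show "(\<lambda>n. cinner (A n (a k)) (b k)) \<longlonglongrightarrow> cinner (L (a k)) (b k)" for k
        by (intro tendsto_intros lim)
      have "norm (cinner (A n (a k)) (b k)) \<le> B * (norm (a k) * norm (b k))" for n k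
      proof -
        have "norm (cinner (A n (a k)) (b k)) \<le> norm (A n (a k)) * norm (b k)" by (rule cmod_cinner_le)
        also have "\<dots> \<le> (B * norm (a k)) * norm (b k)" by (intro mult_right_mono B) auto
        finally show ?thesis by (simp add: mult.assoc)
      qed
      then show "\<forall>\<^sub>F (k, n) in sequentially \<times>\<^sub>F sequentially.
          norm (cinner (A n (a k)) (b k)) \<le> B * (norm (a k) * norm (b k))"
        by (intro always_eventually) auto
      show "summable (\<lambda>k. B * (norm (a k) * norm (b k)))"
        by (intro summable_mult norm_product_summable ab)
    qed simp
    moreover note \<open>open U\<close>
    moreover have "(\<Sum>k. cinner (L (a k)) (b k)) \<in> U" using Basis s by simp
    ultimately have "\<forall>\<^sub>F n in sequentially. (\<Sum>k. cinner (A n (a k)) (b k)) \<in> U"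
      by (rule topological_tendstoD)
    then show ?case by (simp add: s)
  qed
qed

text \<open>
  Consider the operators \<open>A\<close> in the algebra that obey the norm bound of \<open>T\<close> and have the same value
  as \<open>T\<close> under both \<open>\<tau>\<close> and the trace constructed above. The vectors that their lifts assign to
  \<open>\<delta>\<^sub>1\<close> form a convex set invariant under conjugation by \<open>G\<close>. The element of smallest norm of its
  closure is therefore fixed by conjugation, so it is a multiple of \<open>\<delta>\<^sub>1\<close>, the factor being the trace
  of \<open>T\<close>. Approximating it gives a bounded sequence of such \<open>A\<close> that tends strongly, hence
  ultraweakly, to this scalar, while the value under \<open>\<tau>\<close> stays \<open>\<tau>(T)\<close>.
\<close>

lemma trace_unique:
  assumes \<tau>: "normalized_trace rep_vN \<tau>" and T: "T \<in> rep_vN"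
  shows "\<tau> T = tau T"
proof -
  have t_plus: "\<And>S T. S \<in> rep_vN \<Longrightarrow> T \<in> rep_vN \<Longrightarrow> \<tau> (\<lambda>x. S x + T x) = \<tau> S + \<tau> T"
    and t_scale: "\<And>c T. T \<in> rep_vN \<Longrightarrow> \<tau> (\<lambda>x. c *\<^sub>C T x) = c * \<tau> T"
    and t_comm: "\<And>S T. S \<in> rep_vN \<Longrightarrow> T \<in> rep_vN \<Longrightarrow> \<tau> (\<lambda>x. S (T x)) = \<tau> (\<lambda>x. T (S x))"
    and t_cont: "continuous_map (subtopology ultraweak_topology rep_vN) euclidean \<tau>"
    and t_id: "\<tau> (\<lambda>x. x) = 1"
    using \<tau> unfolding normalized_trace_def o_def id_def by blast+
  obtain B where B: "B > 0" "\<And>x. norm (T x) \<le> B * norm x"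
    by (rule bclinear_bound[OF commutant_bclinear[OF T]]) blast
  define C where "C = {A \<in> rep_vN. (\<forall>x. norm (A x) \<le> B * norm x) \<and> \<tau> A = \<tau> T \<and> tau A = tau T}"
  define vec where "vec A = lift A (basis \<one>)" for A
  have CvN: "A \<in> rep_vN" if "A \<in> C" for A using that by (simp add: C_def)
  have "convex (vec ` C)"
  proof (rule convexI)
    fix x y and u v :: real
    assume xy: "x \<in> vec ` C" "y \<in> vec ` C" and uv: "0 \<le> u" "0 \<le> v" "u + v = 1"
    obtain A A' where A: "A \<in> C" "x = vec A" "A' \<in> C" "y = vec A'" using xy by blast
    let ?A = "\<lambda>x. complex_of_real u *\<^sub>C A x + complex_of_real v *\<^sub>C A' x"
    have m: "(\<lambda>x. complex_of_real u *\<^sub>C A x) \<in> rep_vN" "(\<lambda>x. complex_of_real v *\<^sub>C A' x) \<in> rep_vN"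
      using A by (simp_all add: rep_vN_scale CvN)
    have uv': "complex_of_real u * z + complex_of_real v * z = z" for z
      by (simp add: uv(3) flip: ring_distribs of_real_add)
    have "norm (?A z) \<le> B * norm z" for z
    proof -
      have "norm (?A z) \<le> u * norm (A z) + v * norm (A' z)"
        using norm_triangle_ineq[of "complex_of_real u *\<^sub>C A z" "complex_of_real v *\<^sub>C A' z"] uv by simp
      also have "\<dots> \<le> u * (B * norm z) + v * (B * norm z)"
        using A uv by (intro add_mono mult_left_mono) (auto simp: C_def)
      also have "\<dots> = B * norm z" by (simp add: uv(3) flip: ring_distribs)
      finally show ?thesis .
    qed
    moreover have "\<tau> ?A = \<tau> T" "tau ?A = tau T"
      using A m by (simp_all add: t_plus t_scale tau_plus tau_scale CvN)
        (simp_all add: C_def uv')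
    ultimately have inC: "?A \<in> C" using rep_vN_plus[OF _ m] by (simp add: C_def)
    have "vec ?A = complex_of_real u *\<^sub>C x + complex_of_real v *\<^sub>C y"
      using A m by (simp add: vec_def lift_plus lift_scale CvN)
    then have veq: "vec ?A = u *\<^sub>R x + v *\<^sub>R y" by (simp only: scaleC_of_real)
    show "u *\<^sub>R x + v *\<^sub>R y \<in> vec ` C" unfolding veq[symmetric] by (rule imageI[OF inC])
  qed
  then have conv: "convex (closure (vec ` C))" by (rule convex_closure)
  have "T \<in> C" using T B by (simp add: C_def)
  then have ne: "closure (vec ` C) \<noteq> {}" by auto
  obtain m where m: "m \<in> closure (vec ` C)" "\<And>x. x \<in> closure (vec ` C) \<Longrightarrow> norm m \<le> norm x"
    using exists_min_norm[OF closed_closure conv ne] by metis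
  have conj: "lam h (rho h x) \<in> closure (vec ` C)" if h: "h \<in> carrier G" and x: "x \<in> closure (vec ` C)" for h x
  proof -
    have "bclinear (\<lambda>x. lam h (rho h x))" by (rule bclinear_compose[OF bclinear_lam[OF h] bclinear_rho[OF h]])
    from bclinear_continuous[OF this, of "closure (vec ` C)"]
    have "(\<lambda>x. lam h (rho h x)) ` closure (vec ` C) \<subseteq> closure ((\<lambda>x. lam h (rho h x)) ` vec ` C)"
      by (rule continuous_image_closure_subset) simp
    also have "(\<lambda>x. lam h (rho h x)) ` vec ` C \<subseteq> vec ` C"
    proof (clarify)
      fix A assume A: "A \<in> C"
      let ?A = "\<lambda>x. \<pi> h (A (\<pi> (inv h) x))"
      have h': "inv h \<in> carrier G" using h by simp
      have m1: "(\<lambda>x. A (\<pi> (inv h) x)) \<in> rep_vN"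
        by (rule commutant_compose[OF CvN[OF A] rep_in_vN[OF h']])
      have m2: "?A \<in> rep_vN" by (rule commutant_compose[OF rep_in_vN[OF h] m1])
      have "\<tau> ?A = \<tau> A" using t_comm[OF rep_in_vN[OF h] m1] h by simp
      moreover have "tau ?A = tau A" using tau_commute[OF rep_in_vN[OF h] m1] h by simp
      moreover have "norm (?A x) \<le> B * norm x" for x
      proof -
        have "norm (A (\<pi> (inv h) x)) \<le> B * norm (\<pi> (inv h) x)" using A unfolding C_def by blast
        then show ?thesis using h by simp
      qed
      ultimately have inC: "?A \<in> C" using A m2 by (simp add: C_def)
      have veq: "vec ?A = lam h (rho h (vec A))"
      proof -
        have "vec ?A = lam h (lift A (lam (inv h) (basis \<one>)))"
          unfolding vec_def
          using lift_compose[OF rep_in_vN[OF h] m1, of "basis \<one>"] lift_compose[OF CvN[OF A] rep_in_vN[OF h'], of "basis \<one>"] h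
          by (simp add: lift_rep)
        also have "lam (inv h) (basis \<one>) = rho h (basis \<one>)" using h by (simp add: rho_basis)
        also have "lift A \<dots> = rho h (vec A)" unfolding vec_def by (rule lift_rho[OF CvN[OF A] h])
        finally show ?thesis .
      qed
      show "lam h (rho h (vec A)) \<in> vec ` C" unfolding veq[symmetric] by (rule imageI[OF inC])
    qed
    finally show ?thesis using x closure_mono by blast
  qed
  have "m = coord m \<one> *\<^sub>C basis \<one>"
  proof (rule conj_invariant_vector[OF icc])
    fix h assume h: "h \<in> carrier G"
    have c: "lam h (rho h m) \<in> closure (vec ` C)" by (rule conj[OF h m(1)])
    have "norm (lam h (rho h m)) \<le> norm m"
      using norm_lam_le[OF h, of "rho h m"] norm_rho_le[OF h, of m] by linarith
    then have "norm (lam h (rho h m)) = norm m" using m(2)[OF c] by linarith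
    then show "lam h (rho h m) = m" using min_norm_unique[OF conv m c] by blast
  qed
  moreover have "coord m \<one> = tau T"
  proof -
    have "vec ` C \<subseteq> {x. cinner x (basis \<one>) = tau T}"
      by (auto simp: C_def vec_def tau_def cinner_basis_right)
    moreover have "closed {x. cinner x (basis \<one>) = tau T}"
      by (intro closed_Collect_eq continuous_intros)
    ultimately have "closure (vec ` C) \<subseteq> {x. cinner x (basis \<one>) = tau T}" by (rule closure_minimal)
    then show ?thesis using m(1) by (auto simp: cinner_basis_right)
  qed
  ultimately have m_eq: "m = tau T *\<^sub>C basis \<one>" by simp
  obtain X where X: "\<And>n. X n \<in> vec ` C" "X \<longlonglongrightarrow> m" using m(1) unfolding closure_sequential by blast
  then have "\<forall>n. \<exists>A\<in>C. X n = vec A" by blast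
  then obtain A where A: "\<And>n. A n \<in> C" "\<And>n. X n = vec (A n)" by metis
  let ?L = "\<lambda>x::'h. tau T *\<^sub>C x"
  have bd: "norm (A n x) \<le> B * norm x" for n x using A(1) unfolding C_def by blast
  have "(\<lambda>n. lift (A n) (basis \<one>)) \<longlonglongrightarrow> tau T *\<^sub>C basis \<one>"
    using X(2) unfolding A(2) vec_def m_eq .
  then have lim: "(\<lambda>n. A n x) \<longlonglongrightarrow> ?L x" for x
    by (intro strong_convergence[of A B] CvN A bd)
  have L: "?L \<in> rep_vN" by (rule rep_vN_scale[OF _ commutant_ident])
  have \<tau>L: "\<tau> ?L = tau T" using t_scale[OF commutant_ident, of "tau T"] t_id by simp
  show ?thesis
  proof (rule ccontr)
    assume neq: "\<tau> T \<noteq> tau T"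
    have "openin (subtopology ultraweak_topology rep_vN)
        {S \<in> topspace (subtopology ultraweak_topology rep_vN). \<tau> S \<in> - {\<tau> T}}"
      by (rule openin_continuous_map_preimage[OF t_cont]) auto
    then obtain U where U: "openin ultraweak_topology U"
      "{S \<in> rep_vN. \<tau> S \<in> - {\<tau> T}} = U \<inter> rep_vN"
      by (auto simp: openin_subtopology topspace_ultraweak)
    have "?L \<in> U" using U(2) L \<tau>L neq by (metis (mono_tags, lifting) ComplI IntE mem_Collect_eq singletonD)
    then have "\<forall>\<^sub>F n in sequentially. A n \<in> U"
      by (rule ultraweak_convergence[OF bd lim U(1)])
    then obtain n where "A n \<in> U" by (auto simp: eventually_sequentially)
    then have "\<tau> (A n) \<noteq> \<tau> T" using U(2) CvN[OF A(1)] by (metis (mono_tags, lifting) ComplD IntI mem_Collect_eq singletonI)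
    then show False using A(1)[of n] by (simp add: C_def)
  qed
qed

lemma tr_eq: "T \<in> rep_vN \<Longrightarrow> tr rep_vN T = tau T"
proof -
  have "tr rep_vN = restrict tau rep_vN"
    unfolding tr_def
  proof (rule the_equality[of "normalized_trace rep_vN", OF normalized_trace_tau])
    fix \<tau> assume \<tau>: "normalized_trace rep_vN \<tau>"
    then have "\<tau> \<in> extensional rep_vN" by (simp add: normalized_trace_def)
    then show "\<tau> = restrict tau rep_vN"
      by (rule extensionalityI[OF _ restrict_extensional]) (simp add: trace_unique[OF \<tau>])
  qed
  then show "T \<in> rep_vN \<Longrightarrow> tr rep_vN T = tau T" by simp
qed

end

section \<open>Projections and their commutation\<close>

lemma norm_cproj_le:
  assumes K: "closed_csubspace (K::'a::complex_hilbert set)"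
  shows "norm (cproj K x) \<le> norm x"
proof -
  have "(norm (cproj K x))\<^sup>2 = cmod (cinner x (cproj K x))"
    using cproj_orth[OF K cproj_in[OF K, of x], of x]
    by (simp add: cinner_diff_left cinner_self norm_power)
  also have "\<dots> \<le> norm x * norm (cproj K x)" by (rule cmod_cinner_le)
  finally show ?thesis
    by (cases "cproj K x = 0") (simp_all add: power2_eq_square)
qed

lemma bclinear_cproj:
  assumes K: "closed_csubspace (K::'a::complex_hilbert set)"
  shows "bclinear (cproj K)"
proof (rule bclinearI[where B = 1])
  have cs: "csubspace K" using K by (simp add: closed_csubspace_def)
  show "cproj K (x + y) = cproj K x + cproj K y" for x y
  proof (rule cproj_eqI[OF cs])
    show "cproj K x + cproj K y \<in> K" using cs cproj_in[OF K] by (simp add: csubspace_def)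
    show "cinner (x + y - (cproj K x + cproj K y)) z = 0" if "z \<in> K" for z
      using cproj_orth[OF K that, of x] cproj_orth[OF K that, of y]
      by (simp add: cinner_diff_left cinner_add_left)
  qed
  show "cproj K (c *\<^sub>C x) = c *\<^sub>C cproj K x" for c x
  proof (rule cproj_eqI[OF cs])
    show "c *\<^sub>C cproj K x \<in> K" using cs cproj_in[OF K] by (simp add: csubspace_def)
    show "cinner (c *\<^sub>C x - c *\<^sub>C cproj K x) z = 0" if "z \<in> K" for z
      using cproj_orth[OF K that, of x]
      by (simp add: cinner_diff_left cinner_scaleC_left flip: right_diff_distrib)
  qed
qed (use norm_cproj_le[OF K] in simp)

lemma cinner_cproj:
  assumes K: "closed_csubspace (K::'a::complex_hilbert set)"
  shows "cinner (cproj K x) y = cinner x (cproj K y)"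
proof -
  have "cinner (cproj K x) y = cinner (cproj K x) (cproj K y)" for x y
    using cproj_orth[OF K cproj_in[OF K, of x], of y] by (metis cinner_commute cinner_diff_left eq_iff_diff_eq_0)
  then show ?thesis by (metis cinner_commute)
qed

lemma cproj_commute:
  assumes K: "closed_csubspace (K::'a::complex_hilbert set)" and S: "bclinear S"
    and inv: "\<And>x. x \<in> K \<Longrightarrow> S x \<in> K" "\<And>x. x \<in> K \<Longrightarrow> adj S x \<in> K"
  shows "cproj K (S x) = S (cproj K x)"
proof (rule cproj_eqI)
  show "csubspace K" using K by (simp add: closed_csubspace_def)
  show "S (cproj K x) \<in> K" by (intro inv cproj_in K)
  show "cinner (S x - S (cproj K x)) z = 0" if "z \<in> K" for z
    using cproj_orth[OF K inv(2)[OF that], of x]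
    by (simp add: cinner_adj_right[OF S] bclinear_diff[OF S])
qed

lemma isometry_cinner:
  assumes v: "bclinear v" and K: "csubspace K" and iso: "\<And>x. x \<in> K \<Longrightarrow> norm (v x) = norm x"
    and xy: "x \<in> K" "y \<in> K"
  shows "cinner (v x) (v y) = cinner x y"
proof -
  have "cinner (v x) (v y) - cinner x y = 0"
  proof (rule zero_if_Re_zero[where \<phi> = "\<lambda>x. cinner (v x) (v y) - cinner x y" and K = K])
    fix x assume x: "x \<in> K"
    then have "x + y \<in> K" using K xy by (simp add: csubspace_def)
    then have "(norm (v x + v y))\<^sup>2 = (norm (x + y))\<^sup>2" using iso by (simp flip: bclinear_add[OF v])
    then have "v x \<bullet> v y = x \<bullet> y"
      using iso[OF x] iso[OF xy(2)] unfolding dot_norm by simp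
    then show "Re (cinner (v x) (v y) - cinner x y) = 0" by (simp add: Re_cinner)
  qed (use K xy in \<open>auto simp: csubspace_def bclinear_scaleC[OF v] cinner_scaleC_left algebra_simps\<close>)
  then show ?thesis by simp
qed

section \<open>Frame vectors as intertwiners\<close>

context group_rep
begin

definition analysis :: "'h \<Rightarrow> 'h \<Rightarrow> 'a ell2" where
  "analysis \<eta> f = Ell2 (\<lambda>g. if g \<in> carrier G then cinner f (\<pi> g \<eta>) else 0)"

definition partial_isometry :: "('h \<Rightarrow> 'a ell2) \<Rightarrow> bool" where
  "partial_isometry v \<longleftrightarrow> intertwiner v \<and> (\<forall>f. v (adj v (v f)) = v f)"

context
  fixes K \<eta>
  assumes \<eta>: "parseval_frame_vector G \<pi> K \<eta>"
begin

lemma frame_closed_csubspace: "closed_csubspace K"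
  and frame_csubspace: "csubspace K"
  and frame_orbit: "g \<in> carrier G \<Longrightarrow> \<pi> g \<eta> \<in> K"
  and frame_has_sum: "f \<in> K \<Longrightarrow> ((\<lambda>g. (cmod (cinner f (\<pi> g \<eta>)))\<^sup>2) has_sum (norm f)\<^sup>2) (carrier G)"
  using \<eta> by (auto simp: parseval_frame_vector_def parseval_frame_def closed_csubspace_def cinner_self)

lemma analysis_has_sum:
  "((\<lambda>g. (cmod (if g \<in> carrier G then cinner f (\<pi> g \<eta>) else 0))\<^sup>2) has_sum (norm (cproj K f))\<^sup>2) UNIV"
proof -
  have "cinner (cproj K f) (\<pi> g \<eta>) = cinner f (\<pi> g \<eta>)" if "g \<in> carrier G" for g
    using cproj_orth[OF frame_closed_csubspace frame_orbit[OF that], of f] by (simp add: cinner_diff_left)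
  then have "((\<lambda>g. (cmod (cinner f (\<pi> g \<eta>)))\<^sup>2) has_sum (norm (cproj K f))\<^sup>2) (carrier G)"
    using frame_has_sum[OF cproj_in[OF frame_closed_csubspace], of f] by (simp cong: has_sum_cong)
  then show ?thesis by (rule has_sum_cong_neutral[THEN iffD1, rotated -1]) auto
qed

lemma coord_analysis: "coord (analysis \<eta> f) g = (if g \<in> carrier G then cinner f (\<pi> g \<eta>) else 0)"
  unfolding analysis_def by (subst coord_Ell2) (use analysis_has_sum has_sum_imp_summable in auto)

lemma norm_analysis: "norm (analysis \<eta> f) = norm (cproj K f)"
proof -
  have "(norm (analysis \<eta> f))\<^sup>2 = (norm (cproj K f))\<^sup>2"
    using has_sum_unique[OF norm_ell2_has_sum[of "analysis \<eta> f", unfolded coord_analysis] analysis_has_sum] .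
  then show ?thesis by (simp add: power2_eq_iff_nonneg)
qed

lemma intertwiner_analysis: "intertwiner (analysis \<eta>)"
  unfolding intertwiner_def
proof (intro conjI ballI allI)
  show "bclinear (analysis \<eta>)"
    by (rule bclinearI[where B = 1])
      (auto intro!: ell2_eqI simp: coord_analysis cinner_add_left cinner_scaleC_left norm_analysis
        norm_cproj_le frame_closed_csubspace)
  show "analysis \<eta> (\<pi> g f) = lam g (analysis \<eta> f)" if "g \<in> carrier G" for g f
    by (rule ell2_eqI) (auto simp: coord_analysis coord_lam that cinner_rep_inv rep_mult)
qed

lemma adj_analysis_basis: "adj (analysis \<eta>) (basis \<one>) = \<eta>"
  by (rule cinner_eqI)
    (simp add: cinner_adj_right[OF intertwiner_bclinear[OF intertwiner_analysis]] cinner_basis_right coord_analysis)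

lemma norm_analysis_in: "x \<in> K \<Longrightarrow> norm (analysis \<eta> x) = norm x"
  by (simp add: norm_analysis cproj_self frame_csubspace)

lemma analysis_cproj: "analysis \<eta> (cproj K f) = analysis \<eta> f"
proof -
  have "norm (analysis \<eta> (f - cproj K f)) = norm (cproj K f - cproj K (cproj K f))"
    by (simp add: norm_analysis bclinear_diff[OF bclinear_cproj[OF frame_closed_csubspace]])
  also have "\<dots> = 0"
    by (simp add: cproj_self frame_csubspace cproj_in frame_closed_csubspace)
  finally show ?thesis by (simp add: bclinear_diff[OF intertwiner_bclinear[OF intertwiner_analysis]])
qed

text \<open>The Parseval identity on \<open>K\<close>, polarised.\<close>

lemma adj_analysis_analysis: "adj (analysis \<eta>) (analysis \<eta> f) = cproj K f"
proof (rule cinner_eqI)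
  fix z
  note b = intertwiner_bclinear[OF intertwiner_analysis]
  note cl = frame_closed_csubspace
  have "cinner z (adj (analysis \<eta>) (analysis \<eta> f))
      = cinner (analysis \<eta> (cproj K z)) (analysis \<eta> (cproj K f))"
    by (simp add: cinner_adj_right[OF b] analysis_cproj)
  also have "\<dots> = cinner (cproj K z) (cproj K f)"
    by (rule isometry_cinner[OF b frame_csubspace norm_analysis_in]) (auto intro: cproj_in cl)
  also have "\<dots> = cinner z (cproj K f)"
    by (simp add: cinner_cproj[OF cl] cproj_self[OF frame_csubspace cproj_in[OF cl]])
  finally show "cinner z (adj (analysis \<eta>) (analysis \<eta> f)) = cinner z (cproj K f)" .
qed

lemma partial_isometry_analysis: "partial_isometry (analysis \<eta>)"
  by (simp add: partial_isometry_def intertwiner_analysis adj_analysis_analysis analysis_cproj)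

end

lemma partial_isometry_intertwiner: "partial_isometry v \<Longrightarrow> intertwiner v"
  by (simp add: partial_isometry_def)

lemma partial_isometry_adj:
  assumes v: "partial_isometry v"
  shows "adj v (v (adj v y)) = adj v y"
proof (rule cinner_eqI)
  fix z
  note b = intertwiner_bclinear[OF partial_isometry_intertwiner[OF v]]
  have "cinner z (adj v (v (adj v y))) = cinner (v (adj v (v z))) y"
    by (simp add: cinner_adj_right[OF b] cinner_adj_left[OF b, symmetric])
  then show "cinner z (adj v (v (adj v y))) = cinner z (adj v y)"
    using v by (simp add: partial_isometry_def cinner_adj_right[OF b])
qed

text \<open>
  With \<open>A = wSv\<^sup>*\<close> and \<open>E = vv\<^sup>*\<close>, both in the commutant of the left translations, this is
  \<open>tr (EA) = tr (AE) = tr A\<close>, since \<open>v\<^sup>*vv\<^sup>* = v\<^sup>*\<close>.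
\<close>

lemma partial_isometry_trace:
  assumes v: "partial_isometry v" and w: "intertwiner w" and S: "S \<in> rep_commutant"
  shows "coord (v (adj v (w (S (adj v (basis \<one>)))))) \<one> = coord (w (S (adj v (basis \<one>)))) \<one>"
proof -
  note v' = partial_isometry_intertwiner[OF v]
  have E: "(\<lambda>y. v (adj v y)) \<in> lam_commutant" by (rule intertwiner_compose_adj[OF v' v'])
  have A: "(\<lambda>y. w (S (adj v y))) \<in> lam_commutant"
    by (rule intertwiner_compose_adj[OF intertwiner_compose_right[OF w S] v'])
  show ?thesis using trace_commute_lam[OF E A] by (simp add: partial_isometry_adj[OF v])
qed

section \<open>The projections onto cyclic subspaces of the commutant\<close>

definition cyc :: "'h \<Rightarrow> 'h set" where
  "cyc \<eta> = closure ((\<lambda>T. T \<eta>) ` rep_commutant)"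

lemma vproj_cyc: "vproj G \<pi> \<eta> = cproj (cyc \<eta>)"
  by (simp add: vproj_def cyc_def)

lemma commutant_in_cyc: "S \<in> rep_commutant \<Longrightarrow> S \<eta> \<in> cyc \<eta>"
  unfolding cyc_def by (rule subsetD[OF closure_subset], rule rev_image_eqI) simp_all

lemma self_in_cyc: "\<eta> \<in> cyc \<eta>"
  using commutant_in_cyc[OF commutant_ident] .

lemma rep_image_bclinear: "A \<in> \<pi> ` carrier G \<Longrightarrow> bclinear A"
  by (auto simp: bclinear_rep)

lemma cyc_closed_csubspace: "closed_csubspace (cyc \<eta>)"
proof -
  have "csubspace ((\<lambda>T. T \<eta>) ` rep_commutant)"
    unfolding csubspace_def
  proof (intro conjI ballI allI)
    have "(\<lambda>x. 0) \<in> rep_commutant"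
      by (rule commutantI) (auto simp: bclinear_zero_map bclinear_zero[OF bclinear_rep])
    then show "0 \<in> (\<lambda>T. T \<eta>) ` rep_commutant" by (rule rev_image_eqI) simp
  next
    fix x y assume "x \<in> (\<lambda>T. T \<eta>) ` rep_commutant" "y \<in> (\<lambda>T. T \<eta>) ` rep_commutant"
    then obtain S T where ST: "S \<in> rep_commutant" "T \<in> rep_commutant" "x = S \<eta>" "y = T \<eta>" by blast
    from commutant_plus[OF rep_image_bclinear ST(1,2)]
    show "x + y \<in> (\<lambda>T. T \<eta>) ` rep_commutant" by (rule rev_image_eqI) (use ST in auto)
  next
    fix c x assume "x \<in> (\<lambda>T. T \<eta>) ` rep_commutant"
    then obtain S where S: "S \<in> rep_commutant" "x = S \<eta>" by blast
    from commutant_scale[OF rep_image_bclinear S(1)]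
    show "c *\<^sub>C x \<in> (\<lambda>T. T \<eta>) ` rep_commutant" by (rule rev_image_eqI) (use S in auto)
  qed
  then show ?thesis by (simp add: closed_csubspace_def cyc_def csubspace_closure)
qed

lemma cyc_invariant:
  assumes S: "S \<in> rep_commutant" and x: "x \<in> cyc \<eta>"
  shows "S x \<in> cyc \<eta>"
proof -
  have "S ` closure ((\<lambda>T. T \<eta>) ` rep_commutant) \<subseteq> closure (S ` (\<lambda>T. T \<eta>) ` rep_commutant)"
    by (rule continuous_image_closure_subset[OF bclinear_continuous[OF commutant_bclinear[OF S], of UNIV]]) simp
  also have "S ` (\<lambda>T. T \<eta>) ` rep_commutant \<subseteq> (\<lambda>T. T \<eta>) ` rep_commutant"
  proof clarify
    fix T assume T: "T \<in> rep_commutant"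
    show "S (T \<eta>) \<in> (\<lambda>T. T \<eta>) ` rep_commutant"
      by (rule rev_image_eqI[OF commutant_compose[OF S T]]) simp
  qed
  finally show ?thesis using x closure_mono unfolding cyc_def by blast
qed

lemma vproj_in_vN: "vproj G \<pi> \<eta> \<in> rep_vN"
  unfolding vproj_cyc
proof (rule commutantI)
  show "bclinear (cproj (cyc \<eta>))" by (rule bclinear_cproj[OF cyc_closed_csubspace])
  fix S x assume S: "S \<in> rep_commutant"
  show "cproj (cyc \<eta>) (S x) = S (cproj (cyc \<eta>) x)"
    by (rule cproj_commute[OF cyc_closed_csubspace commutant_bclinear[OF S] cyc_invariant[OF S]
          cyc_invariant[OF rep_commutant_adj[OF S]]])
qed

lemma orth_cyc:
  assumes "\<And>S. S \<in> rep_commutant \<Longrightarrow> cinner x (S \<eta>) = 0" "z \<in> cyc \<eta>"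
  shows "cinner x z = 0"
  using orth_closure[of "(\<lambda>T. T \<eta>) ` rep_commutant" x z] assms unfolding cyc_def by blast

text \<open>
  The inner product of \<open>Sv\<^sup>*\<delta>\<^sub>1\<close> and \<open>Tw\<^sup>*\<delta>\<^sub>1\<close> is \<open>tr A\<close> with \<open>A = wT\<^sup>*Sv\<^sup>*\<close>, and
  \<open>tr A = tr (vv\<^sup>*A) = 0\<close> because \<open>v\<^sup>*w = 0\<close>.
\<close>

lemma cyc_orthogonal:
  assumes v: "partial_isometry v" and w: "intertwiner w" and 0: "\<And>f. adj v (w f) = 0"
    and x: "x \<in> cyc (adj v (basis \<one>))" and y: "y \<in> cyc (adj w (basis \<one>))"
  shows "cinner x y = 0"
proof -
  note v' = partial_isometry_intertwiner[OF v]
  note bv = intertwiner_bclinear[OF v'] and bw = intertwiner_bclinear[OF w]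
  have *: "cinner (S (adj v (basis \<one>))) (T (adj w (basis \<one>))) = 0"
    if S: "S \<in> rep_commutant" and T: "T \<in> rep_commutant" for S T
  proof -
    have Q: "(\<lambda>x. adj T (S x)) \<in> rep_commutant"
      by (rule commutant_compose[OF rep_commutant_adj[OF T] S])
    have "cinner (S (adj v (basis \<one>))) (T (adj w (basis \<one>)))
        = coord (w (adj T (S (adj v (basis \<one>))))) \<one>"
      by (simp add: cinner_adj_left[OF commutant_bclinear[OF T], symmetric]
          cinner_adj_right[OF bw] cinner_basis_right)
    also have "\<dots> = 0"
      using partial_isometry_trace[OF v w Q] by (simp add: 0 bclinear_zero[OF bv])
    finally show ?thesis .
  qed
  have "cinner y x = 0"
  proof (rule orth_cyc[OF _ x])
    fix S assume S: "S \<in> rep_commutant"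
    have "cinner (S (adj v (basis \<one>))) y = 0"
      by (rule orth_cyc[OF _ y]) (rule *[OF S])
    then show "cinner y (S (adj v (basis \<one>))) = 0" by (metis cinner_commute complex_cnj_zero)
  qed
  then show ?thesis by (metis cinner_commute complex_cnj_zero)
qed

lemma cyc_orthogonal_projs:
  assumes "\<And>x y. x \<in> cyc \<xi> \<Longrightarrow> y \<in> cyc \<eta> \<Longrightarrow> cinner x y = 0"
  shows "orthogonal_projs (vproj G \<pi> \<eta>) (vproj G \<pi> \<xi>)"
  unfolding orthogonal_projs_def vproj_cyc
proof
  fix x
  have "cproj (cyc \<eta>) (cproj (cyc \<xi>) x) = 0"
    by (rule cproj_eqI) (use cyc_closed_csubspace[of \<eta>] assms cproj_in[OF cyc_closed_csubspace] in
        \<open>auto simp: closed_csubspace_def csubspace_def\<close>)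
  then show "(cproj (cyc \<eta>) \<circ> cproj (cyc \<xi>)) x = 0" by simp
qed

end

context icc_rep
begin

text \<open>
  For an intertwiner \<open>w\<close> the vector \<open>w\<^sup>*v\<eta>\<close> lies in \<open>\<pi>(G)'\<eta>\<close>, as \<open>w\<^sup>*v \<in> \<pi>(G)'\<close>, and
  \<open>w\<^sup>*\<delta>\<^sub>1 - w\<^sup>*v\<eta>\<close> is orthogonal to \<open>\<pi>(G)'\<eta>\<close> by the trace property of the commutant of the left
  translations. So \<open>p\<^sub>\<eta>w\<^sup>*\<delta>\<^sub>1 = w\<^sup>*v\<eta>\<close>, which is the defining property of the lift.
\<close>

lemma lift_vproj:
  assumes v: "partial_isometry v" and \<eta>: "adj v (basis \<one>) = \<eta>"
  shows "lift (vproj G \<pi> \<eta>) (basis \<one>) = v \<eta>"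
proof (rule lift_eqI[OF vproj_in_vN])
  note v' = partial_isometry_intertwiner[OF v]
  note bv = intertwiner_bclinear[OF v']
  show "lam \<one> (v \<eta>) = v \<eta>" using v' by simp
  fix w assume w: "intertwiner w"
  note bw = intertwiner_bclinear[OF w]
  have "cproj (cyc \<eta>) (adj w (basis \<one>)) = adj w (v \<eta>)"
  proof (rule cproj_eqI)
    show "csubspace (cyc \<eta>)" using cyc_closed_csubspace by (simp add: closed_csubspace_def)
    show "adj w (v \<eta>) \<in> cyc \<eta>"
      using commutant_in_cyc[OF adj_compose_intertwiner[OF w v']] .
    fix z assume z: "z \<in> cyc \<eta>"
    show "cinner (adj w (basis \<one>) - adj w (v \<eta>)) z = 0"
    proof (rule orth_cyc[OF _ z])
      fix S assume S: "S \<in> rep_commutant"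
      have "cinner (adj w (v \<eta>)) (S \<eta>) = cinner (basis \<one>) (v (adj v (w (S (adj v (basis \<one>))))))"
        by (simp add: cinner_adj_left[OF bw] \<eta>[symmetric] cinner_adj_left[OF bv] flip: cinner_adj_right[OF bv])
      also have "\<dots> = cinner (basis \<one>) (w (S (adj v (basis \<one>))))"
        by (simp add: cinner_basis_left partial_isometry_trace[OF v w S])
      also have "\<dots> = cinner (adj w (basis \<one>)) (S \<eta>)"
        by (simp add: cinner_adj_left[OF bw] \<eta>)
      finally show "cinner (adj w (basis \<one>) - adj w (v \<eta>)) (S \<eta>) = 0" by (simp add: cinner_diff_left)
    qed
  qed
  then show "adj w (v \<eta>) = vproj G \<pi> \<eta> (adj w (basis \<one>))" by (simp add: vproj_cyc)
qed

lemma tau_vproj: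
  assumes \<eta>: "parseval_frame_vector G \<pi> K \<eta>"
  shows "tau (vproj G \<pi> \<eta>) = of_real ((norm \<eta>)\<^sup>2)"
proof -
  have "tau (vproj G \<pi> \<eta>) = cinner (analysis \<eta> \<eta>) (basis \<one>)"
    unfolding tau_def lift_vproj[OF partial_isometry_analysis[OF \<eta>] adj_analysis_basis[OF \<eta>]]
    by (simp add: cinner_basis_right)
  also have "\<dots> = cinner \<eta> \<eta>"
    by (simp add: adj_analysis_basis[OF \<eta>]
        flip: cinner_adj_right[OF intertwiner_bclinear[OF intertwiner_analysis[OF \<eta>]]])
  finally show ?thesis by (simp add: cinner_self)
qed

end

section \<open>Strong disjointness\<close>

context group_rep
begin

text \<open>
  On families with two nonzero components \<open>a \<in> K\<^sub>i\<close>, \<open>b \<in> K\<^sub>j\<close> the Parseval identity of the direct sum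
  reads \<open>\<parallel>v\<^sub>ia + v\<^sub>jb\<parallel>\<^sup>2 = \<parallel>a\<parallel>\<^sup>2 + \<parallel>b\<parallel>\<^sup>2\<close>, so the ranges of the analysis operators are orthogonal.
\<close>

lemma strongly_disjoint_analysis:
  assumes sd: "strongly_disjoint_vectors G \<pi> n K \<xi>" and ij: "i \<in> {1..n}" "j \<in> {1..n}" "i \<noteq> j"
  shows "adj (analysis (\<xi> i)) (analysis (\<xi> j) f) = 0"
proof -
  have pf: "\<And>j. j \<in> {1..n} \<Longrightarrow> parseval_frame_vector G \<pi> (K j) (\<xi> j)"
    and frame: "\<And>F. F \<in> Pi\<^sub>E {1..n} K \<Longrightarrow>
      ((\<lambda>g. (cmod (dsum_cinner {1..n} F (\<lambda>j\<in>{1..n}. \<pi> g (\<xi> j))))\<^sup>2)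
        has_sum Re (dsum_cinner {1..n} F F)) (carrier G)"
    using sd by (auto simp: strongly_disjoint_vectors_def strongly_disjoint_tuple_def parseval_frame_def)
  note pi = pf[OF ij(1)] and pj = pf[OF ij(2)]
  note bi = intertwiner_bclinear[OF intertwiner_analysis[OF pi]]
    and bj = intertwiner_bclinear[OF intertwiner_analysis[OF pj]]
  have norm_add: "(norm (analysis (\<xi> i) a + analysis (\<xi> j) b))\<^sup>2 = (norm a)\<^sup>2 + (norm b)\<^sup>2"
    if a: "a \<in> K i" and b: "b \<in> K j" for a b
  proof -
    define F where "F = (\<lambda>k\<in>{1..n}. if k = i then a else if k = j then b else 0)"
    have F: "F \<in> Pi\<^sub>E {1..n} K"
      using a b frame_csubspace[OF pf] by (auto simp: F_def csubspace_def)
    have two: "(\<Sum>k\<in>{1..n}. if k = i then x else if k = j then y else 0) = x + y" for x y :: complex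
    proof -
      have "(\<Sum>k\<in>{1..n}. if k = i then x else if k = j then y else 0)
          = (\<Sum>k\<in>{i, j}. if k = i then x else if k = j then y else 0)"
        by (rule sum.mono_neutral_right) (use ij in auto)
      then show ?thesis using ij(3) by simp
    qed
    have ds: "dsum_cinner {1..n} F (\<lambda>k\<in>{1..n}. \<pi> g (\<xi> k)) = cinner a (\<pi> g (\<xi> i)) + cinner b (\<pi> g (\<xi> j))" for g
      unfolding dsum_cinner_def two[symmetric] by (rule sum.cong) (auto simp: F_def)
    have ff: "dsum_cinner {1..n} F F = cinner a a + cinner b b"
      unfolding dsum_cinner_def two[symmetric] by (rule sum.cong) (auto simp: F_def)
    have "((\<lambda>g. (cmod (cinner a (\<pi> g (\<xi> i)) + cinner b (\<pi> g (\<xi> j))))\<^sup>2)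
        has_sum (norm a)\<^sup>2 + (norm b)\<^sup>2) (carrier G)"
      using frame[OF F] unfolding ds ff by (simp add: cinner_self)
    then have "((\<lambda>g. (cmod (coord (analysis (\<xi> i) a + analysis (\<xi> j) b) g))\<^sup>2)
        has_sum (norm a)\<^sup>2 + (norm b)\<^sup>2) UNIV"
      by (rule has_sum_cong_neutral[THEN iffD1, rotated -1])
        (auto simp: coord_analysis[OF pi] coord_analysis[OF pj])
    then show ?thesis using norm_ell2_has_sum has_sum_unique by blast
  qed
  have orth: "cinner (analysis (\<xi> i) a) (analysis (\<xi> j) b) = 0" if a: "a \<in> K i" and b: "b \<in> K j" for a b
  proof (rule zero_if_Re_zero[where K = "K i" and \<phi> = "\<lambda>a. cinner (analysis (\<xi> i) a) (analysis (\<xi> j) b)"])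
    fix a assume a: "a \<in> K i"
    show "Re (cinner (analysis (\<xi> i) a) (analysis (\<xi> j) b)) = 0"
      using norm_add[OF a b] norm_analysis_in[OF pi a] norm_analysis_in[OF pj b]
      by (simp add: Re_cinner dot_norm)
  qed (use frame_csubspace[OF pi] a in \<open>auto simp: csubspace_def bclinear_scaleC[OF bi] cinner_scaleC_left\<close>)
  show ?thesis
  proof (rule cinner_eq_zeroD)
    fix z
    have "cinner z (adj (analysis (\<xi> i)) (analysis (\<xi> j) f))
        = cinner (analysis (\<xi> i) (cproj (K i) z)) (analysis (\<xi> j) (cproj (K j) f))"
      by (simp add: cinner_adj_right[OF bi] analysis_cproj[OF pi] analysis_cproj[OF pj])
    also have "\<dots> = 0" 
      by (rule orth[OF cproj_in[OF frame_closed_csubspace[OF pi]] cproj_in[OF frame_closed_csubspace[OF pj]]])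
    finally show "cinner (adj (analysis (\<xi> i)) (analysis (\<xi> j) f)) z = 0"
      by (metis cinner_commute complex_cnj_zero)
  qed
qed

lemma strongly_disjoint_pairI:
  assumes \<xi>: "parseval_frame_vector G \<pi> UNIV \<xi>" and \<eta>: "parseval_frame_vector G \<pi> UNIV \<eta>"
    and 0: "\<And>f. adj (analysis \<xi>) (analysis \<eta> f) = 0"
  shows "strongly_disjoint_pair G \<pi> UNIV \<xi> UNIV \<eta>"
proof -
  let ?K = "\<lambda>j::nat. if j = 1 then UNIV else UNIV :: 'h set" and ?x = "\<lambda>j::nat. if j = 1 then \<xi> else \<eta>"
  have set2: "{1..2::nat} = {1, 2}" by auto
  note b\<xi> = intertwiner_bclinear[OF intertwiner_analysis[OF \<xi>]]
  have norm_add: "(norm (analysis \<xi> a + analysis \<eta> b))\<^sup>2 = (norm a)\<^sup>2 + (norm b)\<^sup>2" for a b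
  proof -
    have "cinner (analysis \<xi> a) (analysis \<eta> b) = 0"
      by (simp add: 0 flip: cinner_adj_right[OF b\<xi>])
    then have "analysis \<xi> a \<bullet> analysis \<eta> b = 0" by (metis Re_cinner zero_complex.simps(1))
    then show ?thesis
      by (simp add: dot_norm norm_analysis_in[OF \<xi>] norm_analysis_in[OF \<eta>])
  qed
  have "parseval_frame (dsum_cinner {1..2}) (Pi\<^sub>E {1..2} ?K) (carrier G) (\<lambda>g. \<lambda>j\<in>{1..2}. \<pi> g (?x j))"
    unfolding parseval_frame_def
  proof (intro conjI ballI)
    fix F assume "F \<in> Pi\<^sub>E {1..2} ?K"
    have "((\<lambda>g. (cmod (coord (analysis \<xi> (F 1) + analysis \<eta> (F 2)) g))\<^sup>2)
        has_sum (norm (F 1))\<^sup>2 + (norm (F 2))\<^sup>2) UNIV"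
      using norm_ell2_has_sum[of "analysis \<xi> (F 1) + analysis \<eta> (F 2)"] unfolding norm_add .
    then have "((\<lambda>g. (cmod (cinner (F 1) (\<pi> g \<xi>) + cinner (F 2) (\<pi> g \<eta>)))\<^sup>2)
        has_sum (norm (F 1))\<^sup>2 + (norm (F 2))\<^sup>2) (carrier G)"
      by (rule has_sum_cong_neutral[THEN iffD1, rotated -1])
        (auto simp: coord_analysis[OF \<xi>] coord_analysis[OF \<eta>])
    then show "((\<lambda>g. (cmod (dsum_cinner {1..2} F (\<lambda>j\<in>{1..2}. \<pi> g (?x j))))\<^sup>2)
        has_sum Re (dsum_cinner {1..2} F F)) (carrier G)"
      unfolding dsum_cinner_def set2 by (simp add: cinner_self)
  qed auto
  then show ?thesis
    using \<xi> \<eta> unfolding strongly_disjoint_pair_def strongly_disjoint_vectors_def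
      strongly_disjoint_tuple_def parseval_frame_vector_def by auto
qed

lemma strongly_disjoint_pairD:
  assumes "strongly_disjoint_pair G \<pi> UNIV \<xi> UNIV \<eta>"
  shows "adj (analysis \<xi>) (analysis \<eta> f) = 0"
  using strongly_disjoint_analysis[OF assms[unfolded strongly_disjoint_pair_def], of 1 2 f] by simp

end

section \<open>The conjugation\<close>

context group
begin

text \<open>
  The modular conjugation \<open>(J f)(k) = cnj (f (k\<^sup>-\<^sup>1))\<close>. It exchanges the two regular representations,
  hence their commutants, and \<open>J B\<^sup>* J\<close> and \<open>B\<close> agree on \<open>\<delta>\<^sub>1\<close>.
\<close>

definition modular_conj :: "'a ell2 \<Rightarrow> 'a ell2" where
  "modular_conj f = Ell2 (\<lambda>k. cnj (coord (pull (carrier G) (\<lambda>k. inv k) f) k))"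

lemma coord_modular_conj:
  "coord (modular_conj f) k = (if k \<in> carrier G then cnj (coord f (inv k)) else 0)"
proof -
  have inj: "inj_on (\<lambda>k. inv k) (carrier G)"
    by (rule inj_on_inverseI[of _ "\<lambda>k. inv k"]) simp
  have s: "(\<lambda>k. (cmod (cnj (coord (pull (carrier G) (\<lambda>k. inv k) f) k)))\<^sup>2) summable_on UNIV"
    by (simp add: coord_summable)
  show ?thesis
    unfolding modular_conj_def coord_Ell2[OF s] by (simp add: coord_pull[OF inj])
qed

lemma modular_conj_add: "modular_conj (f + h) = modular_conj f + modular_conj h"
  and modular_conj_scaleC: "modular_conj (c *\<^sub>C f) = cnj c *\<^sub>C modular_conj f"
  and modular_conj_basis_one: "modular_conj (basis \<one>) = basis \<one>"
  and modular_conj_involution: "modular_conj (modular_conj f) = lam \<one> f"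
  by (rule ell2_eqI; simp add: coord_modular_conj coord_basis coord_lam)+

lemma modular_conj_lam: "g \<in> carrier G \<Longrightarrow> modular_conj (lam g f) = rho g (modular_conj f)"
  by (rule ell2_eqI) (simp add: coord_modular_conj coord_lam coord_rho inv_mult_group)

lemma modular_conj_rho: "g \<in> carrier G \<Longrightarrow> modular_conj (rho g f) = lam g (modular_conj f)"
  by (rule ell2_eqI) (simp add: coord_modular_conj coord_lam coord_rho inv_mult_group)

lemma cinner_modular_conj: "cinner (modular_conj f) h = cinner (modular_conj h) f"
proof -
  have "((\<lambda>k. coord (modular_conj f) k * cnj (coord h k)) has_sum cinner (modular_conj f) h) UNIV"
    by (rule cinner_ell2_has_sum)
  then have "((\<lambda>k. cnj (coord f (inv k)) * cnj (coord h k)) has_sum cinner (modular_conj f) h) (carrier G)"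
    by (rule has_sum_cong_neutral[THEN iffD1, rotated -1]) (auto simp: coord_modular_conj)
  then have "((\<lambda>k. cnj (coord h (inv k)) * cnj (coord f k)) has_sum cinner (modular_conj f) h) (carrier G)"
    by (rule has_sum_reindex_bij_witness[THEN iffD1, of _ "\<lambda>g. inv g" "\<lambda>g. inv g", rotated -1])
      (auto simp: mult.commute)
  then have "((\<lambda>k. coord (modular_conj h) k * cnj (coord f k)) has_sum cinner (modular_conj f) h) UNIV"
    by (rule has_sum_cong_neutral[THEN iffD1, rotated -1]) (auto simp: coord_modular_conj)
  then show ?thesis using cinner_ell2_has_sum has_sum_unique by blast
qed

lemma norm_modular_conj: "norm (modular_conj f) = norm (lam \<one> f)"
proof -
  have "cinner (modular_conj f) (modular_conj f) = cinner (lam \<one> f) (lam \<one> f)"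
    using cinner_modular_conj[of f "modular_conj f"] cinner_adj_right[OF bclinear_lam, of \<one> "lam \<one> f" f]
    by (simp add: modular_conj_involution adj_lam)
  then show ?thesis unfolding cinner_self of_real_eq_iff by (simp add: power2_eq_iff_nonneg)
qed

lemma
  assumes B: "bclinear B"
  shows bclinear_conjugate: "bclinear (\<lambda>f. modular_conj (B (modular_conj f)))"
    and adj_conjugate: "adj (\<lambda>f. modular_conj (B (modular_conj f)))
      = (\<lambda>f. modular_conj (adj B (modular_conj f)))"
proof -
  obtain b where b: "b > 0" "\<And>x. norm (B x) \<le> b * norm x" by (rule bclinear_bound[OF B]) blast
  have le: "norm (modular_conj f) \<le> norm f" for f
    unfolding norm_modular_conj by (rule norm_lam_le) simp
  show 1: "bclinear (\<lambda>f. modular_conj (B (modular_conj f)))"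
  proof (rule bclinearI[where B = b])
    show "norm (modular_conj (B (modular_conj x))) \<le> b * norm x" for x
      using le[of "B (modular_conj x)"] b(2)[of "modular_conj x"] mult_left_mono[OF le[of x], of b] b(1)
      by linarith
  qed (simp_all add: modular_conj_add modular_conj_scaleC bclinear_add[OF B] bclinear_scaleC[OF B])
  show "adj (\<lambda>f. modular_conj (B (modular_conj f))) = (\<lambda>f. modular_conj (adj B (modular_conj f)))"
  proof (rule adj_eqI[OF 1])
    fix x y
    have "cinner (modular_conj (B (modular_conj x))) y = cinner (modular_conj y) (B (modular_conj x))"
      by (rule cinner_modular_conj)
    also have "\<dots> = cinner (adj B (modular_conj y)) (modular_conj x)"
      by (simp add: cinner_adj_left[OF B])
    also have "\<dots> = cinner x (modular_conj (adj B (modular_conj y)))"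
      using cinner_modular_conj[of x "adj B (modular_conj y)"] by (metis cinner_commute cinner_modular_conj)
    finally show "cinner (modular_conj (B (modular_conj x))) y = cinner x (modular_conj (adj B (modular_conj y)))" .
  qed
qed

lemma conjugate_in_lam_commutant:
  assumes B: "B \<in> commutant (rho ` carrier G)"
  shows "(\<lambda>f. modular_conj (B (modular_conj f))) \<in> commutant (lam ` carrier G)"
  by (rule commutantI)
    (auto simp: bclinear_conjugate commutant_bclinear[OF B] modular_conj_lam modular_conj_rho commutant_image[OF B])

lemma conjugate_adj_basis_one:
  assumes B: "B \<in> commutant (rho ` carrier G)"
  shows "modular_conj (adj B (modular_conj (basis \<one>))) = B (basis \<one>)"
proof (rule ell2_eqI)
  fix k
  note bB = commutant_bclinear[OF B]
  show "coord (modular_conj (adj B (modular_conj (basis \<one>)))) k = coord (B (basis \<one>)) k"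
  proof (cases "k \<in> carrier G")
    case True
    have "coord (modular_conj (adj B (basis \<one>))) k = cinner (basis (inv k)) (adj B (basis \<one>))"
      using True by (simp add: coord_modular_conj cinner_basis_left)
    also have "\<dots> = coord (B (rho k (basis \<one>))) \<one>"
      using True by (simp add: cinner_adj_right[OF bB] cinner_basis_right rho_basis)
    also have "\<dots> = coord (B (basis \<one>)) k"
      using True by (simp only: commutant_image[OF B]) (simp add: coord_rho)
    finally show ?thesis by (simp add: modular_conj_basis_one)
  next
    case False
    have "B (basis \<one>) = rho \<one> (B (basis \<one>))"
      using commutant_image[OF B, of \<one> "basis \<one>"] by (simp add: rho_basis)
    then have "coord (B (basis \<one>)) k = coord (rho \<one> (B (basis \<one>))) k" by simp
    then show ?thesis using False by (simp add: coord_modular_conj coord_rho)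
  qed
qed

end

section \<open>Frame vectors moved by unitaries of the von Neumann algebra\<close>

context icc_rep
begin

lemma adj_lift_unitary:
  assumes u: "u \<in> rep_vN" "unitary_op u"
  shows "adj (lift u) (lift u y) = lam \<one> y"
proof -
  note bu = commutant_bclinear[OF u(1)]
  have "adj u (u x) = x" for x
    by (rule cinner_eqI) (use u(2) in \<open>simp add: cinner_adj_right[OF bu] unitary_op_def\<close>)
  then show ?thesis
    using lift_compose[OF rep_vN_adj[OF u(1)] u(1), of y] by (simp add: adj_lift[OF bu] lift_ident)
qed

text \<open>
  Let \<open>U\<close> be the lift of \<open>u\<close> and \<open>X = JU\<^sup>*J\<close>, a unitary that commutes with the left translations and
  agrees with \<open>U\<close> on \<open>\<delta>\<^sub>1\<close>. Then \<open>u\<eta> = v\<^sub>\<eta>\<^sup>*X\<delta>\<^sub>1\<close>, so that \<open>u\<eta>\<close> has the isometric analysis operator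
  \<open>X\<^sup>*v\<^sub>\<eta>\<close>.
\<close>

lemma parseval_frame_vector_unitary:
  assumes \<eta>: "parseval_frame_vector G \<pi> UNIV \<eta>" and u: "u \<in> rep_vN" "unitary_op u"
  shows "parseval_frame_vector G \<pi> UNIV (u \<eta>)"
proof -
  let ?U = "lift u" and ?v = "analysis \<eta>"
  let ?X = "\<lambda>f. modular_conj (adj ?U (modular_conj f))"
  note bu = commutant_bclinear[OF u(1)]
  have U: "?U \<in> rho_commutant" by (rule lift_in_rho_commutant[OF u(1)])
  note bU = commutant_bclinear[OF U]
  have X: "?X \<in> lam_commutant"
    by (rule conjugate_in_lam_commutant[OF commutant_rho_adj[OF U]])
  note bX = commutant_bclinear[OF X]
  have v: "intertwiner ?v" by (rule intertwiner_analysis[OF \<eta>])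
  note bv = intertwiner_bclinear[OF v]
  have aX: "adj ?X y = modular_conj (?U (modular_conj y))" for y
    using adj_conjugate[OF bclinear_adj[OF bU]] adj_adj[OF bU] by simp
  have u\<eta>: "u \<eta> = adj ?v (?X (basis \<one>))"
    using adj_intertwiner_lift[OF u(1) v, of "basis \<one>"]
    by (simp add: adj_analysis_basis[OF \<eta>] conjugate_adj_basis_one[OF U])
  have co: "coord (adj ?X (?v f)) g = (if g \<in> carrier G then cinner f (\<pi> g (u \<eta>)) else 0)" for f g
  proof (cases "g \<in> carrier G")
    case True
    have "\<pi> g (u \<eta>) = adj ?v (?X (basis g))"
      using True by (simp add: u\<eta> flip: adj_intertwiner[OF v] commutant_image[OF X])
    then have "cinner f (\<pi> g (u \<eta>)) = cinner (adj ?X (?v f)) (basis g)"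
      by (simp add: cinner_adj_right[OF bv] cinner_adj_left[OF bX])
    then show ?thesis using True by (simp add: cinner_basis_right)
  next
    case False then show ?thesis by (simp add: aX coord_modular_conj)
  qed
  have nU: "norm (?U y) = norm (lam \<one> y)" for y
  proof -
    have "cinner (?U y) (?U y) = cinner (lam \<one> y) (lam \<one> y)"
      using adj_lift_unitary[OF u, of y] cinner_adj_right[OF bU, of y "?U y"] cinner_lam_one[of y "lam \<one> y"] by simp
    then show ?thesis unfolding cinner_self of_real_eq_iff by (simp add: power2_eq_iff_nonneg)
  qed
  have norm: "norm (adj ?X (?v f)) = norm f" for f
  proof -
    have "lam \<one> (modular_conj y) = modular_conj y" for y
      by (rule lam_one_eqI) (simp add: coord_modular_conj)
    then have "norm (adj ?X (?v f)) = norm (lam \<one> (?v f))"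
      by (simp add: aX norm_modular_conj nU lam_one_lift[OF bu])
    then show ?thesis using v by (simp add: norm_analysis_in[OF \<eta>])
  qed
  have "((\<lambda>g. (cmod (cinner f (\<pi> g (u \<eta>))))\<^sup>2) has_sum (norm f)\<^sup>2) (carrier G)" for f
    by (rule has_sum_cong_neutral[THEN iffD1, OF _ _ _ norm_ell2_has_sum[of "adj ?X (?v f)", unfolded norm]])
      (auto simp: co)
  then show ?thesis
    by (simp add: parseval_frame_vector_def parseval_frame_def closed_csubspace_def csubspace_UNIV cinner_self)
qed

text \<open>
  Let \<open>D = v\<^sub>\<zeta>\<^sup>*v\<^sub>\<eta> \<in> \<pi>(G)'\<close>. The trace on the commutant of the left translations gives
  \<open>\<parallel>D\<eta>\<parallel>\<^sup>2 = tr (v\<^sub>\<eta>v\<^sub>\<eta>\<^sup>*v\<^sub>\<zeta>Dv\<^sub>\<eta>\<^sup>*) = tr (v\<^sub>\<zeta>Dv\<^sub>\<eta>\<^sup>*) = \<langle>D\<eta>, \<zeta>\<rangle> = 0\<close>, and \<open>D\<close> commutes with \<open>\<pi>(G)\<close>, so it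
  vanishes on the orbit of \<open>\<eta>\<close>, which spans the space.
\<close>

lemma disjoint_if_orthogonal:
  assumes \<eta>: "parseval_frame_vector G \<pi> UNIV \<eta>" and \<zeta>: "parseval_frame_vector G \<pi> UNIV \<zeta>"
    and orth: "\<And>z. z \<in> cyc \<eta> \<Longrightarrow> cinner \<zeta> z = 0"
  shows "adj (analysis \<zeta>) (analysis \<eta> f) = 0"
proof -
  let ?v = "analysis \<eta>" and ?w = "analysis \<zeta>"
  have v: "intertwiner ?v" and w: "intertwiner ?w" by (rule intertwiner_analysis[OF \<eta>] intertwiner_analysis[OF \<zeta>])+
  note bv = intertwiner_bclinear[OF v] and bw = intertwiner_bclinear[OF w]
  define D where "D f = adj ?w (?v f)" for f
  have D: "D \<in> rep_commutant" unfolding D_def[abs_def] by (rule adj_compose_intertwiner[OF w v])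
  note bD = commutant_bclinear[OF D]
  have aD: "adj D f = adj ?v (?w f)" for f
    unfolding D_def[abs_def] by (simp add: adj_compose[OF bclinear_adj[OF bw] bv] adj_adj[OF bw])
  have "cinner (D \<eta>) (D \<eta>) = coord (?v (adj ?v (?w (D \<eta>)))) \<one>"
    by (simp add: adj_analysis_basis[OF \<eta>] aD cinner_basis_right[symmetric]
        cinner_adj_left[OF bD, symmetric] flip: cinner_adj_right[OF bv])
  also have "\<dots> = coord (?w (D \<eta>)) \<one>"
    using partial_isometry_trace[OF partial_isometry_analysis[OF \<eta>] w D]
    unfolding adj_analysis_basis[OF \<eta>] .
  also have "\<dots> = cinner (D \<eta>) \<zeta>"
    by (simp add: cinner_basis_right[symmetric] adj_analysis_basis[OF \<zeta>] flip: cinner_adj_right[OF bw])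
  also have "\<dots> = 0"
    using orth[OF commutant_in_cyc[OF D]] by (metis cinner_commute complex_cnj_zero)
  finally have D0: "D \<eta> = 0" by (simp add: cinner_self)
  have "D (adj ?v (?v f)) = 0"
  proof (rule ell2_op_eq_zero[OF bclinear_compose[OF bD bclinear_adj[OF bv]]])
    show "D (adj ?v (basis g)) = 0" if "g \<in> carrier G" for g
      using that by (simp add: adj_intertwiner_basis[OF v] adj_analysis_basis[OF \<eta>] D0
          commutant_image[OF D] bclinear_zero[OF bclinear_rep])
    show "lam \<one> (?v f) = ?v f" using v by simp
  qed
  then show ?thesis by (simp add: adj_analysis_analysis[OF \<eta>] cproj_self csubspace_UNIV D_def)
qed

lemma strongly_disjoint_iff_orthogonal:
  assumes \<eta>: "parseval_frame_vector G \<pi> UNIV \<eta>" and \<zeta>: "parseval_frame_vector G \<pi> UNIV \<zeta>"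
  shows "strongly_disjoint_pair G \<pi> UNIV \<zeta> UNIV \<eta> \<longleftrightarrow> (\<forall>z\<in>range (vproj G \<pi> \<eta>). cinner \<zeta> z = 0)"
    and "strongly_disjoint_pair G \<pi> UNIV \<zeta> UNIV \<eta> \<Longrightarrow> orthogonal_projs (vproj G \<pi> \<eta>) (vproj G \<pi> \<zeta>)"
proof -
  have "range (vproj G \<pi> \<eta>) = cyc \<eta>"
  proof
    show "range (vproj G \<pi> \<eta>) \<subseteq> cyc \<eta>"
      unfolding vproj_cyc using cproj_in[OF cyc_closed_csubspace] by blast
    show "cyc \<eta> \<subseteq> range (vproj G \<pi> \<eta>)"
      unfolding vproj_cyc using cproj_self cyc_closed_csubspace
      by (metis closed_csubspace_def rangeI subsetI)
  qed
  moreover have orth: "cinner x y = 0"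
    if "strongly_disjoint_pair G \<pi> UNIV \<zeta> UNIV \<eta>" "x \<in> cyc \<zeta>" "y \<in> cyc \<eta>" for x y
    using cyc_orthogonal[OF partial_isometry_analysis[OF \<zeta>] intertwiner_analysis[OF \<eta>]
        strongly_disjoint_pairD[OF that(1)], of x y] that(2,3)
    by (simp add: adj_analysis_basis[OF \<zeta>] adj_analysis_basis[OF \<eta>])
  moreover have "strongly_disjoint_pair G \<pi> UNIV \<zeta> UNIV \<eta>" if "\<forall>z\<in>cyc \<eta>. cinner \<zeta> z = 0"
    by (rule strongly_disjoint_pairI[OF \<zeta> \<eta> disjoint_if_orthogonal[OF \<eta> \<zeta>]]) (use that in blast)
  ultimately show "strongly_disjoint_pair G \<pi> UNIV \<zeta> UNIV \<eta> \<longleftrightarrow> (\<forall>z\<in>range (vproj G \<pi> \<eta>). cinner \<zeta> z = 0)"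
    using self_in_cyc[of \<zeta>] by auto
  show "orthogonal_projs (vproj G \<pi> \<eta>) (vproj G \<pi> \<zeta>)" if "strongly_disjoint_pair G \<pi> UNIV \<zeta> UNIV \<eta>"
    by (rule cyc_orthogonal_projs) (rule orth[OF that])
qed

lemma disjoint_orthogonal_projs:
  assumes sd: "strongly_disjoint_vectors G \<pi> n K \<xi>" and ij: "i \<in> {1..n}" "j \<in> {1..n}" "i \<noteq> j"
  shows "orthogonal_projs (vproj G \<pi> (\<xi> i)) (vproj G \<pi> (\<xi> j))"
proof (rule cyc_orthogonal_projs)
  fix x y assume xy: "x \<in> cyc (\<xi> j)" "y \<in> cyc (\<xi> i)"
  have pf: "\<And>j. j \<in> {1..n} \<Longrightarrow> parseval_frame_vector G \<pi> (K j) (\<xi> j)"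
    using sd by (auto simp: strongly_disjoint_vectors_def)
  show "cinner x y = 0"
    using cyc_orthogonal[OF partial_isometry_analysis[OF pf[OF ij(2)]] intertwiner_analysis[OF pf[OF ij(1)]]
        strongly_disjoint_analysis[OF sd ij(2,1) ij(3)[symmetric]], of x y] xy
    by (simp add: adj_analysis_basis[OF pf[OF ij(1)]] adj_analysis_basis[OF pf[OF ij(2)]])
qed

lemma rep_vN_sum:
  assumes T: "\<And>i. i \<in> I \<Longrightarrow> T i \<in> rep_vN"
  shows "(\<lambda>x. \<Sum>i\<in>I. T i x) \<in> rep_vN"
proof (rule commutantI)
  show "bclinear (\<lambda>x. \<Sum>i\<in>I. T i x)" by (rule bclinear_sum_map) (rule commutant_bclinear[OF T])
  fix A x assume A: "A \<in> rep_commutant"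
  show "(\<Sum>i\<in>I. T i (A x)) = A (\<Sum>i\<in>I. T i x)"
    unfolding bclinear_sum[OF commutant_bclinear[OF A]]
    by (rule sum.cong[OF refl commutant_commute[OF T A]])
qed

lemma tau_sum: "finite I \<Longrightarrow> (\<And>i. i \<in> I \<Longrightarrow> T i \<in> rep_vN) \<Longrightarrow> tau (\<lambda>x. \<Sum>i\<in>I. T i x) = (\<Sum>i\<in>I. tau (T i))"
proof (induction I rule: finite_induct)
  case empty
  show ?case using tau_scale[OF commutant_ident, of 0] by simp
next
  case (insert i I)
  then show ?case using tau_plus[of "T i" "\<lambda>x. \<Sum>i\<in>I. T i x"] rep_vN_sum[of I T] by simp
qed

text \<open>
  The complement \<open>r\<close> of the sum is a projection of trace zero, and the trace of \<open>r = r\<^sup>*r\<close> is the squared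
  norm of the image of \<open>\<delta>\<^sub>1\<close> under its lift.
\<close>

lemma projections_sum_to_identity:
  assumes I: "finite I" and p: "\<And>i. i \<in> I \<Longrightarrow> p i \<in> rep_vN"
    and sa: "\<And>i x y. i \<in> I \<Longrightarrow> cinner (p i x) y = cinner x (p i y)"
    and idem: "\<And>i x. i \<in> I \<Longrightarrow> p i (p i x) = p i x"
    and orth: "\<And>i j x. i \<in> I \<Longrightarrow> j \<in> I \<Longrightarrow> i \<noteq> j \<Longrightarrow> p i (p j x) = 0"
    and tr: "(\<Sum>i\<in>I. tau (p i)) = 1"
  shows "(\<Sum>i\<in>I. p i x) = x"
proof -
  let ?q = "\<lambda>x. \<Sum>i\<in>I. p i x" and ?r = "\<lambda>x. x - (\<Sum>i\<in>I. p i x)"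
  have q: "?q \<in> rep_vN" by (rule rep_vN_sum[OF p])
  have r: "?r \<in> rep_vN" by (rule rep_vN_minus[OF _ commutant_ident q])
  note br = commutant_bclinear[OF r] and bq = commutant_bclinear[OF q]
  have "p i (?q x) = p i x" if i: "i \<in> I" for i x
  proof -
    have "p i (?q x) = (\<Sum>j\<in>I. if j = i then p i x else 0)"
      unfolding bclinear_sum[OF commutant_bclinear[OF p[OF i]]]
      by (rule sum.cong) (use i in \<open>auto simp: idem orth\<close>)
    then show ?thesis using I i by simp
  qed
  then have qq: "?q (?q x) = ?q x" for x by (rule sum.cong[OF refl])
  have rr: "?r (?r x) = ?r x" for x
    using qq[of x] bclinear_diff[OF bq, of x "?q x"] by simp
  have sar: "adj ?r = ?r"
    by (rule adj_eqI[OF br]) (simp add: cinner_diff_left cinner_diff_right cinner_sum_left cinner_sum_right sa)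
  have "tau ?q = 1" by (simp add: tau_sum[OF I p] tr)
  then have "tau ?r = 0"
    unfolding tau_def using lift_minus[OF commutant_ident q, of "basis \<one>"] by (simp add: lift_ident coord_basis)
  have "cinner (lift ?r (basis \<one>)) (lift ?r (basis \<one>)) = cinner (lift ?r (lift ?r (basis \<one>))) (basis \<one>)"
    using cinner_adj_right[OF bclinear_lift[OF br], of "lift ?r (basis \<one>)" "basis \<one>"] adj_lift[OF br]
    unfolding sar by simp
  also have "\<dots> = tau ?r"
    using lift_compose[OF r r, of "basis \<one>"] unfolding rr by (simp add: tau_def cinner_basis_right)
  finally have "lift ?r (basis \<one>) = 0" using \<open>tau ?r = 0\<close> by (simp add: cinner_self)
  then have "?r x = 0" by (rule lift_eq_zero[OF r])
  then show ?thesis by simp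
qed

end

theorem proposition2p5:
  fixes G :: "('g, 'm) monoid_scheme"
    and \<pi> :: "'g \<Rightarrow> 'h::complex_hilbert \<Rightarrow> 'h"
    and \<xi>1 :: 'h
  assumes "group G" and "countable (carrier G)" and "icc_group G"
    and "\<exists>x::'h. x \<noteq> 0"
    and "unitary_rep G \<pi>"
    and "parseval_frame_vector G \<pi> UNIV \<xi>1"
  defines "M \<equiv> commutant (commutant (\<pi> ` carrier G))"
    and "p \<equiv> vproj G \<pi>"
  shows
    "(\<forall>K \<eta>. parseval_frame_vector G \<pi> K \<eta> \<longrightarrow>
        tr M (p \<eta>) = complex_of_real ((norm \<eta>)\<^sup>2)) \<and>
     (\<forall>\<eta> u. parseval_frame_vector G \<pi> UNIV \<eta> \<and> u \<in> M \<and> unitary_op u \<longrightarrow>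
        parseval_frame_vector G \<pi> UNIV (u \<eta>) \<and>
        (strongly_disjoint_pair G \<pi> UNIV (u \<eta>) UNIV \<eta> \<longleftrightarrow>
           (\<forall>v\<in>range (p \<eta>). cinner (u \<eta>) v = 0)) \<and>
        (strongly_disjoint_pair G \<pi> UNIV (u \<eta>) UNIV \<eta> \<longrightarrow>
           orthogonal_projs (p \<eta>) (p (u \<eta>)))) \<and>
     (\<forall>(N::nat) K \<xi>. N \<ge> 1 \<and> strongly_disjoint_vectors G \<pi> (N + 1) K \<xi> \<and>
        (\<Sum>i=1..N+1. (norm (\<xi> i))\<^sup>2) = 1 \<longrightarrow>
        (\<forall>i\<in>{1..N}. \<forall>j\<in>{1..N}. i \<noteq> j \<longrightarrow> orthogonal_projs (p (\<xi> i)) (p (\<xi> j))) \<and>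
        (\<lambda>x. \<Sum>i=1..N+1. p (\<xi> i) x) = id)"
proof -
  interpret group_rep G \<pi>
    using assms(1,5) by (simp add: group_rep_def group_rep_axioms_def)
  interpret icc_rep G \<pi> "analysis \<xi>1"
    by unfold_locales (use assms intertwiner_analysis norm_analysis_in in auto)
  show ?thesis
    unfolding M_def p_def
  proof (intro conjI allI impI ballI; (elim conjE)?)
    fix K \<eta> assume "parseval_frame_vector G \<pi> K \<eta>"
    then show "tr rep_vN (vproj G \<pi> \<eta>) = complex_of_real ((norm \<eta>)\<^sup>2)"
      by (simp add: tr_eq vproj_in_vN tau_vproj)
  next
    fix \<eta> u
    assume \<eta>: "parseval_frame_vector G \<pi> UNIV \<eta>" and u: "u \<in> rep_vN" "unitary_op u"
    note u\<eta> = parseval_frame_vector_unitary[OF \<eta> u]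
    show "parseval_frame_vector G \<pi> UNIV (u \<eta>)" by (rule u\<eta>)
    show "strongly_disjoint_pair G \<pi> UNIV (u \<eta>) UNIV \<eta>
        \<longleftrightarrow> (\<forall>v\<in>range (vproj G \<pi> \<eta>). cinner (u \<eta>) v = 0)"
      by (rule strongly_disjoint_iff_orthogonal(1)[OF \<eta> u\<eta>])
    show "orthogonal_projs (vproj G \<pi> \<eta>) (vproj G \<pi> (u \<eta>))"
      if "strongly_disjoint_pair G \<pi> UNIV (u \<eta>) UNIV \<eta>"
      by (rule strongly_disjoint_iff_orthogonal(2)[OF \<eta> u\<eta> that])
  next
    fix N K \<xi>
    assume sd: "strongly_disjoint_vectors G \<pi> (N + 1) K \<xi>" and sum: "(\<Sum>i=1..N+1. (norm (\<xi> i))\<^sup>2) = 1"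
    note orth = disjoint_orthogonal_projs[OF sd]
    show "orthogonal_projs (vproj G \<pi> (\<xi> i)) (vproj G \<pi> (\<xi> j))"
      if "i \<in> {1..N}" "j \<in> {1..N}" "i \<noteq> j" for i j
      using that by (intro orth) auto
    have pf: "\<And>j. j \<in> {1..N+1} \<Longrightarrow> parseval_frame_vector G \<pi> (K j) (\<xi> j)"
      using sd by (auto simp: strongly_disjoint_vectors_def)
    show "(\<lambda>x. \<Sum>i=1..N+1. vproj G \<pi> (\<xi> i) x) = id"
    proof
      fix x
      have "(\<Sum>i=1..N+1. vproj G \<pi> (\<xi> i) x) = x"
      proof (rule projections_sum_to_identity)
        show "vproj G \<pi> (\<xi> i) \<in> rep_vN" for i by (rule vproj_in_vN)
        show "cinner (vproj G \<pi> (\<xi> i) x) y = cinner x (vproj G \<pi> (\<xi> i) y)" for i x y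
          unfolding vproj_cyc by (rule cinner_cproj[OF cyc_closed_csubspace])
        show "vproj G \<pi> (\<xi> i) (vproj G \<pi> (\<xi> i) x) = vproj G \<pi> (\<xi> i) x" for i x
          unfolding vproj_cyc
          by (rule cproj_self[OF _ cproj_in[OF cyc_closed_csubspace]])
            (use cyc_closed_csubspace in \<open>simp add: closed_csubspace_def\<close>)
        show "vproj G \<pi> (\<xi> i) (vproj G \<pi> (\<xi> j) x) = 0"
          if "i \<in> {1..N+1}" "j \<in> {1..N+1}" "i \<noteq> j" for i j x
          using orth[OF that] by (simp add: orthogonal_projs_def fun_eq_iff)
        have "(\<Sum>i=1..N+1. tau (vproj G \<pi> (\<xi> i))) = (\<Sum>i=1..N+1. complex_of_real ((norm (\<xi> i))\<^sup>2))"
          by (rule sum.cong[OF refl tau_vproj[OF pf]])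
        then show "(\<Sum>i=1..N+1. tau (vproj G \<pi> (\<xi> i))) = 1"
          using sum by (simp only: of_real_sum[symmetric] of_real_1)
      qed simp
      then show "(\<Sum>i=1..N+1. vproj G \<pi> (\<xi> i) x) = id x" by simp
    qed
  qed
qed

end
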